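(* Let $q\in\mathbb{C}$ be transcendental, $\mathcal{A}=\mathcal{O}(O_q(3))$, $\Gamma=\Gamma(u)$ the $9$-dimensional bicovariant bimodule determined by the fundamental corepresentation $u$, $\Gamma_L$ its space of left-invariant elements, and $\tilde\sigma$ the second braiding on $\Gamma_L^{\otimes2}$ defined in the context. Let $\Gamma_{L,3}^{\wedge}=\bigoplus_k\Gamma_{L,3}^{\wedge k}$ be the quotient of the tensor algebra $\bigoplus_k\Gamma_L^{\otimes k}$ by the two-sided ideal generated by $\operatorname{im}(I+\tilde\sigma)\subset\Gamma_L^{\otimes2}$. Then the dimension of $\Gamma_{L,3}^{\wedge k}$ for $k=0,1,2,3,4$ equals respectively $$1,\ 9,\ 30,\ 39,\ 0.$$
   Context: **The quantum group.** Put $i'=4-i$, $\rho=(\tfrac12,0,-\tfrac12)$, and fix a square root $q^{1/2}$. With matrix units $e_{ij}$ of $M_3(\mathbb{C})$ let $$R=q\sum_{i\ne i'}e_{ii}\otimes e_{ii}+\sum_{i= i'}e_{ii}\otimes e_{ii}+\sum_{i\ne j,j'}e_{ii}\otimes e_{jj}+q^{-1}\sum_{i\neq i'}e_{i'i'}\otimes e_{ii}+(q-q^{-1})\sum_{i>j}\bigl(e_{ij}\otimes e_{ji}-q^{\rho_i-\rho_j}e_{ij}\otimes e_{i'j'}\bigr),$$ $\hat R^{ij}_{kl}=R^{ji}_{kl}$ and $C^{ij}=\delta_{ij'}q^{-\rho_i}$. $\mathcal{A}=\mathcal{O}(O_q(3))$ is the Hopf algebra generated by the entries of $u=(u^i_j)_{i,j=1}^3$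 with relations $\hat R(u\otimes u)=(u\otimes u)\hat R$, $uCu^{t}C^{-1}=I=Cu^{t}C^{-1}u$, comultiplication $\Delta(u^i_j)=\sum_k u^i_k\otimes u^k_j$, antipode $S(u)=Cu^tC^{-1}$. It is coquasitriangular with universal $r$-form $\mathbf r$ determined by $\mathbf r(u^i_j,u^k_l)=R^{ik}_{jl}$, with conventions $\mathbf r(ab,c)=\sum\mathbf r(a,c_{(1)})\mathbf r(b,c_{(2)})$, $\mathbf r(a,bc)=\sum\mathbf r(a_{(1)},c)\mathbf r(a_{(2)},b)$; thus $\hat R^{ij}_{kl}=\mathbf r(u^j_k,u^i_l)$. **The bimodule.** $\Gamma=\Gamma(u)$ is the free left $\mathcal{A}$-module with basis of left-invariant elements $\{\theta_{ij}\mid i,j=1,2,3\}$ (spanning $\Gamma_L$) and $$\theta_{ij}a=\sum_{k,l} a_{(1)}\,\mathbf r(u^k_i,a_{(2)})\,\mathbf r(a_{(3)},u^j_l)\,\theta_{kl},\qquad \Delta_R(\theta_{ij})=\sum_{k,l}\theta_{kl}\otimes u^k_i\,(u^{\rm c})^l_j,\quad (u^{\rm c})^l_j=S(u^j_l).$$ The left-invariant elements of the $k$-fold tensor product $\Gamma\otimes_{\mathcal{A}}\cdots\otimes_{\mathcal{A}}\Gamma$ form the space $\Gamma_L^{\otimes k}$ (with $\Gamma_L^{\otimes0}=\mathbb{C}$). **The second braiding.** Identify $\Gamma_L^{\otimes2}$ with $(\mathbb{C}^3)^{\otimes4}$ via $\theta_{ij}\otimes\theta_{kl}\leftrightarrow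 e_i\otimes e_j\otimes e_k\otimes e_l$. A matrix $T=(T^{ij}_{kl})$ acts by $T(e_k\otimes e_l)=\sum_{i,j} T^{ij}_{kl}e_i\otimes e_j$. Let $\check R^{ij}_{kl}=\mathbf r((u^{\rm c})^j_k,(u^{\rm c})^i_l)$ and $\grave{R}^{-}{}^{ij}_{kl}=\mathbf r(u^j_k,(u^{\rm c})^i_l)$; let $b_2=\grave{R}^{-}_2$ be $\grave{R}^{-}$ acting on the second and third factors of $(\mathbb{C}^3)^{\otimes4}$, and let $\hat R\odot\check R$ be the operator acting as $\hat R$ on the first two and as $\check R$ on the last two factors. Then $$\tilde\sigma=b_2(\hat R\odot\check R)b_2^{-1}.$$ *)

theory Defs
  imports
    Complex_Main
    "HOL-Algebra.Embedded_Algebras"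
    "HOL-Algebra.QuotRing"
    "HOL-Computational_Algebra.Polynomial"
begin

section \<open>Free algebras over the complex numbers and their quotients\<close>

text \<open>Elements of the free algebra on \<open>X\<close> are the finitely supported coefficient
  functions on words over \<open>X\<close>; the product is convolution along concatenation.
  If \<open>X\<close> is a basis of a vector space \<open>V\<close>, this is the tensor algebra of \<open>V\<close>.\<close>

definition free_alg :: "'x set \<Rightarrow> ('x list \<Rightarrow> complex) ring" where
  "free_alg X =
    \<lparr> carrier = {f. finite {w. f w \<noteq> 0} \<and> (\<forall>w. f w \<noteq> 0 \<longrightarrow> w \<in> lists X)},
      monoid.mult = (\<lambda>f g w. \<Sum>i\<le>length w. f (take i w) * g (drop i w)),
      one = (\<lambda>w. if w = [] then 1 else 0),
      zero = (\<lambda>w. 0),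
      add = (\<lambda>f g w. f w + g w) \<rparr>"

definition word :: "'x list \<Rightarrow> 'x list \<Rightarrow> complex" where
  "word w0 w = (if w = w0 then 1 else 0)"

definition homogeneous :: "'x set \<Rightarrow> nat \<Rightarrow> ('x list \<Rightarrow> complex) set" where
  "homogeneous X k = {f \<in> carrier (free_alg X). \<forall>w. f w \<noteq> 0 \<longrightarrow> length w = k}"

text \<open>The image of the complex number \<open>z\<close> in the quotient by \<open>I\<close>.\<close>

definition scalar ::
    "'x set \<Rightarrow> ('x list \<Rightarrow> complex) set \<Rightarrow> complex \<Rightarrow> ('x list \<Rightarrow> complex) set" where
  "scalar X I z = I +>\<^bsub>free_alg X\<^esub> (\<lambda>w. z * word [] w)"

lemma finite_conv_support:
  fixes f g :: "'x list \<Rightarrow> complex"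
  assumes "finite {w. f w \<noteq> 0}" "finite {w. g w \<noteq> 0}"
  shows "finite {w. (\<Sum>i\<le>length w. f (take i w) * g (drop i w)) \<noteq> 0}"
proof (rule finite_subset)
  show "{w. (\<Sum>i\<le>length w. f (take i w) * g (drop i w)) \<noteq> 0}
      \<subseteq> (\<lambda>(u, v). u @ v) ` ({w. f w \<noteq> 0} \<times> {w. g w \<noteq> 0})"
  proof
    fix w assume "w \<in> {w. (\<Sum>i\<le>length w. f (take i w) * g (drop i w)) \<noteq> 0}"
    then obtain i where "f (take i w) * g (drop i w) \<noteq> 0"
      by (metis (mono_tags, lifting) mem_Collect_eq sum.not_neutral_contains_not_neutral)
    then show "w \<in> (\<lambda>(u, v). u @ v) ` ({w. f w \<noteq> 0} \<times> {w. g w \<noteq> 0})"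
      by (intro image_eqI[where x = "(take i w, drop i w)"]) auto
  qed
  show "finite ((\<lambda>(u, v). u @ v) ` ({w. f w \<noteq> 0} \<times> {w. g w \<noteq> 0}))"
    using assms by blast
qed

lemma conv_lists:
  fixes f g :: "'x list \<Rightarrow> complex"
  assumes "\<forall>w. f w \<noteq> 0 \<longrightarrow> w \<in> lists X" "\<forall>w. g w \<noteq> 0 \<longrightarrow> w \<in> lists X"
    and "(\<Sum>i\<le>length w. f (take i w) * g (drop i w)) \<noteq> 0"
  shows "w \<in> lists X"
proof -
  obtain i where "f (take i w) * g (drop i w) \<noteq> 0"
    using assms(3) by (metis (mono_tags, lifting) sum.not_neutral_contains_not_neutral)
  then have "take i w \<in> lists X" "drop i w \<in> lists X"
    using assms(1,2) by auto
  then show ?thesis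
    by (metis append_in_lists_conv append_take_drop_id)
qed

lemma conv_assoc:
  fixes f g h :: "'x list \<Rightarrow> complex"
  shows "(\<Sum>i\<le>length w. (\<Sum>j\<le>length (take i w). f (take j (take i w)) * g (drop j (take i w)))
            * h (drop i w))
       = (\<Sum>i\<le>length w. f (take i w)
            * (\<Sum>j\<le>length (drop i w). g (take j (drop i w)) * h (drop j (drop i w))))"
proof -
  let ?n = "length w"
  let ?a = "\<lambda>i j. f (take j w) * g (drop j (take i w)) * h (drop i w)"
  have "(\<Sum>i\<le>?n. (\<Sum>j\<le>length (take i w). f (take j (take i w)) * g (drop j (take i w)))
            * h (drop i w)) = (\<Sum>i\<le>?n. \<Sum>j\<le>i. ?a i j)"
    by (auto simp: sum_distrib_right min_def intro!: sum.cong)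
  also have "\<dots> = (\<Sum>(i, j)\<in>Sigma {..?n} (\<lambda>i. {..i}). ?a i j)"
    by (simp add: sum.Sigma)
  also have "\<dots> = (\<Sum>(j, k)\<in>Sigma {..?n} (\<lambda>j. {..?n - j}). ?a (j + k) j)"
    by (rule sum.reindex_bij_witness[where i = "\<lambda>(j, k). (j + k, j)" and j = "\<lambda>(i, j). (j, i - j)"])
      auto
  also have "\<dots> = (\<Sum>j\<le>?n. \<Sum>k\<le>?n - j. ?a (j + k) j)"
    by (simp add: sum.Sigma)
  also have "\<dots> = (\<Sum>i\<le>?n. f (take i w)
            * (\<Sum>j\<le>length (drop i w). g (take j (drop i w)) * h (drop j (drop i w))))"
    by (auto simp: sum_distrib_left drop_take mult.assoc add.commute intro!: sum.cong)
  finally show ?thesis .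
qed

lemma ring_free_alg: "ring (free_alg X)"
proof (rule ringI)
  have add_fin: "finite {w. f w + g w \<noteq> 0}"
    if "finite {w. f w \<noteq> 0}" "finite {w. g w \<noteq> 0}" for f g :: "'a list \<Rightarrow> complex"
    by (rule finite_subset[OF _ finite_UnI[OF that]]) auto
  show "abelian_group (free_alg X)"
  proof (rule abelian_groupI)
    fix f assume f: "f \<in> carrier (free_alg X)"
    show "\<exists>g\<in>carrier (free_alg X). g \<oplus>\<^bsub>free_alg X\<^esub> f = \<zero>\<^bsub>free_alg X\<^esub>"
      using f by (intro bexI[where x = "\<lambda>w. - f w"]) (auto simp: free_alg_def)
  next
    fix f g assume "f \<in> carrier (free_alg X)" "g \<in> carrier (free_alg X)"
    then have "finite {w. f w \<noteq> 0}" "finite {w. g w \<noteq> 0}"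
      and "\<forall>w. f w \<noteq> 0 \<longrightarrow> w \<in> lists X" "\<forall>w. g w \<noteq> 0 \<longrightarrow> w \<in> lists X"
      by (simp_all add: free_alg_def)
    moreover from this(3,4) have "\<forall>w. f w + g w \<noteq> 0 \<longrightarrow> w \<in> lists X"
      by (metis add_0)
    ultimately show "f \<oplus>\<^bsub>free_alg X\<^esub> g \<in> carrier (free_alg X)"
      by (simp add: free_alg_def add_fin del: lists_eq_set)
  qed (auto simp: free_alg_def fun_eq_iff)
  show "monoid (free_alg X)"
  proof (rule monoidI)
    fix f g assume "f \<in> carrier (free_alg X)" "g \<in> carrier (free_alg X)"
    then show "f \<otimes>\<^bsub>free_alg X\<^esub> g \<in> carrier (free_alg X)"
      using conv_lists[of f X g] by (auto simp: free_alg_def finite_conv_support)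
  next
    show "\<one>\<^bsub>free_alg X\<^esub> \<in> carrier (free_alg X)"
      by (simp add: free_alg_def)
  next
    fix f g h
    show "f \<otimes>\<^bsub>free_alg X\<^esub> g \<otimes>\<^bsub>free_alg X\<^esub> h = f \<otimes>\<^bsub>free_alg X\<^esub> (g \<otimes>\<^bsub>free_alg X\<^esub> h)"
      by (rule ext) (use conv_assoc[where f = f and g = g and h = h] in \<open>simp add: free_alg_def\<close>)
  next
    fix f :: "'a list \<Rightarrow> complex"
    have "(\<Sum>i\<le>length w. (if take i w = [] then 1 else 0) * f (drop i w)) = f w" for w
    proof -
      have "(\<Sum>i\<le>length w. (if take i w = [] then 1 else 0) * f (drop i w))
          = (\<Sum>i\<le>length w. if i = 0 then f w else 0)"
        by (rule sum.cong) auto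
      then show ?thesis by simp
    qed
    then show "\<one>\<^bsub>free_alg X\<^esub> \<otimes>\<^bsub>free_alg X\<^esub> f = f"
      by (simp add: free_alg_def fun_eq_iff)
    have "(\<Sum>i\<le>length w. f (take i w) * (if drop i w = [] then 1 else 0)) = f w" for w
    proof -
      have "(\<Sum>i\<le>length w. f (take i w) * (if drop i w = [] then 1 else 0))
          = (\<Sum>i\<le>length w. if i = length w then f w else 0)"
        by (rule sum.cong) auto
      then show ?thesis by simp
    qed
    then show "f \<otimes>\<^bsub>free_alg X\<^esub> \<one>\<^bsub>free_alg X\<^esub> = f"
      by (simp add: free_alg_def fun_eq_iff)
  qed
qed (auto simp: free_alg_def fun_eq_iff algebra_simps sum.distrib)


section \<open>The quantum group \<open>\<O>(O\<^sub>q(3))\<close>\<close>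

text \<open>Throughout, \<open>s\<close> is the fixed square root of \<open>q\<close>, so that \<open>q = s\<^sup>2\<close>, and
  \<open>q\<close> to the power \<open>\<rho>\<^sub>i\<close> is \<open>s\<close> to the power \<open>2\<rho>\<^sub>i\<close> with \<open>2\<rho> = (1, 0, -1)\<close>.\<close>

definition idx :: "nat set" where
  "idx = {1, 2, 3}"

definition pr :: "nat \<Rightarrow> nat" where
  "pr i = 4 - i"

definition two_rho :: "nat \<Rightarrow> int" where
  "two_rho i = 2 - int i"

text \<open>Matrices on the tensor square of \<open>\<complex>\<^sup>3\<close>: \<open>T i j k l\<close> stands for \<open>T\<^sup>i\<^sup>j\<^sub>k\<^sub>l\<close>, so that
  \<open>e\<^sub>a\<^sub>b \<otimes> e\<^sub>c\<^sub>d\<close> has its only non-zero entry at upper indices \<open>a, c\<close> and lower indices \<open>b, d\<close>.\<close>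

type_synonym mat2 = "nat \<Rightarrow> nat \<Rightarrow> nat \<Rightarrow> nat \<Rightarrow> complex"

definition munit :: "nat \<Rightarrow> nat \<Rightarrow> nat \<Rightarrow> nat \<Rightarrow> mat2" where
  "munit a b c d = (\<lambda>i j k l. if i = a \<and> k = b \<and> j = c \<and> l = d then 1 else 0)"

definition Rmat :: "complex \<Rightarrow> mat2" where
  "Rmat s = (\<lambda>a b c d. let q = s\<^sup>2 in
      q * (\<Sum>i\<in>{i \<in> idx. i \<noteq> pr i}. munit i i i i a b c d)
    + (\<Sum>i\<in>{i \<in> idx. i = pr i}. munit i i i i a b c d)
    + (\<Sum>(i, j)\<in>{(i, j) \<in> idx \<times> idx. i \<noteq> j \<and> i \<noteq> pr j}. munit i i j j a b c d)
    + inverse q * (\<Sum>i\<in>{i \<in> idx. i \<noteq> pr i}. munit (pr i) (pr i) i i a b c d)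
    + (q - inverse q) * (\<Sum>(i, j)\<in>{(i, j) \<in> idx \<times> idx. i > j}.
        munit i j j i a b c d
        - s powi (two_rho i - two_rho j) * munit i j (pr i) (pr j) a b c d))"

definition Rhat :: "complex \<Rightarrow> mat2" where
  "Rhat s i j k l = Rmat s j i k l"

definition Cmat :: "complex \<Rightarrow> nat \<Rightarrow> nat \<Rightarrow> complex" where
  "Cmat s i j = (if i = pr j then s powi (- two_rho i) else 0)"

definition Cinv :: "complex \<Rightarrow> nat \<Rightarrow> nat \<Rightarrow> complex" where
  "Cinv s i j = (if i = pr j then s powi (two_rho j) else 0)"

lemma Cinv_inverse:
  assumes "s \<noteq> 0" "i \<in> idx" "j \<in> idx"
  shows "(\<Sum>k\<in>idx. Cmat s i k * Cinv s k j) = (if i = j then 1 else 0)"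
    and "(\<Sum>k\<in>idx. Cinv s i k * Cmat s k j) = (if i = j then 1 else 0)"
proof -
  have "i \<in> {1, 2, 3}" "j \<in> {1, 2, 3}"
    using assms unfolding idx_def by auto
  then show "(\<Sum>k\<in>idx. Cmat s i k * Cinv s k j) = (if i = j then 1 else 0)"
    and "(\<Sum>k\<in>idx. Cinv s i k * Cmat s k j) = (if i = j then 1 else 0)"
    unfolding idx_def Cmat_def Cinv_def pr_def two_rho_def
    by (elim insertE emptyE; simp add: assms power_int_minus)+
qed

text \<open>The letter \<open>(i, j)\<close> serves both as the generator \<open>u\<^sup>i\<^sub>j\<close> of the algebra and, further
  below, as the basis element \<open>\<theta>\<^sub>i\<^sub>j\<close> of \<open>\<Gamma>\<^sub>L\<close>.\<close>

type_synonym tens = "(nat \<times> nat) list \<Rightarrow> complex"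

definition letters :: "(nat \<times> nat) set" where
  "letters = idx \<times> idx"

abbreviation Fr :: "tens ring" where
  "Fr \<equiv> free_alg letters"

definition Oq3_rels :: "complex \<Rightarrow> tens set" where
  "Oq3_rels s =
     {(\<lambda>w. (\<Sum>m\<in>idx. \<Sum>n\<in>idx. Rhat s i j m n * word [(m, k), (n, l)] w)
          - (\<Sum>m\<in>idx. \<Sum>n\<in>idx. word [(i, m), (j, n)] w * Rhat s m n k l))
       | i j k l. {i, j, k, l} \<subseteq> idx}
   \<union> {(\<lambda>w. (\<Sum>a\<in>idx. \<Sum>b\<in>idx. \<Sum>c\<in>idx. Cmat s a b * Cinv s c j * word [(i, a), (c, b)] w)
          - (if i = j then word [] w else 0))
       | i j. {i, j} \<subseteq> idx}
   \<union> {(\<lambda>w. (\<Sum>a\<in>idx. \<Sum>b\<in>idx. \<Sum>c\<in>idx. Cmat s i a * Cinv s b c * word [(b, a), (c, j)] w)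
          - (if i = j then word [] w else 0))
       | i j. {i, j} \<subseteq> idx}"

definition Oq3_ideal :: "complex \<Rightarrow> tens set" where
  "Oq3_ideal s = Idl\<^bsub>Fr\<^esub> (Oq3_rels s)"

definition Oq3 :: "complex \<Rightarrow> tens set ring" where
  "Oq3 s = Fr Quot (Oq3_ideal s)"

definition csmult :: "complex \<Rightarrow> complex \<Rightarrow> tens set \<Rightarrow> tens set" where
  "csmult s z a = scalar letters (Oq3_ideal s) z \<otimes>\<^bsub>Oq3 s\<^esub> a"

definition ugen :: "complex \<Rightarrow> nat \<Rightarrow> nat \<Rightarrow> tens set" where
  "ugen s i j = Oq3_ideal s +>\<^bsub>Fr\<^esub> word [(i, j)]"

text \<open>\<open>coproduct s a ps\<close> says that \<open>ps\<close> is a list of pairs \<open>(a\<^sub>(\<^sub>1\<^sub>), a\<^sub>(\<^sub>2\<^sub>))\<close> whose tensors add up to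
  \<open>\<Delta>(a)\<close>. It is generated by the rules expressing that \<open>\<Delta>\<close> is the algebra homomorphism with
  the prescribed values on the \<open>u\<^sup>i\<^sub>j\<close>.\<close>

inductive coproduct :: "complex \<Rightarrow> tens set \<Rightarrow> (tens set \<times> tens set) list \<Rightarrow> bool"
  for s :: complex where
  one: "coproduct s \<one>\<^bsub>Oq3 s\<^esub> [(\<one>\<^bsub>Oq3 s\<^esub>, \<one>\<^bsub>Oq3 s\<^esub>)]"
| gen: "i \<in> idx \<Longrightarrow> j \<in> idx \<Longrightarrow> coproduct s (ugen s i j) (map (\<lambda>k. (ugen s i k, ugen s k j)) [1, 2, 3])"
| add: "coproduct s a ps \<Longrightarrow> coproduct s b qs \<Longrightarrow> coproduct s (a \<oplus>\<^bsub>Oq3 s\<^esub> b) (ps @ qs)"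
| scale: "coproduct s a ps \<Longrightarrow>
    coproduct s (csmult s z a) (map (\<lambda>(a1, a2). (csmult s z a1, a2)) ps)"
| mult: "coproduct s a ps \<Longrightarrow> coproduct s b qs \<Longrightarrow> coproduct s (a \<otimes>\<^bsub>Oq3 s\<^esub> b)
    (concat (map (\<lambda>(a1, a2). map (\<lambda>(b1, b2). (a1 \<otimes>\<^bsub>Oq3 s\<^esub> b1, a2 \<otimes>\<^bsub>Oq3 s\<^esub> b2)) qs) ps))"

definition is_counit :: "complex \<Rightarrow> (tens set \<Rightarrow> complex) \<Rightarrow> bool" where
  "is_counit s e \<longleftrightarrow>
     e \<one>\<^bsub>Oq3 s\<^esub> = 1 \<and>
     (\<forall>a\<in>carrier (Oq3 s). \<forall>b\<in>carrier (Oq3 s).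
        e (a \<oplus>\<^bsub>Oq3 s\<^esub> b) = e a + e b \<and> e (a \<otimes>\<^bsub>Oq3 s\<^esub> b) = e a * e b) \<and>
     (\<forall>z. \<forall>a\<in>carrier (Oq3 s). e (csmult s z a) = z * e a) \<and>
     (\<forall>i\<in>idx. \<forall>j\<in>idx. e (ugen s i j) = (if i = j then 1 else 0))"

definition is_antipode :: "complex \<Rightarrow> (tens set \<Rightarrow> tens set) \<Rightarrow> bool" where
  "is_antipode s S \<longleftrightarrow>
     S \<in> carrier (Oq3 s) \<rightarrow> carrier (Oq3 s) \<and>
     S \<one>\<^bsub>Oq3 s\<^esub> = \<one>\<^bsub>Oq3 s\<^esub> \<and>
     (\<forall>a\<in>carrier (Oq3 s). \<forall>b\<in>carrier (Oq3 s).
        S (a \<oplus>\<^bsub>Oq3 s\<^esub> b) = S a \<oplus>\<^bsub>Oq3 s\<^esub> S b \<and> S (a \<otimes>\<^bsub>Oq3 s\<^esub> b) = S b \<otimes>\<^bsub>Oq3 s\<^esub> S a) \<and>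
     (\<forall>z. \<forall>a\<in>carrier (Oq3 s). S (csmult s z a) = csmult s z (S a)) \<and>
     (\<forall>i\<in>idx. \<forall>j\<in>idx. S (ugen s i j) =
        (\<Oplus>\<^bsub>Oq3 s\<^esub>a\<in>idx. \<Oplus>\<^bsub>Oq3 s\<^esub>b\<in>idx. csmult s (Cmat s i a * Cinv s b j) (ugen s b a)))"

definition is_bilinear :: "complex \<Rightarrow> (tens set \<Rightarrow> tens set \<Rightarrow> complex) \<Rightarrow> bool" where
  "is_bilinear s r \<longleftrightarrow>
     (\<forall>a\<in>carrier (Oq3 s). \<forall>b\<in>carrier (Oq3 s). \<forall>c\<in>carrier (Oq3 s).
        r (a \<oplus>\<^bsub>Oq3 s\<^esub> b) c = r a c + r b c \<and> r c (a \<oplus>\<^bsub>Oq3 s\<^esub> b) = r c a + r c b) \<and>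
     (\<forall>z. \<forall>a\<in>carrier (Oq3 s). \<forall>b\<in>carrier (Oq3 s).
        r (csmult s z a) b = z * r a b \<and> r a (csmult s z b) = z * r a b)"

definition list_sum :: "complex \<Rightarrow> tens set list \<Rightarrow> tens set" where
  "list_sum s xs = foldr (\<lambda>x y. x \<oplus>\<^bsub>Oq3 s\<^esub> y) xs \<zero>\<^bsub>Oq3 s\<^esub>"

text \<open>The universal \<open>r\<close>-form: convolution-invertible, intertwining the product with the opposite
  product, multiplicative in both arguments, and with the prescribed values on generators.\<close>

definition universal_r_form ::
    "complex \<Rightarrow> (tens set \<Rightarrow> complex) \<Rightarrow> (tens set \<Rightarrow> tens set \<Rightarrow> complex) \<Rightarrow> bool" where
  "universal_r_form s e r \<longleftrightarrow>
     is_bilinear s r \<and>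
     (\<exists>r'. is_bilinear s r' \<and>
        (\<forall>a b ps qs. coproduct s a ps \<and> coproduct s b qs \<longrightarrow>
           (\<Sum>(a1, a2)\<leftarrow>ps. \<Sum>(b1, b2)\<leftarrow>qs. r a1 b1 * r' a2 b2) = e a * e b \<and>
           (\<Sum>(a1, a2)\<leftarrow>ps. \<Sum>(b1, b2)\<leftarrow>qs. r' a1 b1 * r a2 b2) = e a * e b)) \<and>
     (\<forall>a b ps qs. coproduct s a ps \<and> coproduct s b qs \<longrightarrow>
        list_sum s (concat (map (\<lambda>(a1, a2). map (\<lambda>(b1, b2).
          csmult s (r a1 b1) (a2 \<otimes>\<^bsub>Oq3 s\<^esub> b2)) qs) ps)) =
        list_sum s (concat (map (\<lambda>(a1, a2). map (\<lambda>(b1, b2).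
          csmult s (r a2 b2) (b1 \<otimes>\<^bsub>Oq3 s\<^esub> a1)) qs) ps))) \<and>
     (\<forall>a\<in>carrier (Oq3 s). \<forall>b\<in>carrier (Oq3 s). \<forall>c ps. coproduct s c ps \<longrightarrow>
        r (a \<otimes>\<^bsub>Oq3 s\<^esub> b) c = (\<Sum>(c1, c2)\<leftarrow>ps. r a c1 * r b c2) \<and>
        r c (a \<otimes>\<^bsub>Oq3 s\<^esub> b) = (\<Sum>(c1, c2)\<leftarrow>ps. r c1 b * r c2 a)) \<and>
     (\<forall>i\<in>idx. \<forall>j\<in>idx. \<forall>k\<in>idx. \<forall>l\<in>idx. r (ugen s i j) (ugen s k l) = Rmat s i k j l)"


section \<open>The second braiding and the exterior algebra\<close>

text \<open>\<open>\<Gamma>\<^sub>L\<close> is the nine-dimensional space with basis \<open>\<theta>\<^sub>i\<^sub>j\<close>, and its tensor algebra is \<open>Fr\<close>.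
  The word \<open>[(i, j), (k, l)]\<close> is \<open>\<theta>\<^sub>i\<^sub>j \<otimes> \<theta>\<^sub>k\<^sub>l = e\<^sub>i \<otimes> e\<^sub>j \<otimes> e\<^sub>k \<otimes> e\<^sub>l\<close>.\<close>

definition uc :: "complex \<Rightarrow> (tens set \<Rightarrow> tens set) \<Rightarrow> nat \<Rightarrow> nat \<Rightarrow> tens set" where
  "uc s S l j = S (ugen s j l)"

definition Rcheck ::
    "complex \<Rightarrow> (tens set \<Rightarrow> tens set) \<Rightarrow> (tens set \<Rightarrow> tens set \<Rightarrow> complex) \<Rightarrow> mat2" where
  "Rcheck s S r i j k l = r (uc s S j k) (uc s S i l)"

definition Rgrave ::
    "complex \<Rightarrow> (tens set \<Rightarrow> tens set) \<Rightarrow> (tens set \<Rightarrow> tens set \<Rightarrow> complex) \<Rightarrow> mat2" where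
  "Rgrave s S r i j k l = r (ugen s j k) (uc s S i l)"

definition on_middle :: "mat2 \<Rightarrow> tens \<Rightarrow> tens" where
  "on_middle T f = (\<lambda>w. case w of
      [(i, j), (k, l)] \<Rightarrow> if {i, j, k, l} \<subseteq> idx
        then \<Sum>m\<in>idx. \<Sum>n\<in>idx. T j k m n * f [(i, m), (n, l)] else 0
    | _ \<Rightarrow> 0)"

definition odot :: "mat2 \<Rightarrow> mat2 \<Rightarrow> tens \<Rightarrow> tens" where
  "odot T T' f = (\<lambda>w. case w of
      [(i, j), (k, l)] \<Rightarrow> if {i, j, k, l} \<subseteq> idx
        then \<Sum>a\<in>idx. \<Sum>b\<in>idx. \<Sum>c\<in>idx. \<Sum>d\<in>idx. T i j a b * T' k l c d * f [(a, b), (c, d)] else 0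
    | _ \<Rightarrow> 0)"

definition sigma_tilde ::
    "complex \<Rightarrow> (tens set \<Rightarrow> tens set) \<Rightarrow> (tens set \<Rightarrow> tens set \<Rightarrow> complex) \<Rightarrow> tens \<Rightarrow> tens" where
  "sigma_tilde s S r =
     (let b2 = on_middle (Rgrave s S r)
      in b2 \<circ> odot (Rhat s) (Rcheck s S r) \<circ> inv_into (homogeneous letters 2) b2)"

definition wedge_ideal ::
    "complex \<Rightarrow> (tens set \<Rightarrow> tens set) \<Rightarrow> (tens set \<Rightarrow> tens set \<Rightarrow> complex) \<Rightarrow> tens set" where
  "wedge_ideal s S r =
     Idl\<^bsub>Fr\<^esub> ((\<lambda>f. f \<oplus>\<^bsub>Fr\<^esub> sigma_tilde s S r f) ` homogeneous letters 2)"

definition wedge_alg ::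
    "complex \<Rightarrow> (tens set \<Rightarrow> tens set) \<Rightarrow> (tens set \<Rightarrow> tens set \<Rightarrow> complex) \<Rightarrow> tens set ring" where
  "wedge_alg s S r = Fr Quot (wedge_ideal s S r)"

definition wedge_comp ::
    "complex \<Rightarrow> (tens set \<Rightarrow> tens set) \<Rightarrow> (tens set \<Rightarrow> tens set \<Rightarrow> complex) \<Rightarrow> nat \<Rightarrow> tens set set" where
  "wedge_comp s S r k = (\<lambda>f. wedge_ideal s S r +>\<^bsub>Fr\<^esub> f) ` homogeneous letters k"

definition wedge_scalars ::
    "complex \<Rightarrow> (tens set \<Rightarrow> tens set) \<Rightarrow> (tens set \<Rightarrow> tens set \<Rightarrow> complex) \<Rightarrow> tens set set" where
  "wedge_scalars s S r = range (scalar letters (wedge_ideal s S r))"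

text \<open>The complex dimension of the \<open>k\<close>-th homogeneous component of the quotient, with the
  scalars embedded in the quotient ring.\<close>

definition wedge_dim ::
    "complex \<Rightarrow> (tens set \<Rightarrow> tens set) \<Rightarrow> (tens set \<Rightarrow> tens set \<Rightarrow> complex) \<Rightarrow> nat \<Rightarrow> nat \<Rightarrow> bool" where
  "wedge_dim s S r k n \<longleftrightarrow>
     ring.dimension (wedge_alg s S r) n (wedge_scalars s S r) (wedge_comp s S r k)"

end

theory Submission
  imports Defs "HOL-Library.Function_Algebras"
begin

text \<open>Write \<open>V = \<complex>\<^sup>3\<close> and let \<open>R\<^sub>p\<close> be \<open>Rhat\<close> acting on the tensor factors \<open>p\<close> and \<open>p + 1\<close>,
  counted from \<open>0\<close>, of a tensor power of \<open>V\<close>.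

  The antipode sends \<open>u\<^sup>i\<^sub>j\<close> to a multiple of \<open>u\<close> at the indices
  \<open>j'\<close>, \<open>i'\<close>, so bilinearity of the \<open>r\<close>-form and its values on generators express the matrices
  \<open>Rgrave\<close> and \<open>Rcheck\<close> through \<open>Rhat\<close> (\<open>Rgrave_eq\<close>, \<open>Rcheck_eq\<close>). Identifying \<open>\<theta>\<^sub>i\<^sub>j\<close> with a
  multiple of \<open>e\<^sub>i \<otimes> e\<close> at \<open>j'\<close> absorbs all primes and scalars: the \<open>k\<close>-th tensor power of \<open>\<Gamma>\<^sub>L\<close>
  becomes the \<open>2k\<close>-th tensor power of \<open>V\<close>, and the second braiding becomes
  \<open>R\<^sub>1 R\<^sub>0 R\<^sub>2 R\<^sub>1\<^sup>-\<^sup>1\<close> (\<open>encode_sigma\<close>). The braid that carries the first tensor factors of the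
  \<open>k\<close> copies of \<open>\<Gamma>\<^sub>L\<close> to the left and the second ones to the right conjugates the second braiding of
  the copies \<open>i\<close> and \<open>i + 1\<close> into \<open>R\<^sub>i R\<^sub>k\<^sub>+\<^sub>i\<close> (\<open>shuffle_rel_aux\<close>). Hence the \<open>k\<close>-th component of the
  algebra is the tensor square of the \<open>k\<close>-th tensor power of \<open>V\<close>, modulo all
  \<open>x \<otimes> y + R\<^sub>i x \<otimes> R\<^sub>i y\<close> (\<open>shuffle_pair_rels\<close>, \<open>cls_eq_iff\<close>).

  \<open>Rhat\<close> is diagonalisable with eigenvalues \<open>q\<close>, \<open>-q\<^sup>-\<^sup>1\<close> and \<open>q\<^sup>-\<^sup>2\<close>. If \<open>x\<close> and \<open>y\<close>
  are eigenvectors of \<open>R\<^sub>i\<close> for \<open>a\<close> and \<open>b\<close>, the relation reads \<open>(1 + a b) x \<otimes> y = 0\<close>. So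
  \<open>x \<otimes> y\<close> survives only if \<open>{a, b} = {q, -q\<^sup>-\<^sup>1}\<close>, and vectors with eigenvalue \<open>q\<^sup>-\<^sup>2\<close> vanish
  against everything (\<open>pair_cup\<close>). The vectors of one factor that vanish against everything in the
  other factor form an \<^emph>\<open>absorbing\<close> subspace: it is stable under all \<open>R\<^sub>i\<close> and contains all
  their \<open>q\<^sup>-\<^sup>2\<close>-eigenvectors (\<open>absorbing_left\<close>, \<open>absorbing_right\<close>). Modulo such a subspace the
  \<open>R\<^sub>i\<close> satisfy the relations of the Hecke algebra \<open>H\<^sub>k\<close>, and only the traceless tensors remain:
  the symmetric and alternating ones, of dimensions \<open>5\<close> and \<open>3\<close>, in degree two; in degree three
  the symmetric (\<open>7\<close>) and alternating (\<open>1\<close>) ones and \<open>5\<close> copies of the two-dimensional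
  representation of \<open>H\<^sub>3\<close> (\<open>spanning2\<close>, \<open>spanning3\<close>).

  The relations pair each representation of \<open>H\<^sub>k\<close> with its transpose. Degree two
  gives \<open>5 \<cdot> 3 + 3 \<cdot> 5 = 30\<close>. Degree three gives \<open>7 \<cdot> 1 + 1 \<cdot> 7 + 5 \<cdot> 5 = 39\<close>, as the two-dimensional
  representation is its own transpose. In degree four, the vectors alternating in the factors
  \<open>0, 1\<close> and also in \<open>2, 3\<close> lie in every absorbing subspace (\<open>antisym4_absorbed\<close>), so those symmetric
  in both pairs have no partner left; in what remains, one of \<open>R\<^sub>0\<close>, \<open>R\<^sub>2\<close> has eigenvalue \<open>q\<close> and the other
  \<open>-q\<^sup>-\<^sup>1\<close>, so that
  \<open>R\<^sub>0 + R\<^sub>2 = q - q\<^sup>-\<^sup>1\<close>, which no nonzero representation of \<open>H\<^sub>4\<close> admits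
  (\<open>hecke_collapse\<close>).

  \<open>Rhat\<close> is symmetric, so every \<open>g\<close> with \<open>R\<^sub>i R\<^sub>k\<^sub>+\<^sub>i g = - g\<close> for all \<open>i\<close> is
  orthogonal to the relations for the standard bilinear form. The spanning families consist of such
  vectors and are orthogonal with nonzero squares (\<open>dual_system\<close>), hence they are bases of the
  quotients (\<open>wedge_dim_dual_system\<close>). Transcendence of \<open>q\<close> makes nonzero integer polynomials in
  \<open>q\<close> nonzero (\<open>horner_nz\<close>); these occur as eigenvalue gaps, as squares of the basis vectors and as
  determinants of the linear systems.\<close>

section \<open>Tensor powers as functions on words\<close>

type_synonym vec = "nat list \<Rightarrow> complex"

definition sc :: "complex \<Rightarrow> ('a \<Rightarrow> complex) \<Rightarrow> 'a \<Rightarrow> complex" (infixr \<open>*v\<close> 75)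
  where "c *v f = (\<lambda>w. c * f w)"

lemma sc_apply [simp]: "(c *v f) w = c * f w"
  by (simp add: sc_def)

interpretation fv: vector_space "sc :: complex \<Rightarrow> ('a \<Rightarrow> complex) \<Rightarrow> 'a \<Rightarrow> complex"
  by unfold_locales (auto simp: fun_eq_iff algebra_simps)

definition words :: "nat \<Rightarrow> nat list set" where
  "words n = {w. length w = n \<and> set w \<subseteq> idx}"

definition Tens :: "nat \<Rightarrow> vec set" where
  "Tens n = {f. \<forall>w. f w \<noteq> 0 \<longrightarrow> w \<in> words n}"

lemma finite_idx [simp]: "finite idx"
  by (simp add: idx_def)

lemma finite_words [simp]: "finite (words n)"
proof -
  have "words n = {xs. set xs \<subseteq> idx \<and> length xs = n}" by (auto simp: words_def)
  then show ?thesis by (simp add: finite_lists_length_eq)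
qed

lemma words_Suc: "words (Suc n) = (\<Union>i\<in>idx. (#) i ` words n)"
  by (auto simp: words_def length_Suc_conv)

lemma words_0 [simp]: "words 0 = {[]}"
  by (auto simp: words_def)

lemma words_append: "w \<in> words (m + n) \<longleftrightarrow> take m w \<in> words m \<and> drop m w \<in> words n"
proof
  assume "w \<in> words (m + n)"
  then show "take m w \<in> words m \<and> drop m w \<in> words n"
    by (auto simp: words_def dest: in_set_takeD in_set_dropD)
next
  assume *: "take m w \<in> words m \<and> drop m w \<in> words n"
  then have "set (take m w @ drop m w) \<subseteq> idx"
    unfolding set_append by (auto simp: words_def)
  moreover have "length (take m w @ drop m w) = m + n"
    using * unfolding length_append by (auto simp: words_def)
  ultimately show "w \<in> words (m + n)" by (simp add: words_def)
qed

lemma Tens_subspace: "fv.subspace (Tens n)"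
  unfolding fv.subspace_def Tens_def by (auto, metis add_0)

lemmas Tens_intros [simp, intro] =
  fv.subspace_0[OF Tens_subspace] fv.subspace_add[OF Tens_subspace]
  fv.subspace_scale[OF Tens_subspace] fv.subspace_diff[OF Tens_subspace]

lemma Tens_eqI:
  assumes "f \<in> Tens n" "g \<in> Tens n" "\<And>w. w \<in> words n \<Longrightarrow> f w = g w"
  shows "f = g"
proof
  fix w show "f w = g w"
  proof (cases "w \<in> words n")
    case False
    then have "f w = 0" "g w = 0" using assms(1,2) unfolding Tens_def by blast+
    then show ?thesis by simp
  qed (use assms(3) in blast)
qed

lemma Tens_Cons: "f \<in> Tens (Suc n) \<Longrightarrow> (\<lambda>u. f (i # u)) \<in> Tens n"
  unfolding Tens_def words_def by fastforce

lemma Tens_Cons_notin: "f \<in> Tens n \<Longrightarrow> i \<notin> idx \<Longrightarrow> (\<lambda>u. f (i # u)) = 0"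
  unfolding Tens_def words_def by (auto simp: fun_eq_iff)

lemma word_in_Tens [simp]: "u \<in> words n \<Longrightarrow> word u \<in> Tens n"
  by (auto simp: Tens_def word_def)

lemma Tens_expand:
  assumes "f \<in> Tens n"
  shows "f = (\<Sum>u\<in>words n. f u *v word u)"
proof
  fix w
  have "(\<Sum>u\<in>words n. f u *v word u) w = (\<Sum>u\<in>words n. f u * word u w)"
    by (induction rule: infinite_finite_induct) auto
  also have "\<dots> = (\<Sum>u\<in>words n. if u = w then f u else 0)"
    by (rule sum.cong) (auto simp: word_def)
  also have "\<dots> = f w"
    using assms by (auto simp: Tens_def)
  finally show "f w = (\<Sum>u\<in>words n. f u *v word u) w" by simp
qed

lemma Tens_subset_subspace:
  assumes "fv.subspace M" "\<And>u. u \<in> words n \<Longrightarrow> word u \<in> M"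
  shows "Tens n \<subseteq> M"
proof
  fix f assume "f \<in> Tens n"
  then have "f = (\<Sum>u\<in>words n. f u *v word u)" by (rule Tens_expand)
  also have "\<dots> \<in> M"
    by (intro fv.subspace_sum fv.subspace_scale assms)
  finally show "f \<in> M" .
qed

section \<open>Local operators\<close>

text \<open>Recursion on the position makes \<open>local_op T (Suc p)\<close> act on the slices of \<open>f\<close> with a fixed first
  letter, so a law of operators at positions \<open>p, p + 1, \<dots>\<close> holds as soon as it holds for \<open>p = 0\<close>.\<close>
primrec local_op :: "mat2 \<Rightarrow> nat \<Rightarrow> vec \<Rightarrow> vec" where
  "local_op T 0 f = (\<lambda>w. case w of i # j # v \<Rightarrow> (\<Sum>m\<in>idx. \<Sum>n\<in>idx. T i j m n * f (m # n # v)) | _ \<Rightarrow> 0)"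
| "local_op T (Suc p) f = (\<lambda>w. case w of i # v \<Rightarrow> local_op T p (\<lambda>u. f (i # u)) v | [] \<Rightarrow> 0)"

lemma local_op_Nil [simp]: "local_op T p f [] = 0"
  by (cases p) auto

lemma local_op_single [simp]: "local_op T p f [i] = 0"
  by (cases p) auto

lemma local_op_0_Cons: "local_op T 0 f (i # j # v) = (\<Sum>m\<in>idx. \<Sum>n\<in>idx. T i j m n * f (m # n # v))"
  by simp

lemma local_op_Suc_Cons [simp]: "local_op T (Suc p) f (i # v) = local_op T p (\<lambda>u. f (i # u)) v"
  by simp

declare local_op.simps [simp del]

lemma local_op_add [simp]: "local_op T p (f + g) = local_op T p f + local_op T p g"
proof (induction p arbitrary: f g)
  case 0
  have "local_op T 0 (f + g) w = (local_op T 0 f + local_op T 0 g) w" for w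
    by (auto simp: local_op.simps algebra_simps sum.distrib split: list.split)
  then show ?case by blast
next
  case (Suc p)
  have "local_op T (Suc p) (f + g) w = (local_op T (Suc p) f + local_op T (Suc p) g) w" for w
    using Suc[of "\<lambda>u. f (hd w # u)" "\<lambda>u. g (hd w # u)"]
    by (cases w) (auto simp: plus_fun_def)
  then show ?case by blast
qed

lemma local_op_sc [simp]: "local_op T p (c *v f) = c *v local_op T p f"
proof (induction p arbitrary: f)
  case 0
  have "local_op T 0 (c *v f) w = (c *v local_op T 0 f) w" for w
    by (auto simp: local_op.simps algebra_simps sum_distrib_left split: list.split)
  then show ?case by blast
next
  case (Suc p)
  have "local_op T (Suc p) (c *v f) w = (c *v local_op T (Suc p) f) w" for w
    using Suc[of "\<lambda>u. f (hd w # u)"] by (cases w) (auto simp: sc_def)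
  then show ?case by blast
qed

lemma local_op_zero [simp]: "local_op T p 0 = 0"
  using local_op_sc[of T p 0 0] by (simp del: local_op_sc)

lemma local_op_diff [simp]: "local_op T p (f - g) = local_op T p f - local_op T p g"
  using local_op_add[of T p "f - g" g] by simp

lemma local_op_minus [simp]: "local_op T p (- f) = - local_op T p f"
  using local_op_diff[of T p 0 f] by (simp del: local_op_diff)

lemma local_op_sum:
  fixes g :: "'a \<Rightarrow> vec"
  shows "local_op T p (sum g A) = (\<Sum>a\<in>A. local_op T p (g a))"
  by (induction A rule: infinite_finite_induct)
    (simp_all only: sum.infinite sum.empty sum.insert local_op_zero local_op_add not_False_eq_True)

lemma sum_fun_apply: "(sum g A) w = (\<Sum>a\<in>A. g a w)"
  by (induction A rule: infinite_finite_induct) auto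

lemma local_op_commute:
  assumes "p + 2 \<le> p'"
  shows "local_op T p (local_op U p' f) = local_op U p' (local_op T p f)"
  using assms
proof (induction p arbitrary: p' f)
  case 0
  then obtain r where p': "p' = Suc (Suc r)" by (metis add_0 add_2_eq_Suc le_Suc_ex)
  show ?case
  proof
    fix w
    show "local_op T 0 (local_op U p' f) w = local_op U p' (local_op T 0 f) w"
    proof (cases w)
      case (Cons i w')
      then show ?thesis
      proof (cases w')
        case (Cons j v)
        have "(\<lambda>u. local_op T 0 f (i # j # u)) = (\<Sum>m\<in>idx. \<Sum>n\<in>idx. T i j m n *v (\<lambda>u. f (m # n # u)))"
          by (simp add: local_op_0_Cons fun_eq_iff sum_fun_apply)
        then have "local_op U p' (local_op T 0 f) w
            = (\<Sum>m\<in>idx. \<Sum>n\<in>idx. T i j m n *v local_op U r (\<lambda>u. f (m # n # u))) v"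
          unfolding p' \<open>w = i # w'\<close> Cons by (simp add: local_op_sum)
        then show ?thesis
          unfolding p' \<open>w = i # w'\<close> Cons by (simp add: local_op_0_Cons sum_fun_apply)
      qed auto
    qed auto
  qed
next
  case (Suc p)
  then obtain r where p': "p' = Suc r" and "p + 2 \<le> r" by (cases p') auto
  show ?case
  proof
    fix w
    show "local_op T (Suc p) (local_op U p' f) w = local_op U p' (local_op T (Suc p) f) w"
      using Suc.IH[OF \<open>p + 2 \<le> r\<close>] by (cases w) (auto simp: p')
  qed
qed

definition supported :: "mat2 \<Rightarrow> bool" where
  "supported T \<longleftrightarrow> (\<forall>i j m n. T i j m n \<noteq> 0 \<longrightarrow> i \<in> idx \<and> j \<in> idx \<and> m \<in> idx \<and> n \<in> idx)"

lemma local_op_Tens: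
  assumes "supported T" "f \<in> Tens n"
  shows "local_op T p f \<in> Tens n"
  using assms(2)
proof (induction p arbitrary: f n)
  case 0
  show ?case unfolding Tens_def
  proof (intro CollectI allI impI)
    fix w assume nz: "local_op T 0 f w \<noteq> 0"
    then obtain i j v where w: "w = i # j # v"
      by (cases w; cases "tl w") auto
    from nz obtain m n' where "T i j m n' * f (m # n' # v) \<noteq> 0"
      unfolding w local_op_0_Cons by (meson sum.not_neutral_contains_not_neutral)
    then show "w \<in> words n"
      using 0 assms(1) unfolding w Tens_def supported_def words_def by fastforce
  qed
next
  case (Suc p)
  show ?case unfolding Tens_def
  proof (intro CollectI allI impI)
    fix w assume nz: "local_op T (Suc p) f w \<noteq> 0"
    then obtain i v where w: "w = i # v" by (cases w) auto
    have i: "i \<in> idx"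
      using nz Tens_Cons_notin[OF Suc.prems, of i] unfolding w by (cases "i \<in> idx") auto
    have "n \<noteq> 0"
    proof
      assume "n = 0"
      then have "(\<lambda>u. f (i # u)) = 0" using Suc.prems unfolding Tens_def fun_eq_iff by fastforce
      then show False using nz w by simp
    qed
    then obtain n' where n: "n = Suc n'" by (cases n) auto
    have "local_op T p (\<lambda>u. f (i # u)) \<in> Tens n'"
      using Suc.IH Tens_Cons Suc.prems n by blast
    then have "v \<in> words n'" using nz w unfolding Tens_def by auto
    then show "w \<in> words n" using i n w by (auto simp: words_def)
  qed
qed

section \<open>Tensor products\<close>

text \<open>The first factor is meant to lie in \<open>Tens k\<close>: its degree says where words are cut.\<close>
definition tensor :: "nat \<Rightarrow> vec \<Rightarrow> vec \<Rightarrow> vec" where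
  "tensor k x y = (\<lambda>w. x (take k w) * y (drop k w))"

lemma tensor_Suc [simp]: "tensor (Suc k) x y (i # w) = tensor k (\<lambda>u. x (i # u)) y w"
  by (simp add: tensor_def)

lemma tensor_0: "tensor 0 x y w = x [] * y w"
  by (simp add: tensor_def)

lemma tensor_add_left: "tensor k (x + x') y = tensor k x y + tensor k x' y"
  and tensor_add_right: "tensor k x (y + y') = tensor k x y + tensor k x y'"
  and tensor_sc_left: "tensor k (c *v x) y = c *v tensor k x y"
  and tensor_sc_right: "tensor k x (c *v y) = c *v tensor k x y"
  and tensor_diff_left: "tensor k (x - x') y = tensor k x y - tensor k x' y"
  and tensor_diff_right: "tensor k x (y - y') = tensor k x y - tensor k x y'"
  and tensor_zero_left: "tensor k 0 y = 0"
  and tensor_zero_right: "tensor k x 0 = 0"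
  by (auto simp: tensor_def fun_eq_iff algebra_simps)

lemmas tensor_linear = tensor_add_left tensor_add_right tensor_sc_left tensor_sc_right
  tensor_diff_left tensor_diff_right tensor_zero_left tensor_zero_right

lemma tensor_Tens [intro]: "x \<in> Tens k \<Longrightarrow> y \<in> Tens n \<Longrightarrow> tensor k x y \<in> Tens (k + n)"
  unfolding Tens_def tensor_def by (auto simp: words_append)

lemma tensor_assoc: "tensor (k + l) (tensor k x y) z = tensor k x (tensor l y z)"
  by (simp add: tensor_def fun_eq_iff drop_take mult.assoc add.commute)

lemma tensor_word: "tensor (length u) (word u) (word v) = word (u @ v)"
proof
  fix w
  have "take (length u) w = u \<and> drop (length u) w = v \<longleftrightarrow> w = u @ v"
    by (metis append_eq_conv_conj)
  then show "tensor (length u) (word u) (word v) w = word (u @ v) w"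
    by (auto simp: tensor_def word_def)
qed

lemma local_op_tensor_left:
  assumes "Suc p < k"
  shows "local_op T p (tensor k x y) = tensor k (local_op T p x) y"
  using assms
proof (induction p arbitrary: k x)
  case 0
  then obtain l where k: "k = Suc (Suc l)" by (auto simp: less_iff_Suc_add)
  show ?case
  proof
    fix w show "local_op T 0 (tensor k x y) w = tensor k (local_op T 0 x) y w"
    proof (cases w)
      case (Cons i w')
      then show ?thesis
        by (cases w')
          (simp_all add: k local_op_0_Cons tensor_def sum_distrib_right mult.assoc)
    qed (simp add: tensor_def)
  qed
next
  case (Suc p)
  then obtain l where k: "k = Suc l" "Suc p < l" by (metis Suc_lessE)
  show ?case
  proof
    fix w show "local_op T (Suc p) (tensor k x y) w = tensor k (local_op T (Suc p) x) y w"
      by (cases w) (simp_all add: k Suc.IH[OF k(2)], simp add: tensor_def)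
  qed
qed

lemma local_op_tensor_right: "local_op T (k + p) (tensor k x y) = tensor k x (local_op T p y)"
proof (induction k arbitrary: x)
  case 0
  have "tensor 0 x y = x [] *v y" "tensor 0 x (local_op T p y) = x [] *v local_op T p y"
    by (auto simp: tensor_0 fun_eq_iff)
  then show ?case by (simp only: add_0 local_op_sc)
next
  case (Suc k)
  show ?case
  proof
    fix w show "local_op T (Suc k + p) (tensor (Suc k) x y) w = tensor (Suc k) x (local_op T p y) w"
      by (cases w) (auto simp: Suc.IH, simp add: tensor_def)
  qed
qed

section \<open>The bilinear form\<close>

primrec form :: "nat \<Rightarrow> vec \<Rightarrow> vec \<Rightarrow> complex" where
  "form 0 x y = x [] * y []"
| "form (Suc n) x y = (\<Sum>i\<in>idx. form n (\<lambda>u. x (i # u)) (\<lambda>u. y (i # u)))"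

lemma form_commute: "form n x y = form n y x"
  by (induction n arbitrary: x y) (auto intro!: sum.cong)

lemma form_add_left: "form n (x + x') y = form n x y + form n x' y"
  by (induction n arbitrary: x x' y) (auto simp: algebra_simps sum.distrib plus_fun_def)

lemma form_sc_left: "form n (c *v x) y = c * form n x y"
  by (induction n arbitrary: x y) (auto simp: sum_distrib_left sc_def)

lemma form_add_right: "form n x (y + y') = form n x y + form n x y'"
  using form_add_left form_commute by metis

lemma form_sc_right: "form n x (c *v y) = c * form n x y"
  using form_sc_left form_commute by metis

lemma form_zero_left [simp]: "form n 0 y = 0"
  using form_sc_left[of n 0 0 y] by simp

lemma form_zero_right [simp]: "form n x 0 = 0"
  using form_commute form_zero_left by metis

lemma form_diff_left: "form n (x - x') y = form n x y - form n x' y"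
  using form_add_left[of n "x - x'" x' y] by simp

lemma form_diff_right: "form n x (y - y') = form n x y - form n x y'"
  using form_diff_left form_commute by metis

lemmas form_linear = form_add_left form_add_right form_sc_left form_sc_right form_diff_left form_diff_right

lemma form_sum_right:
  fixes g :: "'a \<Rightarrow> vec"
  shows "form n x (sum g A) = (\<Sum>a\<in>A. form n x (g a))"
  by (induction A rule: infinite_finite_induct)
    (simp_all only: sum.infinite sum.empty sum.insert form_zero_right form_add_right not_False_eq_True)

lemma form_tensor: "form (m + n) (tensor m x y) (tensor m x' y') = form m x x' * form n y y'"
proof (induction m arbitrary: x x')
  case 0
  have "tensor 0 x y = x [] *v y" "tensor 0 x' y' = x' [] *v y'"
    by (auto simp: tensor_0 fun_eq_iff)
  then show ?case by (simp only: add_0 form_linear form.simps mult_ac)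
next
  case (Suc m)
  then show ?case by (simp add: sum_distrib_right)
qed

lemma form_local_op:
  assumes sym: "\<And>i j m n. T i j m n = T m n i j" and "Suc p < n"
  shows "form n (local_op T p x) y = form n x (local_op T p y)"
  using assms(2)
proof (induction p arbitrary: n x y)
  case 0
  then obtain l where n: "n = Suc (Suc l)" by (auto simp: less_iff_Suc_add)
  have l: "(\<lambda>u. local_op T 0 f (i # j # u)) = (\<Sum>a\<in>idx. \<Sum>b\<in>idx. T i j a b *v (\<lambda>u. f (a # b # u)))"
    for f i j by (simp add: local_op_0_Cons fun_eq_iff sum_fun_apply)
  have ips: "form l (sum g A) z = (\<Sum>a\<in>A. form l (g a) z)" for g :: "nat \<Rightarrow> vec" and z A
    by (simp add: form_commute[of l _ z] form_sum_right)
  let ?G = "\<lambda>a b i j. T i j a b * form l (\<lambda>u. x (a # b # u)) (\<lambda>u. y (i # j # u))"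
  have "form n (local_op T 0 x) y = (\<Sum>i\<in>idx. \<Sum>j\<in>idx. \<Sum>a\<in>idx. \<Sum>b\<in>idx. ?G a b i j)"
    by (simp add: n l ips form_linear)
  also have "\<dots> = (\<Sum>i\<in>idx. \<Sum>a\<in>idx. \<Sum>j\<in>idx. \<Sum>b\<in>idx. ?G a b i j)"
    by (rule sum.cong[OF refl], rule sum.swap)
  also have "\<dots> = (\<Sum>a\<in>idx. \<Sum>i\<in>idx. \<Sum>j\<in>idx. \<Sum>b\<in>idx. ?G a b i j)"
    by (rule sum.swap)
  also have "\<dots> = (\<Sum>a\<in>idx. \<Sum>i\<in>idx. \<Sum>b\<in>idx. \<Sum>j\<in>idx. ?G a b i j)"
    by (rule sum.cong[OF refl], rule sum.cong[OF refl], rule sum.swap)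
  also have "\<dots> = (\<Sum>a\<in>idx. \<Sum>b\<in>idx. \<Sum>i\<in>idx. \<Sum>j\<in>idx. ?G a b i j)"
    by (rule sum.cong[OF refl], rule sum.swap)
  also have "\<dots> = form n x (local_op T 0 y)"
    by (simp add: n l form_sum_right form_linear sym)
  finally show ?case .
next
  case (Suc p)
  then obtain l where "n = Suc l" "Suc p < l" by (metis Suc_lessE)
  then show ?case using Suc.IH by simp
qed

declare One_nat_def [simp del]

section \<open>The R-matrix\<close>

lemma idx_sets:
  "{i \<in> idx. i \<noteq> pr i} = {1, 3}" "{i \<in> idx. i = pr i} = {2}"
  "{(i, j) \<in> idx \<times> idx. i \<noteq> j \<and> i \<noteq> pr j} = {(1, 2), (2, 1), (2, 3), (3, 2)}"
  "{(i, j) \<in> idx \<times> idx. i > j} = {(2, 1), (3, 1), (3, 2)}"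
  by (auto simp: idx_def pr_def)

lemma pr_simps [simp]: "pr 1 = 3" "pr 2 = 2" "pr 3 = 1"
  by (simp_all add: pr_def One_nat_def)

lemma Rmat_eq: "Rmat s a b c d =
    s\<^sup>2 * (munit 1 1 1 1 a b c d + munit 3 3 3 3 a b c d) + munit 2 2 2 2 a b c d
    + (munit 1 1 2 2 a b c d + munit 2 2 1 1 a b c d + munit 2 2 3 3 a b c d + munit 3 3 2 2 a b c d)
    + inverse (s\<^sup>2) * (munit 3 3 1 1 a b c d + munit 1 1 3 3 a b c d)
    + (s\<^sup>2 - inverse (s\<^sup>2)) *
      (munit 2 1 1 2 a b c d - inverse s * munit 2 1 2 3 a b c d
     + (munit 3 1 1 3 a b c d - inverse (s\<^sup>2) * munit 3 1 1 3 a b c d)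
     + (munit 3 2 2 3 a b c d - inverse s * munit 3 2 1 2 a b c d))"
  unfolding Rmat_def Let_def idx_sets
  by (simp add: two_rho_def power_int_minus algebra_simps)

lemma Rhat_nz:
  assumes "Rhat s i j m n \<noteq> 0"
  shows "i \<in> idx \<and> j \<in> idx \<and> m \<in> idx \<and> n \<in> idx \<and> i + j = m + n"
  using assms
  unfolding Rhat_def Rmat_eq munit_def by (auto simp: idx_def split: if_splits)

lemma supported_Rhat: "supported (Rhat s)"
  unfolding supported_def using Rhat_nz by blast

lemma idx_cases: "i \<in> idx \<Longrightarrow> (i = 1 \<Longrightarrow> P) \<Longrightarrow> (i = 2 \<Longrightarrow> P) \<Longrightarrow> (i = 3 \<Longrightarrow> P) \<Longrightarrow> P"
  by (auto simp: idx_def)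

lemma sum_idx: "(\<Sum>i\<in>idx. f i) = f 1 + f 2 + f 3"
  by (simp add: idx_def add.assoc)

lemma Rhat_sym: "Rhat s i j m n = Rhat s m n i j"
proof (cases "i \<in> idx \<and> j \<in> idx \<and> m \<in> idx \<and> n \<in> idx")
  case True
  then have "i \<in> idx" "j \<in> idx" "m \<in> idx" "n \<in> idx" by auto
  then show ?thesis
    by (elim idx_cases)
      (simp_all add: Rhat_def Rmat_eq munit_def)
next
  case False
  then show ?thesis using Rhat_nz[of s i j m n] Rhat_nz[of s m n i j] by metis
qed

lemma local_op_0_notin:
  assumes "supported T" "i \<notin> idx \<or> j \<notin> idx"
  shows "local_op T 0 f (i # j # v) = 0"
proof -
  have "T i j m n = 0" for m n using assms unfolding supported_def by blast
  then show ?thesis by (simp add: local_op_0_Cons)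
qed

locale generic_q =
  fixes s :: complex
  assumes transc: "\<not> algebraic (s\<^sup>2)"
begin

abbreviation q :: complex where "q \<equiv> s\<^sup>2"

abbreviation R :: "nat \<Rightarrow> vec \<Rightarrow> vec" where "R \<equiv> local_op (Rhat s)"

text \<open>All scalars that have to be nonzero below are, up to powers of \<open>s\<close>, values of integer polynomials at
  \<open>q\<close>; \<open>cs\<close> lists the coefficients, constant term first.\<close>
lemma horner_nz:
  assumes "\<exists>c\<in>set cs. c \<noteq> (0::int)"
  shows "foldr (\<lambda>a b. of_int a + q * b) cs 0 \<noteq> 0"
proof -
  let ?p = "Poly (map of_int cs :: complex list)"
  have "poly ?p q = foldr (\<lambda>a b. of_int a + q * b) cs 0"
    by (induction cs) (auto simp: algebra_simps)
  moreover have "coeff ?p i \<in> \<int>" for i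
    by (auto simp: coeff_Poly_eq nth_default_def)
  moreover have "?p \<noteq> 0"
  proof
    assume "?p = 0"
    then obtain n where "map of_int cs = replicate n (0::complex)" by (auto simp: Poly_eq_0)
    then have "\<forall>c\<in>set (map of_int cs :: complex list). c = 0" by (metis in_set_replicate)
    then show False using assms by auto
  qed
  ultimately show ?thesis using transc unfolding algebraic_def by metis
qed

lemma s_nz [simp]: "s \<noteq> 0"
  using horner_nz[of "[0, 1]"] by auto

lemma q_facts:
  "1 + q \<noteq> 0" "q \<noteq> 1" "1 + q^2 \<noteq> 0" "1 + q + q^2 \<noteq> 0" "1 + q^2 + q^4 \<noteq> 0" "1 + q^4 \<noteq> 0" "q^3 \<noteq> 1"
  using horner_nz[of "[1, 1]"] horner_nz[of "[-1, 1]"] horner_nz[of "[1, 0, 1]"]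
    horner_nz[of "[1, 1, 1]"] horner_nz[of "[1, 0, 1, 0, 1]"] horner_nz[of "[1, 0, 0, 0, 1]"]
    horner_nz[of "[-1, 0, 0, 1]"]
  by (auto simp: power2_eq_square power3_eq_cube power4_eq_xxxx algebra_simps)

definition t :: complex where "t = inverse s"

lemma s_t: "s * t = 1" "s * (t * x) = x"
  by (simp_all add: t_def field_simps)

lemma t_nz [simp]: "t \<noteq> 0"
  by (simp add: t_def)

lemma power6: "(x::complex) ^ 6 = x * x * x * x * x * x"
  using power_add[of x 3 3] by (simp add: power3_eq_cube mult.assoc)

lemmas power_expand = power2_eq_square power3_eq_cube power4_eq_xxxx power6

lemma Rrow:
  "R 0 f (1 # 1 # v) = s^2 * f (1 # 1 # v)"
  "R 0 f (1 # 2 # v) = (s^2 - t^2) * f (1 # 2 # v) + f (2 # 1 # v)"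
  "R 0 f (2 # 1 # v) = f (1 # 2 # v)"
  "R 0 f (1 # 3 # v) = (s^2 - t^2) * (1 - t^2) * f (1 # 3 # v)
     - (s^2 - t^2) * t * f (2 # 2 # v) + t^2 * f (3 # 1 # v)"
  "R 0 f (2 # 2 # v) = f (2 # 2 # v) - (s^2 - t^2) * t * f (1 # 3 # v)"
  "R 0 f (3 # 1 # v) = t^2 * f (1 # 3 # v)"
  "R 0 f (2 # 3 # v) = (s^2 - t^2) * f (2 # 3 # v) + f (3 # 2 # v)"
  "R 0 f (3 # 2 # v) = f (2 # 3 # v)"
  "R 0 f (3 # 3 # v) = s^2 * f (3 # 3 # v)"
  unfolding local_op_0_Cons sum_idx Rhat_def Rmat_eq munit_def t_def
  by (simp_all add: power_inverse[symmetric] algebra_simps)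

lemma R_Tens [simp, intro]: "f \<in> Tens n \<Longrightarrow> R p f \<in> Tens n"
  by (rule local_op_Tens[OF supported_Rhat])

lemma R_commute: "p + 2 \<le> p' \<Longrightarrow> R p (R p' f) = R p' (R p f)"
  by (rule local_op_commute)

text \<open>A check on the words of length three, and trivial at larger positions because of the recursive form
  of \<open>local_op\<close>. The letters outside \<open>idx\<close> need a separate argument since \<open>f\<close> is arbitrary.\<close>
lemma braid: "R p (R (Suc p) (R p f)) = R (Suc p) (R p (R (Suc p) f))"
proof (induction p arbitrary: f)
  case 0
  have "R 0 (R (Suc 0) (R 0 f)) w = R (Suc 0) (R 0 (R (Suc 0) f)) w" for w
  proof -
    consider "w = []" | i where "w = [i]" | i j where "w = [i, j]" | i j k v where "w = i # j # k # v"
      by (metis neq_Nil_conv)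
    then show ?thesis
    proof cases
      case w: (4 i j k v)
      note [simp] = local_op_0_notin[OF supported_Rhat]
      show ?thesis
      proof (cases "i \<in> idx \<and> j \<in> idx \<and> k \<in> idx")
        case True
        then have "i \<in> idx" "j \<in> idx" "k \<in> idx" by auto
        then show ?thesis unfolding w
          by (elim idx_cases; simp add: Rrow power_expand; simp add: s_t algebra_simps)
      next
        case False
        have z: "R 0 g (a # b # u) = 0" if "a \<notin> idx \<or> b \<notin> idx" for a b u g
          using local_op_0_notin[OF supported_Rhat that] .
        have z': "R 0 g (i # j # u) = (\<Sum>m\<in>idx. \<Sum>n\<in>idx. Rhat s i j m n * g (m # n # u))"
          for g i j u by (rule local_op_0_Cons)
        consider "i \<notin> idx" | "j \<notin> idx" | "k \<notin> idx" using False by blast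
        then show ?thesis
        proof cases
          case a: 1
          then show ?thesis unfolding w z[OF disjI1[OF a]] local_op_Suc_Cons z'[of _ j k] using a by (simp add: z)
        next
          case a: 2
          then show ?thesis unfolding w z[OF disjI2[OF a]] local_op_Suc_Cons z[OF disjI1[OF a]] by simp
        next
          case a: 3
          then show ?thesis unfolding w z'[of _ i j] local_op_Suc_Cons using a by (simp add: z)
        qed
      qed
    qed (simp_all add: local_op_0_Cons)
  qed
  then show ?case by blast
next
  case (Suc p)
  show ?case
  proof
    fix w show "R (Suc p) (R (Suc (Suc p)) (R (Suc p) f)) w = R (Suc (Suc p)) (R (Suc p) (R (Suc (Suc p)) f)) w"
      by (cases w) (simp_all add: Suc.IH)
  qed
qed

text \<open>The minimal polynomial \<open>(R - q) (R + q\<^sup>-\<^sup>1) (R - q\<^sup>-\<^sup>2)\<close> of \<open>Rhat\<close>, with \<open>t = s\<^sup>-\<^sup>1\<close>.\<close>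
lemma cubic:
  assumes "f \<in> Tens n" "Suc p < n"
  shows "R p (R p (R p f)) = (s^2 - t^2 + t^4) *v R p (R p f) + (1 - t^2 + t^6) *v R p f - t^4 *v f"
  using assms
proof (induction p arbitrary: n f)
  case 0
  show ?case
  proof (rule Tens_eqI)
    fix w assume "w \<in> words n"
    then obtain i j v where w: "w = i # j # v" and ij: "i \<in> idx" "j \<in> idx"
      using 0(2) by (cases w; cases "tl w") (auto simp: words_def)
    show "R 0 (R 0 (R 0 f)) w = ((s^2 - t^2 + t^4) *v R 0 (R 0 f) + (1 - t^2 + t^6) *v R 0 f - t^4 *v f) w"
      using ij unfolding w
      by (elim idx_cases; simp add: Rrow power_expand; simp add: s_t algebra_simps)
  qed (intro Tens_intros R_Tens 0)+
next
  case (Suc p)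
  show ?case
  proof (rule Tens_eqI)
    fix w assume "w \<in> words n"
    then obtain i v where w: "w = i # v" using Suc.prems by (cases w) (auto simp: words_def)
    obtain m where m: "n = Suc m" "Suc p < m" using Suc.prems by (cases n) auto
    have "(\<lambda>u. f (i # u)) \<in> Tens m" using Tens_Cons Suc.prems(1) m(1) by blast
    from Suc.IH[OF this m(2)] show "R (Suc p) (R (Suc p) (R (Suc p) f)) w
      = ((s^2 - t^2 + t^4) *v R (Suc p) (R (Suc p) f) + (1 - t^2 + t^6) *v R (Suc p) f - t^4 *v f) w"
      unfolding w by simp
  qed (intro Tens_intros R_Tens Suc)+
qed

end

primrec lincomb :: "(complex \<times> nat list) list \<Rightarrow> vec" where
  "lincomb [] = 0"
| "lincomb (a # l) = fst a *v word (snd a) + lincomb l"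

lemma lincomb_apply: "lincomb l w = (\<Sum>a\<leftarrow>l. if w = snd a then fst a else 0)"
  by (induction l) (auto simp: word_def)

lemma lincomb_Tens [intro]: "(\<And>a. a \<in> set l \<Longrightarrow> snd a \<in> words n) \<Longrightarrow> lincomb l \<in> Tens n"
  by (induction l) (auto intro!: Tens_intros word_in_Tens)

declare lincomb.simps [simp del]

lemma form_word: "u \<in> words n \<Longrightarrow> form n x (word u) = x u"
proof (induction n arbitrary: u x)
  case (Suc n)
  then obtain i v where u: "u = i # v" "i \<in> idx" "v \<in> words n" by (auto simp: words_Suc)
  have "(\<lambda>w. word u (j # w)) = (if j = i then word v else 0)" for j
    by (auto simp: word_def u fun_eq_iff)
  then have "form (Suc n) x (word u) = (\<Sum>j\<in>idx. form n (\<lambda>w. x (j # w)) (if j = i then word v else 0))"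
    by simp
  also have "\<dots> = (\<Sum>j\<in>idx. if j = i then form n (\<lambda>w. x (i # w)) (word v) else 0)"
    by (rule sum.cong) auto
  finally show ?case using Suc.IH[OF u(3)] u(1,2) by simp
qed (simp add: word_def)

lemma form_lincomb:
  assumes "\<And>a. a \<in> set l \<Longrightarrow> snd a \<in> words n"
  shows "form n x (lincomb l) = (\<Sum>a\<leftarrow>l. fst a * x (snd a))"
  using assms by (induction l) (simp_all add: lincomb.simps form_linear form_word)

lemma words2_cases:
  assumes "w \<in> words 2" obtains i j where "w = [i, j]" "i \<in> idx" "j \<in> idx"
  using assms by (auto simp: words_def numeral_2_eq_2 length_Suc_conv)

lemma words3_cases:
  assumes "w \<in> words 3" obtains i j k where "w = [i, j, k]" "i \<in> idx" "j \<in> idx" "k \<in> idx"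
  using assms by (auto simp: words_def numeral_3_eq_3 length_Suc_conv)

lemma word_words [simp]: "w \<in> words n \<longleftrightarrow> length w = n \<and> set w \<subseteq> idx"
  by (simp add: words_def)

lemma idx_mem [simp]: "1 \<in> idx" "2 \<in> idx" "3 \<in> idx"
  by (auto simp: idx_def)

lemma Tens_mem_tensor: "x \<in> Tens k \<Longrightarrow> y \<in> Tens l \<Longrightarrow> n = k + l \<Longrightarrow> tensor k x y \<in> Tens n"
  by auto

context generic_q
begin

lemma form_R: "Suc p < n \<Longrightarrow> form n (R p x) y = form n x (R p y)"
  by (rule form_local_op) (rule Rhat_sym)

section \<open>Inverse and eigenspaces of the R-matrix\<close>
text \<open>The inverse of \<open>R p\<close>, read off from the minimal polynomial.\<close>
definition Ri :: "nat \<Rightarrow> vec \<Rightarrow> vec" where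
  "Ri p f = (s^4) *v ((s^2 - t^2 + t^4) *v R p f + (1 - t^2 + t^6) *v f - R p (R p f))"

lemma Ri_Tens [simp, intro]: "f \<in> Tens n \<Longrightarrow> Ri p f \<in> Tens n"
  unfolding Ri_def by (intro Tens_intros R_Tens)

lemma s4t4: "s^4 * t^4 = 1"
  using s_t(1) by (metis power_mult_distrib power_one)

lemma Ri_R:
  assumes "f \<in> Tens n" "Suc p < n"
  shows "Ri p (R p f) = f" "R p (Ri p f) = f"
proof -
  have "s^4 * (t^4 * x) = x" for x using s4t4 by (simp add: mult.assoc[symmetric])
  then show "Ri p (R p f) = f" "R p (Ri p f) = f"
    unfolding Ri_def local_op_sc local_op_add local_op_diff cubic[OF assms]
    by (auto simp: fun_eq_iff algebra_simps)
qed

lemma gaps: "s^2 + t^2 \<noteq> 0" "s^2 - t^4 \<noteq> 0" "t^2 + t^4 \<noteq> 0"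
proof -
  have "s^2 + t^2 = (1 + q^2) * t^2" "s^2 - t^4 = (q^3 - 1) * t^4" "t^2 + t^4 = (1 + q) * t^4"
    by (simp_all add: power_expand algebra_simps s_t)
  then show "s^2 + t^2 \<noteq> 0" "s^2 - t^4 \<noteq> 0" "t^2 + t^4 \<noteq> 0"
    using q_facts by auto
qed

lemma lagrange_sum:
  fixes A B C f x y z :: complex
  assumes "A \<noteq> 0" "B \<noteq> 0" "C \<noteq> 0" "A * C * B * f = C * x + B * y - A * z"
  shows "f = x / (A * B) + y / (A * C) - z / (B * C)"
proof -
  have "x / (A * B) + y / (A * C) - z / (B * C) = (C * x + B * y - A * z) / (A * C * B)"
    using assms(1-3) by (simp add: field_simps)
  also have "\<dots> = f"
    unfolding assms(4)[symmetric] using assms(1-3) by simp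
  finally show ?thesis by simp
qed

text \<open>Lagrange interpolation at the three eigenvalues. The components are polynomials in \<open>R p\<close> applied to
  \<open>f\<close>, so an eigenvalue of \<open>f\<close> for an operator that commutes with \<open>R p\<close> is inherited by all of
  them; this provides joint eigenvectors of \<open>R 0\<close> and \<open>R 2\<close>.\<close>
lemma eigen_decomposition:
  assumes "f \<in> Tens n" "Suc p < n"
  obtains x y z where "f = x + y + z" "x \<in> Tens n" "y \<in> Tens n" "z \<in> Tens n"
    "R p x = q *v x" "R p y = (- (t^2)) *v y" "R p z = t^4 *v z"
    "\<And>p'. R p' f = c *v f \<Longrightarrow> p + 2 \<le> p' \<or> p' + 2 \<le> p \<Longrightarrow>
      R p' x = c *v x \<and> R p' y = c *v y \<and> R p' z = c *v z"
proof -
  define pol where "pol a b = R p (R p f) - (a + b) *v R p f + (a * b) *v f" for a b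
  define x where "x = (1 / ((s^2 + t^2) * (s^2 - t^4))) *v pol (- (t^2)) (t^4)"
  define y where "y = (1 / ((s^2 + t^2) * (t^2 + t^4))) *v pol (s^2) (t^4)"
  define z where "z = (- 1 / ((s^2 - t^4) * (t^2 + t^4))) *v pol (s^2) (- (t^2))"
  note defs = x_def y_def z_def pol_def
  have pW: "pol a b \<in> Tens n" for a b
    unfolding pol_def using assms by (intro Tens_intros R_Tens)
  have R_pol: "R p (pol a b) = c *v pol a b"
    if "s^2 - t^2 + t^4 - a - b = c" "1 - t^2 + t^6 + a * b = - c * (a + b)" "- (t^4) = c * (a * b)" for a b c
  proof -
    have "R p (pol a b) = (s^2 - t^2 + t^4 - a - b) *v R p (R p f)
        + (1 - t^2 + t^6 + a * b) *v R p f + (- (t^4)) *v f"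
      unfolding pol_def local_op_sc local_op_add local_op_diff cubic[OF assms]
      by (auto simp: fun_eq_iff algebra_simps)
    then show ?thesis
      unfolding that pol_def by (auto simp: fun_eq_iff algebra_simps)
  qed
  show ?thesis
  proof (rule that[of x y z])
    have "(s^2 + t^2) * (t^2 + t^4) * (s^2 - t^4) * f w =
        ((t^2 + t^4) *v pol (- (t^2)) (t^4) + (s^2 - t^4) *v pol (s^2) (t^4)
         - (s^2 + t^2) *v pol (s^2) (- (t^2))) w" for w
      by (simp add: pol_def algebra_simps)
    then have "f w = (x + y + z) w" for w
      unfolding x_def y_def z_def using lagrange_sum[OF gaps, of "f w"] by simp
    then show "f = x + y + z" by blast
    have "R p (pol (- (t^2)) (t^4)) = q *v pol (- (t^2)) (t^4)"
      "R p (pol (s^2) (t^4)) = (- (t^2)) *v pol (s^2) (t^4)"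
      "R p (pol (s^2) (- (t^2))) = t^4 *v pol (s^2) (- (t^2))"
      by (rule R_pol; simp add: power_expand algebra_simps s_t)+
    then show "R p x = q *v x" "R p y = (- (t^2)) *v y" "R p z = t^4 *v z"
      unfolding x_def y_def z_def local_op_sc by (auto simp: fun_eq_iff)
    show "x \<in> Tens n" "y \<in> Tens n" "z \<in> Tens n"
      unfolding x_def y_def z_def by (intro Tens_intros pW)+
    fix p' assume *: "R p' f = c *v f" "p + 2 \<le> p' \<or> p' + 2 \<le> p"
    then have com: "R p' (R p g) = R p (R p' g)" for g
      using R_commute by metis
    have "R p' (pol a b) = c *v pol a b" for a b
      unfolding pol_def local_op_sc local_op_add local_op_diff com *(1)
      by (auto simp: fun_eq_iff algebra_simps)
    then show "R p' x = c *v x \<and> R p' y = c *v y \<and> R p' z = c *v z"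
      unfolding x_def y_def z_def local_op_sc by (auto simp: fun_eq_iff algebra_simps)
  qed
qed

section \<open>Absorbing subspaces\<close>

text \<open>The \<open>t\<^sup>4\<close>-eigenvectors of \<open>R p\<close> are the tensors that carry the invariant vector \<open>kappa\<close> in the
  factors \<open>p, p + 1\<close>; they are the analogues of the traces for the classical orthogonal group.\<close>
definition absorbing :: "nat \<Rightarrow> vec set \<Rightarrow> bool" where
  "absorbing k Q \<longleftrightarrow> fv.subspace Q \<and> Q \<subseteq> Tens k \<and>
     (\<forall>p x. Suc p < k \<longrightarrow> x \<in> Q \<longrightarrow> R p x \<in> Q) \<and>
     (\<forall>p x. Suc p < k \<longrightarrow> x \<in> Tens k \<longrightarrow> R p x = t^4 *v x \<longrightarrow> x \<in> Q)"

lemma absorbingD: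
  assumes "absorbing k Q"
  shows "fv.subspace Q" "Q \<subseteq> Tens k" "\<And>p x. Suc p < k \<Longrightarrow> x \<in> Q \<Longrightarrow> R p x \<in> Q"
    "\<And>p x. Suc p < k \<Longrightarrow> x \<in> Tens k \<Longrightarrow> R p x = t^4 *v x \<Longrightarrow> x \<in> Q"
  using assms unfolding absorbing_def by blast+

text \<open>By the braid relation, conjugation by \<open>R\<^sub>p R\<^sub>p\<^sub>+\<^sub>1\<close> turns \<open>R\<^sub>p\<close> into \<open>R\<^sub>p\<^sub>+\<^sub>1\<close>, hence carries
  eigenvectors of the first to eigenvectors of the second.\<close>
lemma antisym_shift:
  assumes "absorbing k Q" "Suc (Suc p) < k"
    and anti: "\<And>x. x \<in> Tens k \<Longrightarrow> R p x = (- (t^2)) *v x \<Longrightarrow> x \<in> Q"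
    and x: "x \<in> Tens k" "R (Suc p) x = (- (t^2)) *v x"
  shows "x \<in> Q"
proof -
  define y where "y = Ri (Suc p) (Ri p x)"
  have y: "y \<in> Tens k" using x by (auto simp: y_def)
  have Ry: "R p (R (Suc p) y) = x"
    unfolding y_def using x(1) assms(2) by (simp add: Ri_R(2)[of _ k])
  have "R p (R (Suc p) (R p y)) = R (Suc p) x"
    using braid[of p y] Ry by simp
  also have "\<dots> = R p (R (Suc p) ((- (t^2)) *v y))"
    using x(2) Ry by simp
  finally have "Ri (Suc p) (Ri p (R p (R (Suc p) (R p y)))) = Ri (Suc p) (Ri p (R p (R (Suc p) ((- (t^2)) *v y))))"
    by simp
  then have "R p y = (- (t^2)) *v y"
    using y assms(2) Ri_R(1)[of _ k]
    by (metis R_Tens Suc_lessD Tens_intros(3))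
  then have "y \<in> Q" using anti y by blast
  then show ?thesis using Ry absorbingD(3)[OF assms(1)] assms(2)
    by (metis Suc_lessD)
qed

text \<open>Of the three eigencomponents of \<open>x\<close> only the \<open>q\<close>-component survives modulo \<open>Q\<close>.\<close>
lemma sym_mod:
  assumes "absorbing k Q" "Suc p < k" "x \<in> Tens k"
    and anti: "\<And>x. x \<in> Tens k \<Longrightarrow> R p x = (- (t^2)) *v x \<Longrightarrow> x \<in> Q"
  shows "R p x - q *v x \<in> Q"
proof -
  obtain a b c where d: "x = a + b + c" "a \<in> Tens k" "b \<in> Tens k" "c \<in> Tens k"
    "R p a = q *v a" "R p b = (- (t^2)) *v b" "R p c = t^4 *v c"
    using eigen_decomposition[OF assms(3,2)] by metis
  have "b \<in> Q" "c \<in> Q" using d anti absorbingD(4)[OF assms(1,2)] by blast+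
  moreover have "R p x - q *v x = (- (t^2) - q) *v b + (t^4 - q) *v c"
    unfolding d(1) local_op_add d(5-7) by (auto simp: fun_eq_iff algebra_simps)
  ultimately show ?thesis
    using absorbingD(1)[OF assms(1)] by (simp add: fv.subspace_add fv.subspace_scale)
qed

section \<open>Explicit eigenvectors\<close>

text \<open>The invariant vector, with the entries of the matrix \<open>C\<close>. This vector and \<open>alt\<close>, \<open>alt3\<close>,
  \<open>mix\<close>, \<open>sym3\<close> below quantise the classical invariant, the alternating tensors, the determinant,
  the traceless tensors of mixed symmetry and the traceless symmetric tensors. \<open>Rhat\<close> preserves the
  sum of the letters of a word, the weight, so that all of them can be chosen homogeneous; their
  coefficients are the solutions of the eigenvector equations in \<open>R_kappa\<close> to \<open>R01_mix\<close>.\<close>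
definition kappa :: vec where
  "kappa = lincomb [(t, [1,3]), (1, [2,2]), (s, [3,1])]"

definition alt :: "nat \<Rightarrow> vec" where
  "alt m = lincomb (if m = 0 then [(1, [1,2]), (- (s^2), [2,1])]
      else if m = 1 then [(1, [1,3]), (s - t, [2,2]), (- 1, [3,1])]
      else [(1, [2,3]), (- (s^2), [3,2])])"

definition alt3 :: vec where
  "alt3 = lincomb [(1, [1,2,3]), (- (s^2), [2,1,3]), (- (s^2), [1,3,2]), (- (s^2 * (s - t)), [2,2,2]),
     (s^2, [3,1,2]), (s^2, [2,3,1]), (- (s^4), [3,2,1])]"

text \<open>There is one vector for each of the weights \<open>4, \<dots>, 8\<close>. Each is alternating in the first two
  factors and spans, with its image under \<open>R\<^sub>1\<close>, a two-dimensional module of the Hecke algebra \<open>H\<^sub>3\<close>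
  (\<open>R11_mix\<close>, \<open>R01_mix\<close>).\<close>
definition mix_list :: "nat \<Rightarrow> (complex \<times> nat list) list" where
  "mix_list m = (if m = 0 then [(1, [1,2,1]), (- (s^2), [2,1,1])]
      else if m = 1 then [(1, [1,2,2]), (- (s^2), [2,1,2]), (- t, [1,3,1]), (- (1 - t^2), [2,2,1]), (t, [3,1,1])]
      else if m = 2 then [(1, [1,2,3]), (- (s^2), [2,1,3]), (1 + t^2, [1,3,2]),
         ((1 + t^2) * (s - t), [2,2,2]), (- (1 + t^2), [3,1,2]), (t^4, [2,3,1]), (- (t^2), [3,2,1])]
      else if m = 3 then [(1, [1,3,3]), (s - t, [2,2,3]), (- 1, [3,1,3]), (- (t^3), [2,3,2]), (t, [3,2,2])]
      else [(1, [2,3,3]), (- (s^2), [3,2,3])])"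

text \<open>One vector for each of the weights \<open>3, \<dots>, 9\<close>. The coefficient of a word is the factor that
  appears when the word is sorted by the rules of \<open>exchange\<close>.\<close>
definition sym3_list :: "nat \<Rightarrow> (complex \<times> nat list) list" where
  "sym3_list m = (if m = 0 then [(1, [1,1,1])]
      else if m = 1 then [(1, [1,1,2]), (t^2, [1,2,1]), (t^4, [2,1,1])]
      else if m = 2 then [(1, [1,1,3]), (t^4, [1,3,1]), (t^4 * t^4, [3,1,1]),
         (- (t + t^3), [1,2,2]), (- (t^2 * (t + t^3)), [2,1,2]), (- (t^4 * (t + t^3)), [2,2,1])]
      else if m = 3 then [(1, [1,2,3]), (t^2, [2,1,3]), (t^2, [1,3,2]), (- (t^2 * (t + t^3)), [2,2,2]),
         (t^6, [2,3,1]), (t^6, [3,1,2]), (t^4 * t^4, [3,2,1])]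
      else if m = 4 then [(1, [1,3,3]), (t^4, [3,1,3]), (t^4 * t^4, [3,3,1]),
         (- (t + t^3), [2,2,3]), (- (t^2 * (t + t^3)), [2,3,2]), (- (t^4 * (t + t^3)), [3,2,2])]
      else if m = 5 then [(1, [2,3,3]), (t^2, [3,2,3]), (t^4, [3,3,2])]
      else [(1, [3,3,3])])"

definition mix :: "nat \<Rightarrow> vec" where "mix m = lincomb (mix_list m)"

definition sym3 :: "nat \<Rightarrow> vec" where "sym3 m = lincomb (sym3_list m)"

lemma kappa_Tens [simp]: "kappa \<in> Tens 2" unfolding kappa_def by (rule lincomb_Tens) auto
lemma alt_Tens [simp]: "alt m \<in> Tens 2" unfolding alt_def by (rule lincomb_Tens) (auto split: if_splits)
lemma alt3_Tens [simp]: "alt3 \<in> Tens 3" unfolding alt3_def by (rule lincomb_Tens) auto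
lemma mix_Tens [simp]: "mix m \<in> Tens 3" unfolding mix_def mix_list_def by (rule lincomb_Tens) (auto split: if_splits)
lemma sym3_Tens [simp]: "sym3 m \<in> Tens 3" unfolding sym3_def sym3_list_def by (rule lincomb_Tens) (auto split: if_splits)

lemmas vdefs = kappa_def alt_def alt3_def mix_def mix_list_def sym3_def sym3_list_def

lemma less_3_cases: "m < 3 \<Longrightarrow> m = 0 \<or> m = 1 \<or> m = (2::nat)" by auto
lemma less_5_cases: "m < 5 \<Longrightarrow> m = 0 \<or> m = 1 \<or> m = 2 \<or> m = 3 \<or> m = (4::nat)" by auto
lemma less_7_cases: "m < 7 \<Longrightarrow> m = 0 \<or> m = 1 \<or> m = 2 \<or> m = 3 \<or> m = 4 \<or> m = 5 \<or> m = (6::nat)" by auto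

lemma eq2I:
  assumes "f \<in> Tens 2" "g \<in> Tens 2" "\<And>i j. i \<in> idx \<Longrightarrow> j \<in> idx \<Longrightarrow> f [i, j] = g [i, j]"
  shows "f = g"
  by (rule Tens_eqI[OF assms(1,2)]) (metis words2_cases assms(3))

lemma eq3I:
  assumes "f \<in> Tens 3" "g \<in> Tens 3"
    "\<And>i j k. i \<in> idx \<Longrightarrow> j \<in> idx \<Longrightarrow> k \<in> idx \<Longrightarrow> f [i, j, k] = g [i, j, k]"
  shows "f = g"
  by (rule Tens_eqI[OF assms(1,2)]) (metis words3_cases assms(3))

lemma R_kappa: "R 0 kappa = t^4 *v kappa"
  by (rule eq2I, simp, intro Tens_intros, simp)
    (elim idx_cases; simp add: Rrow power_expand vdefs lincomb_apply; simp add: s_t algebra_simps)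

lemma R_alt: "m < 3 \<Longrightarrow> R 0 (alt m) = (- (t^2)) *v alt m"
  by (rule eq2I, simp, intro Tens_intros, simp, drule less_3_cases)
    (elim disjE; hypsubst; elim idx_cases; simp add: Rrow power_expand vdefs lincomb_apply; simp add: s_t algebra_simps)

lemma R0_alt3: "R 0 alt3 = (- (t^2)) *v alt3"
  by (rule eq3I, simp, intro Tens_intros, simp,
    elim idx_cases; simp add: Rrow power_expand vdefs lincomb_apply; simp add: s_t algebra_simps)

lemma R1_alt3: "R (Suc 0) alt3 = (- (t^2)) *v alt3"
  by (rule eq3I, simp, intro Tens_intros, simp,
    elim idx_cases; simp add: Rrow power_expand vdefs lincomb_apply; simp add: s_t algebra_simps)

lemma R0_sym3: "m < 7 \<Longrightarrow> R 0 (sym3 m) = q *v sym3 m"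
  by (drule less_7_cases, elim disjE; hypsubst; (rule eq3I, simp, intro Tens_intros, simp);
    elim idx_cases; simp add: Rrow power_expand vdefs lincomb_apply; simp add: s_t algebra_simps)

lemma R1_sym3: "m < 7 \<Longrightarrow> R (Suc 0) (sym3 m) = q *v sym3 m"
  by (drule less_7_cases, elim disjE; hypsubst; (rule eq3I, simp, intro Tens_intros, simp);
    elim idx_cases; simp add: Rrow power_expand vdefs lincomb_apply; simp add: s_t algebra_simps)

lemma R0_mix: "m < 5 \<Longrightarrow> R 0 (mix m) = (- (t^2)) *v mix m"
  by (drule less_5_cases, elim disjE; hypsubst; (rule eq3I, simp, intro Tens_intros R_Tens mix_Tens);
    elim idx_cases; simp add: Rrow power_expand vdefs lincomb_apply; simp add: s_t algebra_simps)

lemma R11_mix: "m < 5 \<Longrightarrow> R (Suc 0) (R (Suc 0) (mix m)) = mix m + (s^2 - t^2) *v R (Suc 0) (mix m)"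
  by (drule less_5_cases, elim disjE; hypsubst; (rule eq3I, simp, intro Tens_intros R_Tens mix_Tens);
    elim idx_cases; simp add: Rrow power_expand vdefs lincomb_apply; simp add: s_t algebra_simps)

lemma R01_mix: "m < 5 \<Longrightarrow> R 0 (R (Suc 0) (mix m)) = q *v R (Suc 0) (mix m) - (s^4) *v mix m"
  by (drule less_5_cases, elim disjE; hypsubst; (rule eq3I, simp, intro Tens_intros R_Tens mix_Tens);
    elim idx_cases; simp add: Rrow power_expand vdefs lincomb_apply; simp add: s_t algebra_simps)

section \<open>Absorbing subspaces of the third tensor power\<close>
lemma R0_words:
  "R 0 (word [2,1]) = word [1,2]"
  "R 0 (word [3,2]) = word [2,3]"
  "R 0 (word [3,1]) = t^2 *v word [1,3]"
  "R 0 (word [2,2]) = word [2,2] - ((s^2 - t^2) * t) *v word [1,3]"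
  by (rule eq2I, (intro Tens_intros R_Tens word_in_Tens; simp)+, (elim idx_cases; simp add: Rrow word_def))+

text \<open>Where \<open>R 0\<close> acts as \<open>q\<close>, which by \<open>sym_mod\<close> is the case modulo alternating and invariant vectors,
  each two-letter word is a multiple of one of \<open>11\<close>, \<open>12\<close>, \<open>13\<close>, \<open>23\<close>, \<open>33\<close>.\<close>
lemma exchange:
  assumes "(u, d, v) \<in> {([2,1], t^2, [1,2]), ([3,2], t^2, [2,3]), ([3,1], t^4, [1,3]), ([2,2], - (t + t^3), [1,3])}"
  obtains c where "word u - d *v word v = c *v (R 0 (word u) - q *v word u)" "word u \<in> Tens 2"
    "length u = 2" "length v = 2"
proof -
  have q1: "1 - q \<noteq> 0" using q_facts(2) by simp
  have "(1 - q) * (- (t + t^3)) = (s^2 - t^2) * t" by (simp add: power_expand algebra_simps s_t)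
  then have c22: "- (t + t^3) = (s^2 - t^2) * t / (1 - q)" using q1 by (simp add: field_simps)
  consider "u = [2,1]" "d = t^2" "v = [1,2]" | "u = [3,2]" "d = t^2" "v = [2,3]"
    | "u = [3,1]" "d = t^4" "v = [1,3]" | "u = [2,2]" "d = - (t + t^3)" "v = [1,3]"
    using assms by auto
  then show ?thesis
  proof cases
    case 1 then show ?thesis
      by (intro that[of "- (t^2)"]) (simp_all add: R0_words fun_eq_iff power_expand algebra_simps s_t)
  next
    case 2 then show ?thesis
      by (intro that[of "- (t^2)"]) (simp_all add: R0_words fun_eq_iff power_expand algebra_simps s_t)
  next
    case 3 then show ?thesis
      by (intro that[of "- (t^2)"]) (simp_all add: R0_words fun_eq_iff power_expand algebra_simps s_t)
  next
    case 4
    show ?thesis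
    proof (intro that[of "1 / (1 - q)"] ext)
      fix w
      have "(1 / (1 - q)) * ((1 - q) * word u w - (s^2 - t^2) * t * word v w)
          = word u w - (s^2 - t^2) * t / (1 - q) * word v w"
        using q1 by (simp add: field_simps)
      then show "(word u - d *v word v) w = ((1 / (1 - q)) *v (R 0 (word u) - q *v word u)) w"
        unfolding 4 R0_words c22 by (simp add: algebra_simps)
    qed (use 4 in auto)
  qed
qed

text \<open>\<open>(R\<^sub>p - q) (R\<^sub>p - q\<^sup>-\<^sup>2)\<close>, a nonzero multiple of the projection onto the alternating tensors.\<close>
definition anti :: "nat \<Rightarrow> vec \<Rightarrow> vec" where
  "anti p x = R p (R p x) - (s^2 + t^4) *v R p x + t^2 *v x"

lemma anti_linear:
  "anti p (x + y) = anti p x + anti p y" "anti p (c *v x) = c *v anti p x"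
  "anti p (x - y) = anti p x - anti p y" "anti p 0 = 0"
  by (auto simp: anti_def fun_eq_iff algebra_simps)

lemma anti_tensor_left: "Suc p < k \<Longrightarrow> anti p (tensor k x y) = tensor k (anti p x) y"
  by (simp add: anti_def local_op_tensor_left tensor_linear)

lemma anti_tensor_right: "anti (k + p) (tensor k x y) = tensor k x (anti p y)"
  by (simp add: anti_def local_op_tensor_right tensor_linear)

lemma anti_eigen: "R p x = (- (t^2)) *v x \<Longrightarrow> anti p x = ((1 + t^2) * (1 + t^4)) *v x"
  unfolding anti_def by (simp only: local_op_sc) (simp add: fun_eq_iff power_expand algebra_simps s_t)

lemma anti_const: "(1 + t^2) * (1 + t^4) \<noteq> 0" "t^4 + t^6 \<noteq> 0"
proof -
  have "(1 + t^2) * (1 + t^4) = ((1 + q) * (1 + q^2)) * t^6" "t^4 + t^6 = (1 + q) * t^6"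
    by (simp_all add: power_expand algebra_simps s_t)
  then show "(1 + t^2) * (1 + t^4) \<noteq> 0" "t^4 + t^6 \<noteq> 0" using q_facts by simp_all
qed

lemma absorbing_anti: "absorbing k Q \<Longrightarrow> Suc p < k \<Longrightarrow> x \<in> Q \<Longrightarrow> anti p x \<in> Q"
  unfolding anti_def
  by (intro fv.subspace_add fv.subspace_diff fv.subspace_scale)
    (auto intro: absorbingD(1) absorbingD(3))

lemma anti_words:
  "anti 0 (word [1,1]) = 0"
  "anti 0 (word [1,2]) = (t^4 + t^6) *v alt 0"
  "anti 0 (word [2,1]) = (- (t^2 + t^4)) *v alt 0"
  "anti 0 (word [1,3]) = (t^2 + t^4) *v alt 1"
  "anti 0 (word [2,2]) = ((t^2 + t^4) * (s - t)) *v alt 1"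
  "anti 0 (word [3,1]) = (- (t^2 + t^4)) *v alt 1"
  "anti 0 (word [2,3]) = (t^4 + t^6) *v alt 2"
  "anti 0 (word [3,2]) = (- (t^2 + t^4)) *v alt 2"
  "anti 0 (word [3,3]) = 0"
  unfolding anti_def
  by (rule eq2I, (intro Tens_intros R_Tens word_in_Tens alt_Tens; simp)+,
    (elim idx_cases; simp add: Rrow word_def vdefs lincomb_apply power_expand; simp add: s_t algebra_simps))+

lemma anti_word_alt:
  assumes "i \<in> idx" "j \<in> idx"
  obtains c m where "m < 3" "anti 0 (word [i, j]) = c *v alt m"
proof -
  have "\<exists>c m. m < 3 \<and> anti 0 (word [i, j]) = c *v alt m"
    using assms
  proof (elim idx_cases)
    have "(0::vec) = 0 *v alt 0" by simp
    then have z: "\<exists>c m. m < 3 \<and> (0::vec) = c *v alt m" by (metis zero_less_numeral)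
    have "0 < (3::nat)" "1 < (3::nat)" "2 < (3::nat)" by auto
    then show "i = 1 \<Longrightarrow> j = 1 \<Longrightarrow> ?thesis" "i = 1 \<Longrightarrow> j = 2 \<Longrightarrow> ?thesis" "i = 1 \<Longrightarrow> j = 3 \<Longrightarrow> ?thesis"
      "i = 2 \<Longrightarrow> j = 1 \<Longrightarrow> ?thesis" "i = 2 \<Longrightarrow> j = 2 \<Longrightarrow> ?thesis" "i = 2 \<Longrightarrow> j = 3 \<Longrightarrow> ?thesis"
      "i = 3 \<Longrightarrow> j = 1 \<Longrightarrow> ?thesis" "i = 3 \<Longrightarrow> j = 2 \<Longrightarrow> ?thesis" "i = 3 \<Longrightarrow> j = 3 \<Longrightarrow> ?thesis"
      using z anti_words by metis+
  qed
  then show ?thesis using that by blast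
qed

lemma subspace_scaleD:
  assumes "fv.subspace Q" "c *v x \<in> Q" "c \<noteq> 0"
  shows "x \<in> Q"
proof -
  have "x = (1 / c) *v (c *v x)" using assms(3) by (auto simp: fun_eq_iff)
  then show ?thesis using fv.subspace_scale[OF assms(1,2)] by metis
qed

lemma letter_kappa: "tensor 1 (word [i]) kappa = t *v word [i,1,3] + word [i,2,2] + s *v word [i,3,1]"
proof -
  have "tensor 1 (word [i]) (word u) = word (i # u)" for u
    using tensor_word[of "[i]" u] by (simp add: One_nat_def)
  then show ?thesis
    by (simp add: kappa_def lincomb.simps tensor_linear algebra_simps)
qed

lemma word3_split: "word [i,j,k] = tensor 2 (word [i,j]) (word [k])"
  using tensor_word[of "[i,j]" "[k]"] by (simp add: numeral_2_eq_2)

text \<open>The nine vectors \<open>alt m \<otimes> e\<^sub>k\<close> are obtained from nine elements of \<open>Q\<close> in their span: the five vectors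
  \<open>mix\<close>, the vector \<open>alt3\<close>, and the projections \<open>anti 0\<close> of \<open>e\<^sub>i \<otimes> kappa\<close>, where the invariant
  vector sits in the last two factors. The linear system splits by weight into blocks of sizes
  \<open>1, 2, 3, 2, 1\<close>.\<close>
lemma alt_letter_absorbed:
  assumes Q: "absorbing 3 Q" and alt3: "alt3 \<in> Q" and mix: "\<And>m. m < 5 \<Longrightarrow> mix m \<in> Q"
    and m: "m < 3" and k: "k \<in> idx"
  shows "tensor 2 (alt m) (word [k]) \<in> Q"
proof -
  define X where "X m k = tensor 2 (alt m) (word [k])" for m k
  note sub = absorbingD(1)[OF Q]
  note Qadd = fv.subspace_add[OF sub] and Qsc = fv.subspace_scale[OF sub] and Qdiff = fv.subspace_diff[OF sub]
  have cup: "anti 0 (tensor 1 (word [i]) kappa) \<in> Q" if "i \<in> idx" for i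
  proof (rule absorbing_anti[OF Q])
    have "R (1 + 0) (tensor 1 (word [i]) kappa) = t^4 *v tensor 1 (word [i]) kappa"
      unfolding local_op_tensor_right R_kappa by (simp add: tensor_linear)
    then show "tensor 1 (word [i]) kappa \<in> Q"
      using that by (intro absorbingD(4)[OF Q, of 1] Tens_mem_tensor[of _ 1 _ 2]) auto
  qed simp
  have XW: "X m k \<in> Tens 3" if "k \<in> idx" for m k
    unfolding X_def using that by (intro Tens_mem_tensor[of _ 2 _ 1]) auto
  have two: "Suc 0 < 2" by simp
  note ev = X_def tensor_def vdefs lincomb_apply word_def power_expand
  have w0: "mix 0 = X 0 1" and w1: "mix 1 = X 0 2 - t *v X 1 1"
    and w2: "mix 2 = X 0 3 + (1 + t^2) *v X 1 2 + t^4 *v X 2 1"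
    and w3: "mix 3 = X 1 3 - t^3 *v X 2 2" and w4: "mix 4 = X 2 3"
    and a: "alt3 = X 0 3 - q *v X 1 2 + q *v X 2 1"
    by (rule eq3I, (intro Tens_intros XW mix_Tens alt3_Tens; simp)+,
        (elim idx_cases; simp add: ev; simp add: s_t algebra_simps))+
  have c1: "anti 0 (tensor 1 (word [1]) kappa) = (t^4 + t^6) *v (X 0 2 + (q * s) *v X 1 1)"
    and c2: "anti 0 (tensor 1 (word [2]) kappa) = (t^4 + t^6) *v ((q * (s - t)) *v X 1 2 + s *v X 2 1 - s *v X 0 3)"
    and c3: "anti 0 (tensor 1 (word [3]) kappa) = (t^4 + t^6) *v (- (s *v X 1 3) - q *v X 2 2)"
    unfolding letter_kappa word3_split anti_linear anti_tensor_left[OF two] anti_words X_def tensor_linear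
    by (simp_all add: fun_eq_iff power_expand algebra_simps s_t)
  have C1: "X 0 2 + (q * s) *v X 1 1 \<in> Q"
    and C2: "(q * (s - t)) *v X 1 2 + s *v X 2 1 - s *v X 0 3 \<in> Q"
    and C3: "- (s *v X 1 3) - q *v X 2 2 \<in> Q"
    using cup[of 1] cup[of 2] cup[of 3] anti_const(2) subspace_scaleD[OF sub] unfolding c1 c2 c3 by auto
  have Xw: "X 0 1 \<in> Q" "X 2 3 \<in> Q" using mix[of 0] mix[of 4] w0 w4 by auto
  have X11: "X 1 1 \<in> Q"
  proof (rule subspace_scaleD[OF sub])
    have "((1 + q^2) * t) *v X 1 1 = (X 0 2 + (q * s) *v X 1 1) - mix 1"
      unfolding w1 by (auto simp: fun_eq_iff power_expand algebra_simps s_t)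
    also have "\<dots> \<in> Q" using C1 mix[of 1] by (intro Qdiff) auto
    finally show "((1 + q^2) * t) *v X 1 1 \<in> Q" .
  qed (use q_facts in simp)
  have "X 0 2 = mix 1 + t *v X 1 1" unfolding w1 by (auto simp: fun_eq_iff)
  then have X02: "X 0 2 \<in> Q" using mix[of 1] X11 by (auto intro!: Qadd Qsc)
  have X21: "X 2 1 \<in> Q"
  proof (rule subspace_scaleD[OF sub])
    have "((1 + q + 2 * q^2 + q^3 + q^4) * t^4) *v X 2 1
       = (mix 2 - alt3) + (1 + t^2 + q) *v (alt3 + t *v ((q * (s - t)) *v X 1 2 + s *v X 2 1 - s *v X 0 3))"
      unfolding w2 a by (auto simp: fun_eq_iff power_expand algebra_simps s_t)
    also have "\<dots> \<in> Q" using C2 alt3 mix[of 2] by (auto intro!: Qadd Qsc Qdiff)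
    finally show "((1 + q + 2 * q^2 + q^3 + q^4) * t^4) *v X 2 1 \<in> Q" .
    have "1 + q + 2 * q^2 + q^3 + q^4 \<noteq> 0"
      using horner_nz[of "[1,1,2,1,1]"] by (simp add: power_expand algebra_simps)
    then show "(1 + q + 2 * q^2 + q^3 + q^4) * t^4 \<noteq> 0" by simp
  qed
  have X12: "X 1 2 = (1 + q) *v X 2 1 - (alt3 + t *v ((q * (s - t)) *v X 1 2 + s *v X 2 1 - s *v X 0 3))"
    unfolding a by (auto simp: fun_eq_iff power_expand algebra_simps s_t)
  have X12: "X 1 2 \<in> Q" by (subst X12) (use C2 alt3 X21 in \<open>auto intro!: Qadd Qsc Qdiff\<close>)
  have "X 0 3 = alt3 + q *v X 1 2 - q *v X 2 1" unfolding a by (auto simp: fun_eq_iff)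
  then have X03: "X 0 3 \<in> Q" using alt3 X12 X21 by (auto intro!: Qadd Qsc Qdiff)
  have X22: "X 2 2 \<in> Q"
  proof (rule subspace_scaleD[OF sub])
    have "(- (1 + q^2) * t^2) *v X 2 2 = s *v mix 3 + (- (s *v X 1 3) - q *v X 2 2)"
      unfolding w3 by (auto simp: fun_eq_iff power_expand algebra_simps s_t)
    also have "\<dots> \<in> Q" using C3 mix[of 3] by (auto intro!: Qadd Qsc)
    finally show "(- (1 + q^2) * t^2) *v X 2 2 \<in> Q" .
    show "- (1 + q^2) * t^2 \<noteq> 0"
      using q_facts(3) t_nz by (metis mult_eq_0_iff neg_equal_0_iff_equal power_not_zero)
  qed
  have "X 1 3 = mix 3 + t^3 *v X 2 2" unfolding w3 by (auto simp: fun_eq_iff)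
  then have X13: "X 1 3 \<in> Q" using mix[of 3] X22 by (auto intro!: Qadd Qsc)
  have "X m k \<in> Q"
    using less_3_cases[OF m] k Xw X11 X02 X21 X12 X03 X22 X13 by (elim disjE idx_cases) auto
  then show ?thesis by (simp add: X_def)
qed

lemma nz_by_horner:
  assumes "x = foldr (\<lambda>a b. of_int a + q * b) cs 0 * t ^ k" "\<exists>c\<in>set cs. c \<noteq> 0"
  shows "x \<noteq> 0"
  using horner_nz[OF assms(2)] assms(1) by simp

lemma power8: "(x::complex) ^ 8 = x * x * x * x * x * x * x * x"
  and power16: "(x::complex) ^ 16 = (x * x * x * x * x * x * x * x) * (x * x * x * x * x * x * x * x)"
proof -
  show 8: "(x::complex) ^ 8 = x * x * x * x * x * x * x * x"
    using power_add[of x 4 4] by (simp add: power4_eq_xxxx mult.assoc)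
  show "(x::complex) ^ 16 = (x * x * x * x * x * x * x * x) * (x * x * x * x * x * x * x * x)"
    using power_add[of x 8 8] 8 by simp
qed

text \<open>The square of \<open>sym3 m\<close> for the bilinear form. It plays a second role in \<open>spanning3\<close>: sorting
  replaces each word of \<open>sym3 m\<close> by its own coefficient times the sorted word, so this is also the
  factor between \<open>sym3 m\<close> and that word.\<close>
lemma sym3_norm_nz:
  assumes "m < 7"
  shows "(\<Sum>a\<leftarrow>sym3_list m. fst a * fst a) \<noteq> 0"
proof -
  have "(\<Sum>a\<leftarrow>sym3_list 1. fst a * fst a) \<noteq> 0"
    by (rule nz_by_horner[of _ "[1,0,1,0,1]" 8]) (simp_all add: sym3_list_def power_expand power8 algebra_simps s_t)
  moreover have "(\<Sum>a\<leftarrow>sym3_list 2. fst a * fst a) \<noteq> 0"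
    by (rule nz_by_horner[of _ "[1,1,2,2,3,2,2,1,1]" 16]) (simp_all add: sym3_list_def power_expand power16 algebra_simps s_t)
  moreover have "(\<Sum>a\<leftarrow>sym3_list 3. fst a * fst a) \<noteq> 0"
    by (rule nz_by_horner[of _ "[1,0,2,1,2,1,2,0,1]" 16]) (simp_all add: sym3_list_def power_expand power16 algebra_simps s_t)
  moreover have "(\<Sum>a\<leftarrow>sym3_list 4. fst a * fst a) = (\<Sum>a\<leftarrow>sym3_list 2. fst a * fst a)"
    "(\<Sum>a\<leftarrow>sym3_list 5. fst a * fst a) = (\<Sum>a\<leftarrow>sym3_list 1. fst a * fst a)"
    by (simp_all add: sym3_list_def)
  moreover have "(\<Sum>a\<leftarrow>sym3_list 0. fst a * fst a) \<noteq> 0" "(\<Sum>a\<leftarrow>sym3_list 6. fst a * fst a) \<noteq> 0"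
    by (simp_all add: sym3_list_def)
  ultimately show ?thesis using less_7_cases[OF assms] by (elim disjE; hypsubst; simp only: not_False_eq_True)
qed

lemma sym3_list_words: "a \<in> set (sym3_list m) \<Longrightarrow> snd a \<in> words 3"
  unfolding sym3_list_def by (auto split: if_splits)

lemma mix_list_words: "a \<in> set (mix_list m) \<Longrightarrow> snd a \<in> words 3"
  unfolding mix_list_def by (auto split: if_splits)

lemma form_sym3_right: "form 3 x (sym3 m) = (\<Sum>a\<leftarrow>sym3_list m. fst a * x (snd a))"
  unfolding sym3_def by (rule form_lincomb) (rule sym3_list_words)

lemma sym3_weight: "m < 7 \<Longrightarrow> a \<in> set (sym3_list m) \<Longrightarrow> sum_list (snd a) = m + 3"
  by (drule less_7_cases, elim disjE; hypsubst; auto simp: sym3_list_def)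

lemma form_mix_right: "form 3 x (mix m) = (\<Sum>a\<leftarrow>mix_list m. fst a * x (snd a))"
  unfolding mix_def by (rule form_lincomb) (rule mix_list_words)

lemma mix_weight: "m < 5 \<Longrightarrow> a \<in> set (mix_list m) \<Longrightarrow> sum_list (snd a) = m + 4"
  by (drule less_5_cases, elim disjE; hypsubst; auto simp: mix_list_def)

lemma lincomb_nz: "lincomb l u \<noteq> 0 \<Longrightarrow> \<exists>a\<in>set l. snd a = u"
  by (induction l) (auto simp: lincomb.simps word_def split: if_splits)

lemma form_sym3_orthogonal:
  assumes "m < 7" "n < 7" "m \<noteq> n"
  shows "form 3 (sym3 m) (sym3 n) = 0"
proof -
  have "sym3 m (snd a) = 0" if a: "a \<in> set (sym3_list n)" for a
  proof (rule ccontr)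
    assume "sym3 m (snd a) \<noteq> 0"
    then obtain b where b: "b \<in> set (sym3_list m)" "snd b = snd a" using lincomb_nz unfolding sym3_def by blast
    then show False using sym3_weight[OF assms(1) b(1)] sym3_weight[OF assms(2) a] assms(3) by simp
  qed
  then show ?thesis
    unfolding form_sym3_right by (simp cong: map_cong)
qed

lemma form_sym3_self:
  assumes "m < 7"
  shows "form 3 (sym3 m) (sym3 m) \<noteq> 0"
proof -
  have "form 3 (sym3 m) (sym3 m) = (\<Sum>a\<leftarrow>sym3_list m. fst a * fst a)"
    unfolding form_sym3_right
    using less_7_cases[OF assms] by (elim disjE; hypsubst; simp add: sym3_def sym3_list_def lincomb_apply)
  then show ?thesis using sym3_norm_nz[OF assms] by simp
qed

lemma form_alt3: "form 3 alt3 alt3 \<noteq> 0"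
proof -
  have "form 3 alt3 alt3 = 1 + 4 * s^4 + s^4 * (s - t)^2 + s^4 * s^4"
    unfolding alt3_def by (subst form_lincomb) (auto simp: lincomb_apply power_expand algebra_simps)
  then show ?thesis
    by (rule nz_by_horner[of _ "[1,1,2,1,1]" 0, OF trans]) (simp_all add: power_expand algebra_simps s_t)
qed

lemma form_mix_orthogonal:
  assumes "m < 5" "n < 5" "m \<noteq> n"
  shows "form 3 (mix m) (mix n) = 0"
proof -
  have "mix m (snd a) = 0" if a: "a \<in> set (mix_list n)" for a
  proof (rule ccontr)
    assume "mix m (snd a) \<noteq> 0"
    then obtain b where b: "b \<in> set (mix_list m)" "snd b = snd a" using lincomb_nz unfolding mix_def by blast
    then show False using mix_weight[OF assms(1) b(1)] mix_weight[OF assms(2) a] assms(3) by simp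
  qed
  then show ?thesis
    unfolding form_mix_right by (simp cong: map_cong)
qed

lemma form_mix_self:
  assumes "m < 5"
  shows "form 3 (mix m) (mix m) \<noteq> 0"
proof -
  have "form 3 (mix m) (mix m) = (\<Sum>a\<leftarrow>mix_list m. fst a * fst a)"
    unfolding form_mix_right
    using less_5_cases[OF assms] by (elim disjE; hypsubst; simp add: mix_def mix_list_def lincomb_apply)
  moreover have "(\<Sum>a\<leftarrow>mix_list 0. fst a * fst a) \<noteq> 0"
    by (rule nz_by_horner[of _ "[1,0,1]" 0]) (simp_all add: mix_list_def power_expand algebra_simps s_t)
  moreover have "(\<Sum>a\<leftarrow>mix_list 1. fst a * fst a) \<noteq> 0"
    by (rule nz_by_horner[of _ "[1,0,2,0,1]" 4]) (simp_all add: mix_list_def power_expand algebra_simps s_t)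
  moreover have "(\<Sum>a\<leftarrow>mix_list 2. fst a * fst a) \<noteq> 0"
    by (rule nz_by_horner[of _ "[1,1,3,2,3,1,1]" 8]) (simp_all add: mix_list_def power_expand power8 algebra_simps s_t)
  moreover have "(\<Sum>a\<leftarrow>mix_list 3. fst a * fst a) \<noteq> 0"
    by (rule nz_by_horner[of _ "[1,0,2,0,1]" 6]) (simp_all add: mix_list_def power_expand algebra_simps s_t)
  moreover have "(\<Sum>a\<leftarrow>mix_list 4. fst a * fst a) = (\<Sum>a\<leftarrow>mix_list 0. fst a * fst a)"
    by (simp add: mix_list_def)
  ultimately show ?thesis using less_5_cases[OF assms] by (elim disjE; hypsubst; simp only: not_False_eq_True)
qed

text \<open>\<open>anti 0\<close> maps \<open>Tens 3\<close> onto the span of the vectors \<open>alt m \<otimes> e\<^sub>k\<close>, and multiplies a vector that is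
  alternating in the first two factors by a nonzero scalar.\<close>
lemma antisym_absorbed:
  assumes Q: "absorbing 3 Q" and alt3: "alt3 \<in> Q" and mix: "\<And>m. m < 5 \<Longrightarrow> mix m \<in> Q"
    and x: "x \<in> Tens 3" "R 0 x = (- (t^2)) *v x"
  shows "x \<in> Q"
proof -
  note sub = absorbingD(1)[OF Q]
  have "Tens 3 \<subseteq> {x. anti 0 x \<in> Q}"
  proof (rule Tens_subset_subspace)
    show "fv.subspace {x. anti 0 x \<in> Q}"
      unfolding fv.subspace_def using sub
      by (simp add: anti_linear fv.subspace_0 fv.subspace_add fv.subspace_scale)
    fix u assume "u \<in> words 3"
    then obtain i j k where u: "u = [i,j,k]" "i \<in> idx" "j \<in> idx" "k \<in> idx" by (rule words3_cases)
    have two: "Suc 0 < 2" by simp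
    obtain c m where "m < 3" "anti 0 (word [i, j]) = c *v alt m" using anti_word_alt u by metis
    then have "anti 0 (word u) = c *v tensor 2 (alt m) (word [k])"
      unfolding u word3_split anti_tensor_left[OF two] by (simp add: tensor_linear)
    then show "word u \<in> {x. anti 0 x \<in> Q}"
      using alt_letter_absorbed[OF Q alt3 mix \<open>m < 3\<close> u(4)] fv.subspace_scale[OF sub] by simp
  qed
  then have "((1 + t^2) * (1 + t^4)) *v x \<in> Q" using x anti_eigen[of 0 x] by auto
  then show ?thesis using subspace_scaleD[OF sub] anti_const(1) by blast
qed

text \<open>Alternating vectors lie in \<open>Q\<close> at both positions, so words can be sorted modulo \<open>Q\<close> until seven
  of them remain, one for each weight. Sorting turns \<open>sym3 m\<close> into a nonzero multiple of
  the sorted word of its weight.\<close>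
lemma spanning3:
  assumes Q: "absorbing 3 Q" and alt3: "alt3 \<in> Q" and mix: "\<And>m. m < 5 \<Longrightarrow> mix m \<in> Q"
    and sym3: "\<And>m. m < 7 \<Longrightarrow> sym3 m \<in> Q"
  shows "Tens 3 \<subseteq> Q"
proof -
  note sub = absorbingD(1)[OF Q]
  note anti0 = antisym_absorbed[OF Q alt3 mix]
  have anti1: "x \<in> Q" if "x \<in> Tens 3" "R (Suc 0) x = (- (t^2)) *v x" for x
    by (rule antisym_shift[OF Q _ anti0 that]) auto
  \<comment> \<open>\<open>E u d v\<close>: modulo \<open>Q\<close>, the word \<open>u\<close> is \<open>d\<close> times the word \<open>v\<close>.\<close>
  define E where "E u d v \<longleftrightarrow> word u - d *v word v \<in> Q" for u d v
  have E_refl: "E u 1 u" for u by (simp add: E_def fv.subspace_0[OF sub])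
  have E_trans: "E u e w" if "E u c v" "E v d w" "e = c * d" for u c v d w e
  proof -
    have "word u - e *v word w = (word u - c *v word v) + c *v (word v - d *v word w)"
      by (simp add: that(3) fun_eq_iff algebra_simps)
    also have "\<dots> \<in> Q" using that(1,2) unfolding E_def
      by (intro fv.subspace_add[OF sub] fv.subspace_scale[OF sub])
    finally show ?thesis by (simp add: E_def)
  qed
  let ?P = "{([2,1], t^2, [1,2]), ([3,2], t^2, [2,3]), ([3,1], t^4, [1,3]), ([2,2], - (t + t^3), [1,3])}"
  have E0: "E (u @ [k]) d (v @ [k])" and E1: "E (k # u) d (k # v)"
    if uv: "(u, d, v) \<in> ?P" and k: "k \<in> idx" for u d v k
  proof -
    obtain c where c: "word u - d *v word v = c *v (R 0 (word u) - q *v word u)"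
      and uW: "word u \<in> Tens 2" and len: "length u = 2" "length v = 2"
      using exchange[OF uv] by metis
    have W3: "tensor 2 (word u) (word [k]) \<in> Tens 3" "tensor (Suc 0) (word [k]) (word u) \<in> Tens 3"
      using Tens_mem_tensor[OF uW, of "word [k]" 1 3] Tens_mem_tensor[OF _ uW, of "word [k]" "Suc 0" 3] k by simp_all
    have "word (u @ [k]) - d *v word (v @ [k]) = tensor 2 (word u - d *v word v) (word [k])"
      using tensor_word[of u "[k]"] tensor_word[of v "[k]"] len by (simp add: tensor_linear)
    also have "\<dots> = c *v (R 0 (tensor 2 (word u) (word [k])) - q *v tensor 2 (word u) (word [k]))"
      unfolding c by (simp add: tensor_linear local_op_tensor_left)
    also have "\<dots> \<in> Q"
      using sym_mod[OF Q _ _ anti0, where p = 0 and x = "tensor 2 (word u) (word [k])"] W3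
      by (intro fv.subspace_scale[OF sub]) auto
    finally show "E (u @ [k]) d (v @ [k])" by (simp add: E_def)
    have "word (k # u) - d *v word (k # v) = tensor (Suc 0) (word [k]) (word u - d *v word v)"
      using tensor_word[of "[k]" u] tensor_word[of "[k]" v] by (simp add: tensor_linear)
    also have "\<dots> = c *v (R (Suc 0 + 0) (tensor (Suc 0) (word [k]) (word u)) - q *v tensor (Suc 0) (word [k]) (word u))"
      unfolding c local_op_tensor_right by (simp add: tensor_linear)
    also have "\<dots> \<in> Q"
      using sym_mod[OF Q _ _ anti1, where p = "Suc 0" and x = "tensor (Suc 0) (word [k]) (word u)"] W3
      by (intro fv.subspace_scale[OF sub]) auto
    finally show "E (k # u) d (k # v)" by (simp add: E_def)
  qed
  have E0: "E [a,b,k] d [a',b',k]" if "([a,b], d, [a',b']) \<in> ?P" "k \<in> idx" for a b a' b' d k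
    using E0[OF that] by simp
  note F = E0 E1
  have x0: "E [1,1,1] 1 [1,1,1]" and x1: "E [1,1,2] 1 [1,1,2]" and x2: "E [1,1,3] 1 [1,1,3]"
    and x3: "E [1,2,3] 1 [1,2,3]" and x4: "E [1,3,3] 1 [1,3,3]" and x5: "E [2,3,3] 1 [2,3,3]"
    and x6: "E [3,3,3] 1 [3,3,3]"
    by (rule E_refl)+
  have a1: "E [1,2,1] (t^2) [1,1,2]" by (rule F) auto
  have a2: "E [2,1,1] (t^4) [1,1,2]" by (rule E_trans[of _ "t^2", OF F(1) a1]) (simp_all add: power_expand algebra_simps)
  have b1: "E [1,3,1] (t^4) [1,1,3]" by (rule F) auto
  have b2: "E [3,1,1] (t^4 * t^4) [1,1,3]" by (rule E_trans[of _ "t^4", OF F(1) b1]) auto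
  have b3: "E [1,2,2] (- (t + t^3)) [1,1,3]" by (rule F) auto
  have b4: "E [2,1,2] (- (t^2 * (t + t^3))) [1,1,3]" by (rule E_trans[of _ "t^2", OF F(1) b3]) (simp_all add: algebra_simps)
  have b5: "E [2,2,1] (- (t^4 * (t + t^3))) [1,1,3]" by (rule E_trans[of _ "t^2", OF F(2) b4]) (simp_all add: power_expand algebra_simps)
  have c1: "E [2,1,3] (t^2) [1,2,3]" by (rule F) auto
  have c2: "E [1,3,2] (t^2) [1,2,3]" by (rule F) auto
  have c3: "E [2,2,2] (- (t^2 * (t + t^3))) [1,2,3]" by (rule E_trans[of _ "- (t + t^3)", OF F(2) c1]) (simp_all add: algebra_simps)
  have c4: "E [2,3,1] (t^6) [1,2,3]" by (rule E_trans[of _ "t^4", OF F(2) c1]) (simp_all add: power_expand algebra_simps)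
  have c5: "E [3,1,2] (t^6) [1,2,3]" by (rule E_trans[of _ "t^4", OF F(1) c2]) (simp_all add: power_expand algebra_simps)
  have c6: "E [3,2,1] (t^4 * t^4) [1,2,3]" by (rule E_trans[of _ "t^2", OF F(1) c4]) (simp_all add: power_expand algebra_simps)
  have d1: "E [3,1,3] (t^4) [1,3,3]" by (rule F) auto
  have d2: "E [3,3,1] (t^4 * t^4) [1,3,3]" by (rule E_trans[of _ "t^4", OF F(2) d1]) auto
  have d3: "E [2,2,3] (- (t + t^3)) [1,3,3]" by (rule F) auto
  have d4: "E [2,3,2] (- (t^2 * (t + t^3))) [1,3,3]" by (rule E_trans[of _ "t^2", OF F(2) d3]) (simp_all add: algebra_simps)
  have d5: "E [3,2,2] (- (t^4 * (t + t^3))) [1,3,3]" by (rule E_trans[of _ "t^2", OF F(1) d4]) (simp_all add: power_expand algebra_simps)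
  have e1: "E [3,2,3] (t^2) [2,3,3]" by (rule F) auto
  have e2: "E [3,3,2] (t^4) [2,3,3]" by (rule E_trans[of _ "t^2", OF F(2) e1]) (simp_all add: power_expand algebra_simps)
  note Es = x0 x1 x2 x3 x4 x5 x6 a1 a2 b1 b2 b3 b4 b5 c1 c2 c3 c4 c5 c6 d1 d2 d3 d4 d5 e1 e2
  have rep: "word v \<in> Q"
    if "\<And>a. a \<in> set l \<Longrightarrow> E (snd a) (fst a) v" "lincomb l \<in> Q" "(\<Sum>a\<leftarrow>l. fst a * fst a) \<noteq> 0" for l v
  proof -
    define D where "D l \<longleftrightarrow> lincomb l - (\<Sum>a\<leftarrow>l. fst a * fst a) *v word v \<in> Q" for l
    have D_Nil: "D []" by (simp add: D_def lincomb.simps fv.subspace_0[OF sub])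
    have D_Cons: "D (a # l)" if "E (snd a) (fst a) v" "D l" for a l
    proof -
      have "lincomb (a # l) - (\<Sum>a\<leftarrow>a # l. fst a * fst a) *v word v
        = fst a *v (word (snd a) - fst a *v word v) + (lincomb l - (\<Sum>a\<leftarrow>l. fst a * fst a) *v word v)"
        by (simp add: lincomb.simps fun_eq_iff algebra_simps)
      also have "\<dots> \<in> Q"
        using that unfolding E_def D_def by (intro fv.subspace_add[OF sub] fv.subspace_scale[OF sub]) auto
      finally show ?thesis unfolding D_def .
    qed
    have "D l" using that(1) by (induction l) (simp_all add: D_Nil D_Cons)
    then have "lincomb l - (\<Sum>a\<leftarrow>l. fst a * fst a) *v word v \<in> Q" by (simp add: D_def)
    then have "(\<Sum>a\<leftarrow>l. fst a * fst a) *v word v \<in> Q"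
      using fv.subspace_diff[OF sub that(2)] by fastforce
    then show ?thesis using subspace_scaleD[OF sub] that(3) by blast
  qed
  have rep_sym3: "word v \<in> Q" if "m < 7" "\<And>a. a \<in> set (sym3_list m) \<Longrightarrow> E (snd a) (fst a) v" for m v
    using rep[OF that(2) sym3[OF that(1), unfolded sym3_def] sym3_norm_nz[OF that(1)]] .
  have "word [1,1,1] \<in> Q" by (rule rep_sym3[of 0]) (use Es in \<open>auto simp: sym3_list_def\<close>)
  moreover have "word [1,1,2] \<in> Q" by (rule rep_sym3[of 1]) (use Es in \<open>auto simp: sym3_list_def\<close>)
  moreover have "word [1,1,3] \<in> Q" by (rule rep_sym3[of 2]) (use Es in \<open>auto simp: sym3_list_def\<close>)
  moreover have "word [1,2,3] \<in> Q" by (rule rep_sym3[of 3]) (use Es in \<open>auto simp: sym3_list_def\<close>)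
  moreover have "word [1,3,3] \<in> Q" by (rule rep_sym3[of 4]) (use Es in \<open>auto simp: sym3_list_def\<close>)
  moreover have "word [2,3,3] \<in> Q" by (rule rep_sym3[of 5]) (use Es in \<open>auto simp: sym3_list_def\<close>)
  moreover have "word [3,3,3] \<in> Q" by (rule rep_sym3[of 6]) (use Es in \<open>auto simp: sym3_list_def\<close>)
  ultimately have reps: "word [1,1,1] \<in> Q" "word [1,1,2] \<in> Q" "word [1,1,3] \<in> Q" "word [1,2,3] \<in> Q"
    "word [1,3,3] \<in> Q" "word [2,3,3] \<in> Q" "word [3,3,3] \<in> Q" by blast+
  have Ein: "word u \<in> Q" if "E u d v" "word v \<in> Q" for u d v
  proof -
    have "word u = (word u - d *v word v) + d *v word v" by (simp add: fun_eq_iff)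
    then show ?thesis using that fv.subspace_add[OF sub] fv.subspace_scale[OF sub] unfolding E_def by metis
  qed
  show ?thesis
  proof (rule Tens_subset_subspace[OF sub])
    fix u assume "u \<in> words 3"
    then obtain i j k where u: "u = [i,j,k]" "i \<in> idx" "j \<in> idx" "k \<in> idx" by (rule words3_cases)
    show "word u \<in> Q"
      unfolding u(1)
      by (rule idx_cases[OF u(2)]; rule idx_cases[OF u(3)]; rule idx_cases[OF u(4)]; simp only:)
        (blast intro: Es Ein reps)+
  qed
qed

end

lemma tensor_minus: "tensor k (- x) y = - tensor k x y" "tensor k x (- y) = - tensor k x y"
  by (auto simp: tensor_def fun_eq_iff)

context generic_q
begin

section \<open>Relations on a product of two tensor powers\<close>

text \<open>The relations of the \<open>k\<close>-th component after the first tensor factors of all copies of \<open>\<Gamma>\<^sub>L\<close> have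
  been separated from the second ones.\<close>
definition pair_rels :: "nat \<Rightarrow> vec set" where
  "pair_rels k = fv.span {h + R i (R (k + i) h) | i h. Suc i < k \<and> h \<in> Tens (k + k)}"

lemma pair_rels_subspace: "fv.subspace (pair_rels k)"
  unfolding pair_rels_def by (rule fv.subspace_span)

lemma pair_rels_pair:
  assumes "x \<in> Tens k" "y \<in> Tens k" "Suc i < k"
  shows "tensor k x y + tensor k (R i x) (R i y) \<in> pair_rels k"
proof -
  have "R i (R (k + i) (tensor k x y)) = tensor k (R i x) (R i y)"
    unfolding local_op_tensor_right by (rule local_op_tensor_left[OF assms(3)])
  then have "tensor k x y + tensor k (R i x) (R i y) = tensor k x y + R i (R (k + i) (tensor k x y))" by simp
  also have "\<dots> \<in> pair_rels k"
    unfolding pair_rels_def using assms by (intro fv.span_base) (auto intro!: tensor_Tens)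
  finally show ?thesis .
qed

lemma nonzero_consts: "1 - t^6 \<noteq> 0" "1 + t^4 \<noteq> 0" "1 + t^4 * t^4 \<noteq> 0" "1 + t^2 \<noteq> 0" "1 + s^4 \<noteq> 0"
proof -
  show "1 - t^6 \<noteq> 0" by (rule nz_by_horner[of _ "[-1,0,0,1]" 6]) (simp_all add: power_expand algebra_simps s_t)
  show "1 + t^4 \<noteq> 0" by (rule nz_by_horner[of _ "[1,0,1]" 4]) (simp_all add: power_expand algebra_simps s_t)
  show "1 + t^4 * t^4 \<noteq> 0" by (rule nz_by_horner[of _ "[1,0,0,0,1]" 8]) (simp_all add: power_expand power8 algebra_simps s_t)
  show "1 + t^2 \<noteq> 0" by (rule nz_by_horner[of _ "[1,1]" 2]) (simp_all add: power_expand algebra_simps s_t)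
  show "1 + s^4 \<noteq> 0" by (rule nz_by_horner[of _ "[1,0,1]" 0]) (simp_all add: power_expand algebra_simps s_t)
qed

lemma eigen_gap: "1 + (- (t^2)) * (- (t^2)) \<noteq> 0" "1 + q * q \<noteq> 0"
  using nonzero_consts q_facts(3) by (simp_all add: power_expand mult.assoc)

context
  fixes k M
  assumes M: "fv.subspace M" and relM: "pair_rels k \<subseteq> M"
begin

lemma pair_mem: "x \<in> Tens k \<Longrightarrow> y \<in> Tens k \<Longrightarrow> Suc i < k \<Longrightarrow> tensor k x y + tensor k (R i x) (R i y) \<in> M"
  using pair_rels_pair relM by blast

lemma pair_eigen:
  assumes "x \<in> Tens k" "y \<in> Tens k" "Suc i < k" "R i x = a *v x" "R i y = b *v y" "1 + a * b \<noteq> 0"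
  shows "tensor k x y \<in> M"
proof (rule subspace_scaleD[OF M _ assms(6)])
  have "(1 + a * b) *v tensor k x y = tensor k x y + tensor k (R i x) (R i y)"
    unfolding assms(4,5) by (simp add: tensor_linear fun_eq_iff algebra_simps)
  then show "(1 + a * b) *v tensor k x y \<in> M" using pair_mem[OF assms(1-3)] by simp
qed

lemma pair_add: "tensor k x y \<in> M \<Longrightarrow> tensor k x z \<in> M \<Longrightarrow> tensor k x (y + z) \<in> M"
  "tensor k x y \<in> M \<Longrightarrow> tensor k z y \<in> M \<Longrightarrow> tensor k (x + z) y \<in> M"
  by (auto simp only: tensor_linear intro!: fv.subspace_add[OF M])

text \<open>None of the products of \<open>q\<^sup>-\<^sup>2\<close> with the three eigenvalues equals \<open>-1\<close>.\<close>
lemma pair_cup: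
  assumes "x \<in> Tens k" "y \<in> Tens k" "Suc i < k" "R i y = t^4 *v y"
  shows "tensor k x y \<in> M" "tensor k y x \<in> M"
proof -
  obtain a b c where d: "x = a + b + c" "a \<in> Tens k" "b \<in> Tens k" "c \<in> Tens k"
    "R i a = q *v a" "R i b = (- (t^2)) *v b" "R i c = t^4 *v c"
    using eigen_decomposition[OF assms(1,3)] by metis
  have e: "1 + q * t^4 \<noteq> 0" "1 + - (t^2) * t^4 \<noteq> 0" "1 + t^4 * t^4 \<noteq> 0"
    using nonzero_consts by (simp_all add: power_expand algebra_simps s_t)
  have e': "1 + t^4 * q \<noteq> 0" "1 + t^4 * - (t^2) \<noteq> 0" using e(1,2) by (simp_all add: mult.commute)
  note p = pair_eigen[OF _ _ assms(3)]
  have "tensor k a y \<in> M" "tensor k b y \<in> M" "tensor k c y \<in> M"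
    using p[OF d(2) assms(2) d(5) assms(4)] p[OF d(3) assms(2) d(6) assms(4)]
      p[OF d(4) assms(2) d(7) assms(4)] e by blast+
  then show "tensor k x y \<in> M" unfolding d(1) by (intro pair_add)
  have "tensor k y a \<in> M" "tensor k y b \<in> M" "tensor k y c \<in> M"
    using p[OF assms(2) d(2) assms(4) d(5)] p[OF assms(2) d(3) assms(4) d(6)]
      p[OF assms(2) d(4) assms(4) d(7)] e e' by blast+
  then show "tensor k y x \<in> M" unfolding d(1) by (intro pair_add)
qed

text \<open>Stability under \<open>R\<^sub>p\<close> holds because the relations move the operator to the other factor:
  \<open>R\<^sub>p x \<otimes> y\<close> is congruent to \<open>- x \<otimes> R\<^sub>p\<^sup>-\<^sup>1 y\<close>.\<close>
lemma absorbing_left: "absorbing k {x \<in> Tens k. \<forall>y\<in>Tens k. tensor k x y \<in> M}"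
  unfolding absorbing_def
proof (intro conjI allI impI)
  show "fv.subspace {x \<in> Tens k. \<forall>y\<in>Tens k. tensor k x y \<in> M}"
    unfolding fv.subspace_def
    by (auto simp: tensor_linear fv.subspace_0[OF M] fv.subspace_add[OF M] fv.subspace_scale[OF M])
  fix p x assume p: "Suc p < k"
  show "x \<in> {x \<in> Tens k. \<forall>y\<in>Tens k. tensor k x y \<in> M} \<Longrightarrow> R p x \<in> {x \<in> Tens k. \<forall>y\<in>Tens k. tensor k x y \<in> M}"
  proof safe
    fix y assume x: "x \<in> Tens k" "\<forall>y\<in>Tens k. tensor k x y \<in> M" and y: "y \<in> Tens k"
    have "tensor k x (Ri p y) + tensor k (R p x) y \<in> M"
      using pair_mem[OF x(1) Ri_Tens[OF y] p] Ri_R(2)[OF y p] by metis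
    then have "(tensor k x (Ri p y) + tensor k (R p x) y) - tensor k x (Ri p y) \<in> M"
      using x y by (intro fv.subspace_diff[OF M]) auto
    then show "tensor k (R p x) y \<in> M" by simp
  qed auto
  show "x \<in> Tens k \<Longrightarrow> R p x = t^4 *v x \<Longrightarrow> x \<in> {x \<in> Tens k. \<forall>y\<in>Tens k. tensor k x y \<in> M}"
    using pair_cup p by blast
qed auto

text \<open>The variant with the left factor restricted to a set stable under the inverse operators allows one
  module over the Hecke algebra to be treated at a time.\<close>
lemma absorbing_right:
  assumes V: "V \<subseteq> Tens k" and cl: "\<And>x i. x \<in> V \<Longrightarrow> Suc i < k \<Longrightarrow> Ri i x \<in> V"
  shows "absorbing k {y \<in> Tens k. \<forall>x\<in>V. tensor k x y \<in> M}"
  unfolding absorbing_def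
proof (intro conjI allI impI)
  show "fv.subspace {y \<in> Tens k. \<forall>x\<in>V. tensor k x y \<in> M}"
    unfolding fv.subspace_def
    by (auto simp: tensor_linear fv.subspace_0[OF M] fv.subspace_add[OF M] fv.subspace_scale[OF M])
  fix p y assume p: "Suc p < k"
  show "y \<in> {y \<in> Tens k. \<forall>x\<in>V. tensor k x y \<in> M} \<Longrightarrow> R p y \<in> {y \<in> Tens k. \<forall>x\<in>V. tensor k x y \<in> M}"
  proof safe
    fix x assume y: "y \<in> Tens k" "\<forall>x\<in>V. tensor k x y \<in> M" and x: "x \<in> V"
    have "tensor k (Ri p x) y + tensor k x (R p y) \<in> M"
      using pair_mem[OF Ri_Tens y(1) p, of x p] Ri_R(2)[OF _ p, of x] x V by (metis subsetD)
    then have "(tensor k (Ri p x) y + tensor k x (R p y)) - tensor k (Ri p x) y \<in> M"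
      using x y cl[OF x p] by (intro fv.subspace_diff[OF M]) auto
    then show "tensor k x (R p y) \<in> M" by simp
  qed auto
  show "y \<in> Tens k \<Longrightarrow> R p y = t^4 *v y \<Longrightarrow> y \<in> {y \<in> Tens k. \<forall>x\<in>V. tensor k x y \<in> M}"
    using pair_cup(1)[OF subsetD[OF V] _ p] by simp
qed auto

lemma absorbing_right_all: "absorbing k {y \<in> Tens k. \<forall>x\<in>Tens k. tensor k x y \<in> M}"
  by (rule absorbing_right) auto

lemma absorbing_right_eigen:
  assumes "x \<in> Tens k" "c \<noteq> 0" "\<And>i. Suc i < k \<Longrightarrow> R i x = c *v x"
  shows "absorbing k {y \<in> Tens k. tensor k x y \<in> M}"
proof -
  have "absorbing k {y \<in> Tens k. \<forall>z\<in>range (\<lambda>d. d *v x). tensor k z y \<in> M}"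
  proof (rule absorbing_right)
    show "range (\<lambda>d. d *v x) \<subseteq> Tens k" using assms(1) by auto
    fix z i assume z: "z \<in> range (\<lambda>d. d *v x)" and i: "Suc i < k"
    then obtain d where d: "z = d *v x" by auto
    have "z = R i ((d / c) *v x)" using assms(2) assms(3)[OF i] by (auto simp: d fun_eq_iff)
    then have "Ri i z = (d / c) *v x" using Ri_R(1)[OF _ i] assms(1) by (metis Tens_intros(3))
    then show "Ri i z \<in> range (\<lambda>d. d *v x)" by auto
  qed
  moreover have "{y \<in> Tens k. \<forall>z\<in>range (\<lambda>d. d *v x). tensor k z y \<in> M} = {y \<in> Tens k. tensor k x y \<in> M}"
  proof -
    have "x = 1 *v x" by (simp add: fun_eq_iff)
    then have x: "x \<in> range (\<lambda>d. d *v x)" by (rule range_eqI)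
    have "tensor k z y \<in> M" if "z \<in> range (\<lambda>d. d *v x)" "tensor k x y \<in> M" for z y
      using that by (auto simp: tensor_linear intro: fv.subspace_scale[OF M])
    then show ?thesis using x by blast
  qed
  ultimately show ?thesis by simp
qed

lemma tensors_cover:
  assumes "\<And>x y. x \<in> Tens k \<Longrightarrow> y \<in> Tens k \<Longrightarrow> tensor k x y \<in> M"
  shows "Tens (k + k) \<subseteq> M"
proof (rule Tens_subset_subspace[OF M])
  fix u assume u: "u \<in> words (k + k)"
  then have "word u = tensor k (word (take k u)) (word (drop k u))"
    using tensor_word[of "take k u" "drop k u"] by simp
  moreover have "take k u \<in> words k" "drop k u \<in> words k" using u words_append by blast+
  ultimately show "word u \<in> M" using assms word_in_Tens by metis
qed

end

section \<open>Degree three: the spanning family\<close>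

definition mix2 :: "nat \<Rightarrow> vec" where "mix2 m = R (Suc 0) (mix m)"

text \<open>The two-dimensional module of \<open>H\<^sub>3\<close> with basis \<open>mix m\<close>, \<open>mix2 m\<close> is isomorphic to its dual twisted by
  the sign. So the product of two copies contains, up to scalars, one vector \<open>g\<close> with
  \<open>R\<^sub>i R\<^sub>3\<^sub>+\<^sub>i g = - g\<close> for \<open>i = 0, 1\<close>; as the matrices in these bases do not depend on \<open>m\<close>, it is a
  determinant.\<close>
definition mixed :: "nat \<Rightarrow> nat \<Rightarrow> vec" where
  "mixed m n = tensor 3 (mix m) (mix2 n) - tensor 3 (mix2 m) (mix n)"

lemma mix2_Tens [simp]: "mix2 m \<in> Tens 3" by (simp add: mix2_def)

lemma R_mix2:
  assumes "m < 5"
  shows "R (Suc 0) (mix2 m) = mix m + (s^2 - t^2) *v mix2 m" "R 0 (mix2 m) = q *v mix2 m - s^4 *v mix m"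
  using R11_mix[OF assms] R01_mix[OF assms] by (simp_all add: mix2_def)

lemma Suc_less_3_cases: "Suc i < 3 \<Longrightarrow> i = 0 \<or> i = Suc 0" by auto

text \<open>The sets of vectors that vanish against \<open>alt3\<close>, against \<open>sym3 n\<close>, and against the module spanned by
  \<open>mix m\<close> and \<open>mix2 m\<close> are absorbing, so by \<open>spanning3\<close> it suffices to test them on
  the explicit vectors; then \<open>spanning3\<close> applies once more to the left factor.\<close>
lemma degree3_cover:
  assumes M: "fv.subspace M" and relM: "pair_rels 3 \<subseteq> M"
    and sa: "\<And>m. m < 7 \<Longrightarrow> tensor 3 (sym3 m) alt3 \<in> M" and as: "\<And>m. m < 7 \<Longrightarrow> tensor 3 alt3 (sym3 m) \<in> M"
    and g: "\<And>m n. m < 5 \<Longrightarrow> n < 5 \<Longrightarrow> mixed m n \<in> M"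
  shows "Tens (3 + 3) \<subseteq> M"
proof (rule tensors_cover[OF M relM])
  note pe = pair_eigen[OF M relM]
  note Madd = fv.subspace_add[OF M] and Msc = fv.subspace_scale[OF M] and Mdiff = fv.subspace_diff[OF M]
  have alt3_all: "tensor 3 alt3 y \<in> M" if "y \<in> Tens 3" for y
  proof -
    let ?Q = "{y \<in> Tens 3. tensor 3 alt3 y \<in> M}"
    have "absorbing 3 ?Q"
      by (rule absorbing_right_eigen[OF M relM alt3_Tens, of "- (t^2)"]) (use Suc_less_3_cases R0_alt3 R1_alt3 in auto)
    moreover have "alt3 \<in> ?Q"
      using pe[OF alt3_Tens alt3_Tens _ R0_alt3 R0_alt3 eigen_gap(1)] by simp
    moreover have "mix m \<in> ?Q" if "m < 5" for m
      using pe[OF alt3_Tens mix_Tens _ R0_alt3 R0_mix[OF that] eigen_gap(1)] by simp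
    moreover have "sym3 m \<in> ?Q" if "m < 7" for m using as[OF that] by simp
    ultimately show ?thesis using spanning3[of ?Q] that by blast
  qed
  have sym3_mix: "tensor 3 (mix m) (sym3 n) \<in> M \<and> tensor 3 (mix2 m) (sym3 n) \<in> M \<and> tensor 3 (sym3 n) (mix m) \<in> M"
    if mn: "m < 5" "n < 7" for m n
  proof -
    \<comment> \<open>The two relations are a linear system for \<open>?X\<close> and \<open>?Y\<close> with determinant
      \<open>1 + q\<^sup>2 + q\<^sup>4\<close>.\<close>
    let ?X = "tensor 3 (mix m) (sym3 n)" and ?Y = "tensor 3 (mix2 m) (sym3 n)"
    have 1: "?X + q *v ?Y \<in> M"
      using pair_mem[OF M relM mix_Tens sym3_Tens, of "Suc 0" m n] R1_sym3[OF mn(2)] by (simp add: mix2_def tensor_linear)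
    have 2: "?Y + q *v (q *v ?Y - s^4 *v ?X) \<in> M"
      using pair_mem[OF M relM mix2_Tens sym3_Tens, of 0 m n] R0_sym3[OF mn(2)] R_mix2(2)[OF mn(1)] by (simp add: tensor_linear fv.scale_right_diff_distrib)
    have Y: "?Y \<in> M"
    proof (rule subspace_scaleD[OF M])
      have "(1 + q^2 + q^4) *v ?Y = (?Y + q *v (q *v ?Y - s^4 *v ?X)) + (q * s^4) *v (?X + q *v ?Y)"
        by (simp add: fun_eq_iff power_expand algebra_simps)
      also have "\<dots> \<in> M" by (intro Madd Msc 1 2)
      finally show "(1 + q^2 + q^4) *v ?Y \<in> M" .
    qed (use q_facts in simp)
    have "?X = (?X + q *v ?Y) - q *v ?Y" by simp
    then have X: "?X \<in> M" using 1 Y Mdiff Msc by metis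
    let ?X' = "tensor 3 (sym3 n) (mix m)" and ?Y' = "tensor 3 (sym3 n) (mix2 m)"
    have 3: "?X' + q *v ?Y' \<in> M"
      using pair_mem[OF M relM sym3_Tens mix_Tens, of "Suc 0" n m] R1_sym3[OF mn(2)] by (simp add: mix2_def tensor_linear)
    have 4: "?Y' + q *v (q *v ?Y' - s^4 *v ?X') \<in> M"
      using pair_mem[OF M relM sym3_Tens mix2_Tens, of 0 n m] R0_sym3[OF mn(2)] R_mix2(2)[OF mn(1)] by (simp add: tensor_linear fv.scale_right_diff_distrib)
    have Y': "?Y' \<in> M"
    proof (rule subspace_scaleD[OF M])
      have "(1 + q^2 + q^4) *v ?Y' = (?Y' + q *v (q *v ?Y' - s^4 *v ?X')) + (q * s^4) *v (?X' + q *v ?Y')"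
        by (simp add: fun_eq_iff power_expand algebra_simps)
      also have "\<dots> \<in> M" by (intro Madd Msc 3 4)
      finally show "(1 + q^2 + q^4) *v ?Y' \<in> M" .
    qed (use q_facts in simp)
    have "?X' = (?X' + q *v ?Y') - q *v ?Y'" by simp
    then have "?X' \<in> M" using 3 Y' Mdiff Msc by metis
    with X Y show ?thesis by blast
  qed
  have sym3_all: "tensor 3 (sym3 n) y \<in> M" if n: "n < 7" and y: "y \<in> Tens 3" for n y
  proof -
    let ?Q = "{y \<in> Tens 3. tensor 3 (sym3 n) y \<in> M}"
    have "absorbing 3 ?Q"
      by (rule absorbing_right_eigen[OF M relM sym3_Tens, of q]) (use Suc_less_3_cases R0_sym3[OF n] R1_sym3[OF n] in auto)
    moreover have "alt3 \<in> ?Q" using sa[OF n] by simp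
    moreover have "mix m \<in> ?Q" if "m < 5" for m using sym3_mix[OF that n] by simp
    moreover have "sym3 m \<in> ?Q" if "m < 7" for m
      using pe[OF sym3_Tens sym3_Tens _ R0_sym3[OF n] R0_sym3[OF that] eigen_gap(2)] by simp
    ultimately show ?thesis using spanning3[of ?Q] y by blast
  qed
  have mix_all: "tensor 3 (mix m) y \<in> M" if m: "m < 5" and y: "y \<in> Tens 3" for m y
  proof -
    let ?V = "{a *v mix m + b *v mix2 m | a b. True}"
    let ?Q = "{y \<in> Tens 3. \<forall>x\<in>?V. tensor 3 x y \<in> M}"
    have Q_iff: "y \<in> ?Q \<longleftrightarrow> y \<in> Tens 3 \<and> tensor 3 (mix m) y \<in> M \<and> tensor 3 (mix2 m) y \<in> M" for y
    proof
      assume "y \<in> ?Q"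
      moreover have "mix m = 1 *v mix m + 0 *v mix2 m" "mix2 m = 0 *v mix m + 1 *v mix2 m"
        by (auto simp: fun_eq_iff)
      then have "mix m \<in> ?V" "mix2 m \<in> ?V" by blast+
      ultimately show "y \<in> Tens 3 \<and> tensor 3 (mix m) y \<in> M \<and> tensor 3 (mix2 m) y \<in> M" by blast
    next
      assume "y \<in> Tens 3 \<and> tensor 3 (mix m) y \<in> M \<and> tensor 3 (mix2 m) y \<in> M"
      then show "y \<in> ?Q" by (auto simp: tensor_linear intro!: Madd Msc)
    qed
    have VW: "?V \<subseteq> Tens 3" by auto
    have "absorbing 3 ?Q"
    proof (rule absorbing_right[OF M relM VW])
      fix x i assume "x \<in> ?V" and i: "Suc i < 3"
      then obtain a b where x: "x = a *v mix m + b *v mix2 m" by auto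
      define a' b' where "a' = (if i = 0 then - (q * a) - s^4 * b else b - (s^2 - t^2) * a)"
        and "b' = (if i = 0 then t^2 * b else a)"
      have "x = R i (a' *v mix m + b' *v mix2 m)"
        using Suc_less_3_cases[OF i]
      proof
        assume "i = 0"
        then show ?thesis
          by (simp add: a'_def b'_def x R_mix2(2)[OF m] R0_mix[OF m]) (simp add: fun_eq_iff power_expand algebra_simps s_t)
      next
        assume "i = Suc 0"
        then show ?thesis
          by (simp add: a'_def b'_def x R_mix2(1)[OF m] mix2_def[symmetric]) (simp add: fun_eq_iff power_expand algebra_simps s_t)
      qed
      then have "Ri i x = a' *v mix m + b' *v mix2 m"
        using Ri_R(1)[OF _ i] by (metis Tens_intros(2,3) mix_Tens mix2_Tens)
      then show "Ri i x \<in> ?V" by blast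
    qed
    moreover have "alt3 \<in> ?Q"
    proof -
      have w: "tensor 3 (mix m) alt3 \<in> M" using pe[OF mix_Tens alt3_Tens _ R0_mix[OF m] R0_alt3 eigen_gap(1)] by simp
      have "tensor 3 (mix m) alt3 + (- (t^2)) *v tensor 3 (mix2 m) alt3 \<in> M"
        using pair_mem[OF M relM mix_Tens alt3_Tens, of "Suc 0" m] R1_alt3 by (simp add: mix2_def tensor_linear tensor_minus)
      from Mdiff[OF this w] have "(- (t^2)) *v tensor 3 (mix2 m) alt3 \<in> M"
        by (rule back_subst[of "\<lambda>x. x \<in> M"]) (simp add: fun_eq_iff)
      then have "tensor 3 (mix2 m) alt3 \<in> M" by (rule subspace_scaleD[OF M]) simp
      then show ?thesis unfolding Q_iff using w by simp
    qed
    \<comment> \<open>The relations at both positions cut the span of the four products of \<open>mix\<close> and \<open>mix2\<close> down to a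
      line, which the hypothesis on \<open>mixed\<close> removes.\<close>
    moreover have "mix n \<in> ?Q" if n: "n < 5" for n
    proof -
      have w: "tensor 3 (mix m) (mix n) \<in> M"
        using pe[OF mix_Tens mix_Tens _ R0_mix[OF m] R0_mix[OF n] eigen_gap(1)] by simp
      have "tensor 3 (mix m) (mix n) + tensor 3 (mix2 m) (mix2 n) \<in> M"
        using pair_mem[OF M relM mix_Tens mix_Tens, of "Suc 0" m n] by (simp add: mix2_def)
      from Mdiff[OF this w] have v: "tensor 3 (mix2 m) (mix2 n) \<in> M" by simp
      have "tensor 3 (mix m) (mix2 n) + (tensor 3 (mix2 m) (mix n) + (s^2 - t^2) *v tensor 3 (mix2 m) (mix2 n)) \<in> M"
        using pair_mem[OF M relM mix_Tens mix2_Tens, of "Suc 0" m n] R_mix2[OF n] by (simp add: mix2_def[symmetric] tensor_linear)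
      from Mdiff[OF Mdiff[OF this Msc[OF v, of "s^2 - t^2"]] g[OF m n]]
      have "2 *v tensor 3 (mix2 m) (mix n) \<in> M"
        unfolding mixed_def by (rule back_subst[of "\<lambda>x. x \<in> M"]) (simp add: fun_eq_iff algebra_simps)
      then have "tensor 3 (mix2 m) (mix n) \<in> M" by (rule subspace_scaleD[OF M]) simp
      then show ?thesis unfolding Q_iff using w by simp
    qed
    moreover have "sym3 n \<in> ?Q" if "n < 7" for n unfolding Q_iff using sym3_mix[OF m that] by simp
    ultimately have "y \<in> ?Q" using spanning3[of ?Q] y by blast
    then show ?thesis using Q_iff by blast
  qed
  let ?Q = "{x \<in> Tens 3. \<forall>y\<in>Tens 3. tensor 3 x y \<in> M}"
  have "absorbing 3 ?Q" by (rule absorbing_left[OF M relM])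
  moreover have "alt3 \<in> ?Q" using alt3_all by simp
  moreover have "mix m \<in> ?Q" if "m < 5" for m using mix_all[OF that] by simp
  moreover have "sym3 m \<in> ?Q" if "m < 7" for m using sym3_all[OF that] by simp
  ultimately have "Tens 3 \<subseteq> ?Q" by (rule spanning3)
  then show "tensor 3 x y \<in> M" if "x \<in> Tens 3" "y \<in> Tens 3" for x y using that by blast
qed

section \<open>Dual systems\<close>
text \<open>Such a \<open>G\<close> is a basis of \<open>Tens (k + k)\<close> modulo \<open>pair_rels k\<close>: it spans by the last clause, and pairing
  with its elements, which is well defined on the quotient, shows independence.\<close>
definition dual_system :: "nat \<Rightarrow> vec set \<Rightarrow> bool" where
  "dual_system k G \<longleftrightarrow> finite G \<and> G \<subseteq> Tens (k + k) \<and>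
     (\<forall>g\<in>G. form (k + k) g g \<noteq> 0) \<and>
     (\<forall>g\<in>G. \<forall>g'\<in>G. g \<noteq> g' \<longrightarrow> form (k + k) g g' = 0) \<and>
     (\<forall>g\<in>G. \<forall>x\<in>pair_rels k. form (k + k) g x = 0) \<and>
     (\<forall>M. fv.subspace M \<longrightarrow> pair_rels k \<subseteq> M \<longrightarrow> G \<subseteq> M \<longrightarrow> Tens (k + k) \<subseteq> M)"

text \<open>\<open>R\<^sub>i R\<^sub>k\<^sub>+\<^sub>i\<close> is self-adjoint for the form, so pairing with \<open>g\<close> turns \<open>R\<^sub>i R\<^sub>k\<^sub>+\<^sub>i h\<close> into \<open>- h\<close>.\<close>
lemma orthogonal_pair_rels:
  assumes "g \<in> Tens (k + k)" "\<And>i. Suc i < k \<Longrightarrow> R i (R (k + i) g) = - g" "x \<in> pair_rels k"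
  shows "form (k + k) g x = 0"
proof -
  have "pair_rels k \<subseteq> {x. form (k + k) g x = 0}"
    unfolding pair_rels_def
  proof (rule fv.span_minimal)
    show "fv.subspace {x. form (k + k) g x = 0}"
      by (auto simp: fv.subspace_def form_linear)
    show "{h + R i (R (k + i) h) |i h. Suc i < k \<and> h \<in> Tens (k + k)} \<subseteq> {x. form (k + k) g x = 0}"
    proof safe
      fix i h assume i: "Suc i < k"
      have "form (k + k) g (R i (R (k + i) h)) = form (k + k) (R (k + i) (R i g)) h"
        using i by (simp add: form_R[symmetric])
      also have "R (k + i) (R i g) = - g"
        using R_commute[of i "k + i" g] assms(2)[OF i] i by simp
      also have "form (k + k) (- g) h = - form (k + k) g h"
        using form_sc_left[of "k + k" "-1" g h] by (simp add: fv.scale_minus_left[symmetric])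
      finally show "form (k + k) g (h + R i (R (k + i) h)) = 0" by (simp add: form_linear)
    qed
  qed
  then show ?thesis using assms(3) by blast
qed

lemma dual_systemI:
  assumes "finite A" "\<And>a. a \<in> A \<Longrightarrow> f a \<in> Tens (k + k)"
    and "\<And>a. a \<in> A \<Longrightarrow> form (k + k) (f a) (f a) \<noteq> 0"
    and orth: "\<And>a b. a \<in> A \<Longrightarrow> b \<in> A \<Longrightarrow> a \<noteq> b \<Longrightarrow> form (k + k) (f a) (f b) = 0"
    and "\<And>a i. a \<in> A \<Longrightarrow> Suc i < k \<Longrightarrow> R i (R (k + i) (f a)) = - f a"
    and "\<And>M. fv.subspace M \<Longrightarrow> pair_rels k \<subseteq> M \<Longrightarrow> (\<And>a. a \<in> A \<Longrightarrow> f a \<in> M) \<Longrightarrow> Tens (k + k) \<subseteq> M"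
  shows "dual_system k (f ` A) \<and> card (f ` A) = card A"
proof
  have "inj_on f A"
    using assms(3) orth by (intro inj_onI) metis
  then show "card (f ` A) = card A" by (rule card_image)
  show "dual_system k (f ` A)"
    unfolding dual_system_def
    using assms orthogonal_pair_rels by (auto simp: image_subset_iff)
qed

lemma R_pair: "Suc i < k \<Longrightarrow> R i (R (k + i) (tensor k x y)) = tensor k (R i x) (R i y)"
  unfolding local_op_tensor_right by (rule local_op_tensor_left)

section \<open>Degrees zero and one\<close>

lemma degree_small:
  assumes "k \<le> 1"
  shows "dual_system k (word ` words (k + k)) \<and> card (word ` words (k + k)) = card (words (k + k))"
proof (rule dual_systemI)
  show "Tens (k + k) \<subseteq> M" if "fv.subspace M" "\<And>a. a \<in> words (k + k) \<Longrightarrow> word a \<in> M" for M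
    using that by (rule Tens_subset_subspace)
qed (use assms in \<open>auto simp del: word_words simp: form_word word_def\<close>)

lemma card_words: "card (words n) = 3 ^ n"
proof -
  have "words n = {xs. set xs \<subseteq> idx \<and> length xs = n}" by (auto simp: words_def)
  moreover have "card idx = 3" by (simp add: idx_def)
  ultimately show ?thesis by (simp add: card_lists_length_eq)
qed

section \<open>Degree three: orthogonality\<close>

text \<open>The ratio of \<open>\<langle>mix m, mix2 n\<rangle>\<close> to \<open>\<langle>mix m, mix n\<rangle>\<close>; it comes from evaluating
  \<open>\<langle>R\<^sub>0 (mix m), mix2 n\<rangle> = \<langle>mix m, R\<^sub>0 (mix2 n)\<rangle>\<close>.\<close>
definition mix_ratio :: complex where "mix_ratio = s^4 / (s^2 + t^2)"

lemma mix_ratio_eq: "mix_ratio * (s^2 + t^2) = s^4"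
  using gaps(1) by (simp add: mix_ratio_def)

lemma form_eigen:
  assumes "R 0 x = a *v x" "R 0 y = b *v y" "a \<noteq> b"
  shows "form 3 x y = 0"
proof -
  have "a * form 3 x y = b * form 3 x y"
    using form_R[of 0 3 x y] assms(1,2) by (simp add: form_linear)
  then show ?thesis using assms(3) by simp
qed

lemma q_ne: "q \<noteq> - (t^2)"
  using gaps(1) by (metis add.left_inverse)

lemma form_sym3_alt3: "m < 7 \<Longrightarrow> form 3 (sym3 m) alt3 = 0"
  by (rule form_eigen[OF R0_sym3 R0_alt3 q_ne])

lemma form_sym3_mix: "m < 7 \<Longrightarrow> n < 5 \<Longrightarrow> form 3 (sym3 m) (mix n) = 0"
  by (rule form_eigen[OF R0_sym3 R0_mix q_ne])

lemma form_sym3_mix2: "m < 7 \<Longrightarrow> n < 5 \<Longrightarrow> form 3 (sym3 m) (mix2 n) = 0"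
  using form_R[of "Suc 0" 3 "sym3 m" "mix n"] R1_sym3[of m] form_sym3_mix[of m n]
  by (simp add: mix2_def form_linear)

lemma gram_numerator_nz: "t^4 + 1 + s^4 \<noteq> 0"
  by (rule nz_by_horner[of _ "[1,0,1,0,1]" 4]) (simp_all add: power_expand algebra_simps s_t)

lemma form_mix_mix2:
  assumes "m < 5" "n < 5"
  shows "form 3 (mix m) (mix2 n) = mix_ratio * form 3 (mix m) (mix n)"
    and "form 3 (mix2 m) (mix n) = mix_ratio * form 3 (mix m) (mix n)"
    and "form 3 (mix2 m) (mix2 n) = (1 + (s^2 - t^2) * mix_ratio) * form 3 (mix m) (mix n)"
proof -
  have 1: "form 3 (mix m) (mix2 n) = mix_ratio * form 3 (mix m) (mix n)" if "m < 5" "n < 5" for m n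
  proof -
    have "- (t^2) * form 3 (mix m) (mix2 n) = q * form 3 (mix m) (mix2 n) - s^4 * form 3 (mix m) (mix n)"
      using form_R[of 0 3 "mix m" "mix2 n"] unfolding R0_mix[OF that(1)] R_mix2(2)[OF that(2)]
      by (simp add: form_linear del: fv.scale_minus_left)
    then have "(s^2 + t^2) * form 3 (mix m) (mix2 n) = s^4 * form 3 (mix m) (mix n)"
      by (simp add: algebra_simps)
    then have "(s^2 + t^2) * form 3 (mix m) (mix2 n) = (s^2 + t^2) * (mix_ratio * form 3 (mix m) (mix n))"
      by (simp add: mix_ratio_eq[symmetric] mult.commute mult.left_commute)
    then show ?thesis using gaps(1) by simp
  qed
  show "form 3 (mix m) (mix2 n) = mix_ratio * form 3 (mix m) (mix n)" by (rule 1[OF assms])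
  show "form 3 (mix2 m) (mix n) = mix_ratio * form 3 (mix m) (mix n)"
    using 1[OF assms(2,1)] form_commute by metis
  have "form 3 (mix2 m) (mix2 n) = form 3 (mix m) (R (Suc 0) (mix2 n))"
    unfolding mix2_def[of m] by (rule form_R) simp
  then show "form 3 (mix2 m) (mix2 n) = (1 + (s^2 - t^2) * mix_ratio) * form 3 (mix m) (mix n)"
    using 1[OF assms] by (simp add: R_mix2(1)[OF assms(2)] form_linear algebra_simps)
qed

text \<open>The Gram determinant of \<open>mix m\<close>, \<open>mix2 m\<close> divided by the square of \<open>\<langle>mix m, mix m\<rangle>\<close>; it is
  half of the square of \<open>mixed m m\<close> in the same normalisation.\<close>
lemma gram_nz: "1 + (s^2 - t^2) * mix_ratio - mix_ratio^2 \<noteq> 0"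
proof -
  have "(1 + (s^2 - t^2) * mix_ratio - mix_ratio^2) * (s^2 + t^2)^2
      = (s^2 + t^2)^2 + (s^2 - t^2) * (s^2 + t^2) * (mix_ratio * (s^2 + t^2)) - (mix_ratio * (s^2 + t^2))^2"
    by (simp add: power2_eq_square algebra_simps)
  also have "\<dots> = t^4 + 1 + s^4"
    unfolding mix_ratio_eq by (simp add: power_expand algebra_simps s_t)
  finally show ?thesis using gram_numerator_nz by auto
qed

lemma form_6: "form 6 (tensor 3 x y) (tensor 3 x' y') = form 3 x x' * form 3 y y'"
  using form_tensor[of 3 3 x y x' y'] by simp

lemma R_pair3: "R 0 (R 3 (tensor 3 x y)) = tensor 3 (R 0 x) (R 0 y)"
  "R (Suc 0) (R 4 (tensor 3 x y)) = tensor 3 (R (Suc 0) x) (R (Suc 0) y)"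
  using R_pair[of 0 3 x y] R_pair[of "Suc 0" 3 x y] by simp_all

definition family3 :: "(nat + nat) + (nat \<times> nat) \<Rightarrow> vec" where
  "family3 a = (case a of Inl (Inl m) \<Rightarrow> tensor 3 (sym3 m) alt3 | Inl (Inr m) \<Rightarrow> tensor 3 alt3 (sym3 m)
     | Inr (m, n) \<Rightarrow> mixed m n)"

text \<open>Vectors of different families are orthogonal because of distinct eigenvalues of \<open>R\<^sub>0\<close> or \<open>R\<^sub>1\<close> in one
  of the two factors, those of the same family because of distinct weights.\<close>
lemma degree3: "\<exists>G. dual_system 3 G \<and> card G = 39"
proof -
  let ?A = "({..<7} <+> {..<7}) <+> ({..<5::nat} \<times> {..<5::nat}) :: ((nat + nat) + (nat \<times> nat)) set"
  have "dual_system 3 (family3 ` ?A) \<and> card (family3 ` ?A) = card ?A"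
  proof (rule dual_systemI)
    fix a assume a: "a \<in> ?A"
    show "family3 a \<in> Tens (3 + 3)"
      by (auto simp: family3_def mixed_def split: sum.split prod.split intro!: Tens_intros(4) Tens_mem_tensor[of _ 3 _ 3])
    have g: "form 6 (mixed m n) (mixed m n) \<noteq> 0" if "m < 5" "n < 5" for m n
    proof -
      have "form 6 (mixed m n) (mixed m n) = 2 * (1 + (s^2 - t^2) * mix_ratio - mix_ratio^2) * (form 3 (mix m) (mix m) * form 3 (mix n) (mix n))"
        unfolding mixed_def using that
        by (simp add: form_linear form_6 form_mix_mix2 power2_eq_square algebra_simps)
      then show ?thesis
        using form_mix_self[OF that(1)] form_mix_self[OF that(2)] gram_nz by (metis mult_eq_0_iff zero_neq_numeral)
    qed
    show "form (3 + 3) (family3 a) (family3 a) \<noteq> 0"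
      using a g by (auto simp: family3_def form_6 form_alt3 form_sym3_self)
    fix i assume i: "Suc i < 3"
    show "R i (R (3 + i) (family3 a)) = - family3 a"
      using a Suc_less_3_cases[OF i]
      by (auto simp: family3_def mixed_def R_pair3 R0_sym3 R1_sym3 R0_alt3 R1_alt3 R0_mix R_mix2
          mix2_def[symmetric] tensor_linear tensor_minus fun_eq_iff power_expand algebra_simps s_t)
  next
    fix a b assume ab: "a \<in> ?A" "b \<in> ?A" "a \<noteq> b"
    have g: "form 6 (mixed m n) (mixed m' n') = 0" if "m < 5" "n < 5" "m' < 5" "n' < 5" "m \<noteq> m' \<or> n \<noteq> n'" for m n m' n'
      using that(5) form_mix_orthogonal[OF that(1,3)] form_mix_orthogonal[OF that(2,4)] unfolding mixed_def
      by (auto simp: form_linear form_6 form_mix_mix2 that)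
    have sg: "form 6 (tensor 3 (sym3 m) alt3) (mixed m' n') = 0" "form 6 (tensor 3 alt3 (sym3 m)) (mixed m' n') = 0"
      if "m < 7" "m' < 5" "n' < 5" for m m' n'
      using that unfolding mixed_def by (simp_all add: form_linear form_6 form_sym3_mix form_sym3_mix2)
    have gs: "form 6 (mixed m' n') (tensor 3 (sym3 m) alt3) = 0" "form 6 (mixed m' n') (tensor 3 alt3 (sym3 m)) = 0"
      if "m < 7" "m' < 5" "n' < 5" for m m' n'
      using sg[OF that] form_commute by metis+
    have as: "form 3 alt3 (sym3 m) = 0" if "m < 7" for m using form_sym3_alt3[OF that] form_commute by metis
    show "form (3 + 3) (family3 a) (family3 b) = 0"
      using ab sg gs
      by (auto simp: family3_def form_6 form_sym3_alt3 as) (metis form_sym3_orthogonal g)+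
  next
    fix M assume M: "fv.subspace M" "pair_rels 3 \<subseteq> M" and f: "\<And>a. a \<in> ?A \<Longrightarrow> family3 a \<in> M"
    show "Tens (3 + 3) \<subseteq> M"
    proof (rule degree3_cover[OF M])
      show "tensor 3 (sym3 m) alt3 \<in> M" if "m < 7" for m using f[of "Inl (Inl m)"] that by (auto simp: family3_def)
      show "tensor 3 alt3 (sym3 m) \<in> M" if "m < 7" for m using f[of "Inl (Inr m)"] that by (auto simp: family3_def)
      show "mixed m n \<in> M" if "m < 5" "n < 5" for m n using f[of "Inr (m, n)"] that by (auto simp: family3_def)
    qed
  qed simp
  moreover have "card ?A = 39" by (simp add: card_Plus)
  ultimately show ?thesis by metis
qed

section \<open>Degree two\<close>

definition sym2_list :: "nat \<Rightarrow> (complex \<times> nat list) list" where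
  "sym2_list m = (if m = 0 then [(1, [1,1])]
      else if m = 1 then [(1, [1,2]), (t^2, [2,1])]
      else if m = 2 then [(1, [1,3]), (t^4, [3,1]), (- (t + t^3), [2,2])]
      else if m = 3 then [(1, [2,3]), (t^2, [3,2])]
      else [(1, [3,3])])"

definition sym2 :: "nat \<Rightarrow> vec" where "sym2 m = lincomb (sym2_list m)"

lemma sym2_Tens [simp]: "sym2 m \<in> Tens 2"
  unfolding sym2_def sym2_list_def by (rule lincomb_Tens) (auto split: if_splits)

lemma R0_sym2: "m < 5 \<Longrightarrow> R 0 (sym2 m) = q *v sym2 m"
  by (drule less_5_cases, elim disjE; hypsubst; (rule eq2I, simp, intro Tens_intros, simp);
    elim idx_cases; simp add: Rrow power_expand sym2_def sym2_list_def lincomb_apply; simp add: s_t algebra_simps)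

lemma spanning2:
  assumes Q: "absorbing 2 Q" and alt: "\<And>m. m < 3 \<Longrightarrow> alt m \<in> Q" and sym2: "\<And>m. m < 5 \<Longrightarrow> sym2 m \<in> Q"
  shows "Tens 2 \<subseteq> Q"
proof -
  note sub = absorbingD(1)[OF Q]
  note Qadd = fv.subspace_add[OF sub] and Qsc = fv.subspace_scale[OF sub] and Qdiff = fv.subspace_diff[OF sub]
  have kappa: "kappa \<in> Q" by (rule absorbingD(4)[OF Q, of 0]) (simp_all add: R_kappa)
  have n2: "q + t^2 \<noteq> 0" "1 + q + t^2 \<noteq> 0"
    using gaps(1) by simp (rule nz_by_horner[of _ "[1,1,1]" 2], simp_all add: power_expand algebra_simps s_t)
  note ev = fun_eq_iff vdefs sym2_def sym2_list_def lincomb.simps power_expand algebra_simps s_t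
  have w: "word [1,1] \<in> Q" "word [3,3] \<in> Q" using sym2[of 0] sym2[of 4] by (simp_all add: sym2_def sym2_list_def lincomb.simps)
  have "(q + t^2) *v word [1,2] = q *v sym2 1 + t^2 *v alt 0" "(q + t^2) *v word [2,1] = sym2 1 - alt 0"
    "(q + t^2) *v word [2,3] = q *v sym2 3 + t^2 *v alt 2" "(q + t^2) *v word [3,2] = sym2 3 - alt 2"
    by (simp_all add: ev)
  moreover have "q *v sym2 1 + t^2 *v alt 0 \<in> Q" "sym2 1 - alt 0 \<in> Q" "q *v sym2 3 + t^2 *v alt 2 \<in> Q" "sym2 3 - alt 2 \<in> Q"
    using sym2 alt by (auto intro!: Qadd Qsc Qdiff)
  ultimately have w': "word [1,2] \<in> Q" "word [2,1] \<in> Q" "word [2,3] \<in> Q" "word [3,2] \<in> Q"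
    using subspace_scaleD[OF sub _ n2(1)] by metis+
  have d: "s *v word [2,2] - word [3,1] \<in> Q"
  proof (rule subspace_scaleD[OF sub _ nonzero_consts(2)])
    have "(1 + t^4) *v (s *v word [2,2] - word [3,1]) = alt 1 - sym2 2" by (simp add: ev)
    also have "\<dots> \<in> Q" using sym2[of 2] alt[of 1] by (intro Qdiff) auto
    finally show "(1 + t^4) *v (s *v word [2,2] - word [3,1]) \<in> Q" .
  qed
  have w22: "word [2,2] \<in> Q"
  proof (rule subspace_scaleD[OF sub _ n2(2)])
    have "(1 + q + t^2) *v word [2,2] = (kappa - t *v alt 1) + (s + t) *v (s *v word [2,2] - word [3,1])" by (simp add: ev)
    also have "\<dots> \<in> Q" using Qadd[OF Qdiff[OF kappa Qsc[OF alt]] Qsc[OF d]] by simp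
    finally show "(1 + q + t^2) *v word [2,2] \<in> Q" .
  qed
  have "word [3,1] = s *v word [2,2] - (s *v word [2,2] - word [3,1])" by simp
  then have w31: "word [3,1] \<in> Q" using d w22 Qdiff Qsc by metis
  have "word [1,3] = alt 1 - (s - t) *v word [2,2] + word [3,1]" by (simp add: ev)
  also have "\<dots> \<in> Q" using alt[of 1] w22 w31 by (intro Qadd Qdiff Qsc) auto
  finally have w13: "word [1,3] \<in> Q" .
  show ?thesis
  proof (rule Tens_subset_subspace[OF sub])
    fix u assume "u \<in> words 2"
    then obtain i j where u: "u = [i,j]" "i \<in> idx" "j \<in> idx" by (rule words2_cases)
    show "word u \<in> Q"
      unfolding u(1)
      by (rule idx_cases[OF u(2)]; rule idx_cases[OF u(3)]; simp only: w w' w22 w31 w13)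
  qed
qed

lemma sym2_list_words: "a \<in> set (sym2_list m) \<Longrightarrow> snd a \<in> words 2"
  unfolding sym2_list_def by (auto split: if_splits)

lemma form_sym2_right: "form 2 x (sym2 m) = (\<Sum>a\<leftarrow>sym2_list m. fst a * x (snd a))"
  unfolding sym2_def[of m] by (rule form_lincomb) (rule sym2_list_words)

lemma form_sym2: "m < 5 \<Longrightarrow> n < 5 \<Longrightarrow> m \<noteq> n \<Longrightarrow> form 2 (sym2 m) (sym2 n) = 0"
  unfolding form_sym2_right by (drule less_5_cases, drule less_5_cases, elim disjE; simp add: sym2_def sym2_list_def lincomb_apply)

lemma form_sym2_self: "m < 5 \<Longrightarrow> form 2 (sym2 m) (sym2 m) \<noteq> 0"
proof -
  assume m: "m < 5"
  note e = form_sym2_right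
  have "form 2 (sym2 0) (sym2 0) \<noteq> 0" "form 2 (sym2 4) (sym2 4) \<noteq> 0"
    unfolding e by (simp_all add: sym2_def sym2_list_def lincomb_apply)
  moreover have "form 2 (sym2 1) (sym2 1) \<noteq> 0" "form 2 (sym2 3) (sym2 3) \<noteq> 0"
    unfolding e using nonzero_consts(2) by (simp_all add: sym2_def sym2_list_def lincomb_apply power_expand mult.assoc)
  moreover have "form 2 (sym2 2) (sym2 2) \<noteq> 0"
    unfolding e by (rule nz_by_horner[of _ "[1,1,2,1,1]" 8])
      (simp_all add: sym2_def sym2_list_def lincomb_apply power_expand power8 algebra_simps s_t)
  ultimately show ?thesis using less_5_cases[OF m] by (elim disjE) auto
qed

lemma form_alt: "m < 3 \<Longrightarrow> n < 3 \<Longrightarrow> m \<noteq> n \<Longrightarrow> form 2 (alt m) (alt n) = 0"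
  and form_alt_self: "m < 3 \<Longrightarrow> form 2 (alt m) (alt m) \<noteq> 0"
proof -
  have w: "form 2 x (alt n) = (if n = 0 then x [1,2] - q * x [2,1]
      else if n = 1 then x [1,3] + (s - t) * x [2,2] - x [3,1] else x [2,3] - q * x [3,2])" for x n
    unfolding alt_def by (subst form_lincomb) (auto split: if_splits)
  show "m < 3 \<Longrightarrow> n < 3 \<Longrightarrow> m \<noteq> n \<Longrightarrow> form 2 (alt m) (alt n) = 0"
    unfolding w by (drule less_3_cases, drule less_3_cases, elim disjE; simp add: alt_def lincomb_apply)
  have "form 2 (alt 0) (alt 0) \<noteq> 0" "form 2 (alt 2) (alt 2) \<noteq> 0"
    unfolding w by (rule nz_by_horner[of _ "[1,0,1]" 0]; simp add: alt_def lincomb_apply power_expand algebra_simps s_t)+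
  moreover have "form 2 (alt 1) (alt 1) \<noteq> 0"
    unfolding w by (rule nz_by_horner[of _ "[1,0,1]" 2]; simp add: alt_def lincomb_apply power_expand algebra_simps s_t)
  ultimately show "m < 3 \<Longrightarrow> form 2 (alt m) (alt m) \<noteq> 0" by (drule_tac less_3_cases) auto
qed

lemma form_sym2_alt: "m < 5 \<Longrightarrow> n < 3 \<Longrightarrow> form 2 (sym2 m) (alt n) = 0" "m < 5 \<Longrightarrow> n < 3 \<Longrightarrow> form 2 (alt n) (sym2 m) = 0"
proof -
  assume mn: "m < 5" "n < 3"
  have "q * form 2 (sym2 m) (alt n) = - (t^2) * form 2 (sym2 m) (alt n)"
    using form_R[of 0 2 "sym2 m" "alt n"] unfolding R0_sym2[OF mn(1)] R_alt[OF mn(2)]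
    by (simp add: form_linear del: fv.scale_minus_left)
  then have "(s^2 + t^2) * form 2 (sym2 m) (alt n) = 0" by (simp add: algebra_simps)
  then show "form 2 (sym2 m) (alt n) = 0" using gaps(1) by simp
  then show "form 2 (alt n) (sym2 m) = 0" using form_commute by metis
qed

lemma form_4: "form 4 (tensor 2 x y) (tensor 2 x' y') = form 2 x x' * form 2 y y'"
  using form_tensor[of 2 2 x y x' y'] by simp

lemma degree2_cover:
  assumes M: "fv.subspace M" and relM: "pair_rels 2 \<subseteq> M"
    and ta: "\<And>m n. m < 5 \<Longrightarrow> n < 3 \<Longrightarrow> tensor 2 (sym2 m) (alt n) \<in> M"
    and at: "\<And>m n. m < 5 \<Longrightarrow> n < 3 \<Longrightarrow> tensor 2 (alt n) (sym2 m) \<in> M"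
  shows "Tens (2 + 2) \<subseteq> M"
proof (rule tensors_cover[OF M relM])
  note pe = pair_eigen[OF M relM]
  have alt_all: "tensor 2 (alt n) y \<in> M" if n: "n < 3" and y: "y \<in> Tens 2" for n y
  proof -
    let ?Q = "{y \<in> Tens 2. tensor 2 (alt n) y \<in> M}"
    have "absorbing 2 ?Q"
      by (rule absorbing_right_eigen[OF M relM alt_Tens, of "- (t^2)"]) (use R_alt[OF n] in auto)
    moreover have "alt m \<in> ?Q" if "m < 3" for m
      using pe[OF alt_Tens alt_Tens _ R_alt[OF n] R_alt[OF that] eigen_gap(1)] by simp
    moreover have "sym2 m \<in> ?Q" if "m < 5" for m using at[OF that n] by simp
    ultimately show ?thesis using spanning2[of ?Q] y by blast
  qed
  have sym2_all: "tensor 2 (sym2 n) y \<in> M" if n: "n < 5" and y: "y \<in> Tens 2" for n y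
  proof -
    let ?Q = "{y \<in> Tens 2. tensor 2 (sym2 n) y \<in> M}"
    have "absorbing 2 ?Q"
      by (rule absorbing_right_eigen[OF M relM sym2_Tens, of q]) (use R0_sym2[OF n] in auto)
    moreover have "alt m \<in> ?Q" if "m < 3" for m using ta[OF n that] by simp
    moreover have "sym2 m \<in> ?Q" if "m < 5" for m
      using pe[OF sym2_Tens sym2_Tens _ R0_sym2[OF n] R0_sym2[OF that] eigen_gap(2)] by simp
    ultimately show ?thesis using spanning2[of ?Q] y by blast
  qed
  let ?Q = "{x \<in> Tens 2. \<forall>y\<in>Tens 2. tensor 2 x y \<in> M}"
  have "absorbing 2 ?Q" by (rule absorbing_left[OF M relM])
  moreover have "alt m \<in> ?Q" if "m < 3" for m using alt_all[OF that] by simp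
  moreover have "sym2 m \<in> ?Q" if "m < 5" for m using sym2_all[OF that] by simp
  ultimately have "Tens 2 \<subseteq> ?Q" by (rule spanning2)
  then show "tensor 2 x y \<in> M" if "x \<in> Tens 2" "y \<in> Tens 2" for x y using that by blast
qed

definition family2 :: "(nat \<times> nat) + (nat \<times> nat) \<Rightarrow> vec" where
  "family2 a = (case a of Inl (m, n) \<Rightarrow> tensor 2 (sym2 m) (alt n) | Inr (m, n) \<Rightarrow> tensor 2 (alt n) (sym2 m))"

lemma degree2: "\<exists>G. dual_system 2 G \<and> card G = 30"
proof -
  let ?A = "({..<5} \<times> {..<3}) <+> ({..<5} \<times> {..<3}) :: ((nat \<times> nat) + (nat \<times> nat)) set"
  have "dual_system 2 (family2 ` ?A) \<and> card (family2 ` ?A) = card ?A"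
  proof (rule dual_systemI)
    fix a assume a: "a \<in> ?A"
    show "family2 a \<in> Tens (2 + 2)"
      by (auto simp: family2_def split: sum.split prod.split intro!: Tens_mem_tensor[of _ 2 _ 2])
    show "form (2 + 2) (family2 a) (family2 a) \<noteq> 0"
      using a by (auto simp: family2_def form_4 form_sym2_self form_alt_self)
    fix i assume "Suc i < 2"
    then have "i = 0" by simp
    then show "R i (R (2 + i) (family2 a)) = - family2 a"
      using a R_pair[of 0 2]
      by (auto simp: family2_def R0_sym2 R_alt tensor_linear tensor_minus fun_eq_iff power_expand algebra_simps s_t)
  next
    fix a b assume "a \<in> ?A" "b \<in> ?A" "a \<noteq> b"
    then show "form (2 + 2) (family2 a) (family2 b) = 0"
      by (auto simp: family2_def form_4 form_sym2_alt) (metis form_sym2 form_alt)+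
  next
    fix M assume M: "fv.subspace M" "pair_rels 2 \<subseteq> M" and f: "\<And>a. a \<in> ?A \<Longrightarrow> family2 a \<in> M"
    show "Tens (2 + 2) \<subseteq> M"
    proof (rule degree2_cover[OF M])
      show "tensor 2 (sym2 m) (alt n) \<in> M" if "m < 5" "n < 3" for m n using f[of "Inl (m, n)"] that by (auto simp: family2_def)
      show "tensor 2 (alt n) (sym2 m) \<in> M" if "m < 5" "n < 3" for m n using f[of "Inr (m, n)"] that by (auto simp: family2_def)
    qed
  qed simp
  moreover have "card ?A = 30" by (simp add: card_Plus)
  ultimately show ?thesis by metis
qed

section \<open>Degree four\<close>

lemma anti_right: "anti (Suc (Suc 0)) (tensor 2 x y) = tensor 2 x (anti 0 y)"
  using anti_tensor_right[of 2 0 x y] by (simp add: numeral_2_eq_2)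

lemma word4_split: "word [i,a,b,j] = tensor 2 (word [i,a]) (word [b,j])"
  using tensor_word[of "[i,a]" "[b,j]"] by (simp add: numeral_2_eq_2)

text \<open>The nine vectors \<open>alt m \<otimes> alt n\<close> are recovered from the vectors \<open>e\<^sub>i \<otimes> kappa \<otimes> e\<^sub>j\<close>, whose invariant
  vector sits in the two middle factors, by applying \<open>anti\<close> to the outer pairs. Weights split
  the linear system into blocks of sizes \<open>1, 2, 3, 2, 1\<close>. In the classical case, the product of
  two alternating tensors of \<open>\<complex>\<^sup>3\<close> has no traceless part.\<close>
lemma alt_alt_absorbed:
  assumes Q: "absorbing 4 Q" and mn: "m < 3" "n < 3"
  shows "tensor 2 (alt m) (alt n) \<in> Q"
proof -
  define X where "X m n = tensor 2 (alt m) (alt n)" for m n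
  note sub = absorbingD(1)[OF Q]
  note Qadd = fv.subspace_add[OF sub] and Qsc = fv.subspace_scale[OF sub] and Qdiff = fv.subspace_diff[OF sub]
  define y where "y i j = t *v word [i,1,3,j] + word [i,2,2,j] + s *v word [i,3,1,j]" for i j :: nat
  have yQ: "y i j \<in> Q" if "i \<in> idx" "j \<in> idx" for i j
  proof -
    have w: "tensor (Suc 0) (word [i]) (tensor 2 (word [a,b]) (word [j])) = word [i,a,b,j]" for a b
      using tensor_word[of "[i]" "[a,b,j]"] by (simp add: word3_split)
    have y: "y i j = tensor (Suc 0) (word [i]) (tensor 2 kappa (word [j]))"
      by (simp add: y_def kappa_def lincomb.simps tensor_linear w algebra_simps)
    have "R (Suc 0 + 0) (y i j) = t^4 *v y i j"
      unfolding y local_op_tensor_right by (simp add: local_op_tensor_left R_kappa tensor_linear)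
    moreover have "y i j \<in> Tens 4" unfolding y_def using that by (intro Tens_intros word_in_Tens) auto
    ultimately show ?thesis by (intro absorbingD(4)[OF Q, of "Suc 0"]) auto
  qed
  have z: "anti (Suc (Suc 0)) (anti 0 (y i j)) \<in> Q" if "i \<in> idx" "j \<in> idx" for i j
    using that by (intro absorbing_anti[OF Q] yQ) auto
  define l where "l = (t^4 + t^6) * (t^4 + t^6)"
  have l: "l \<noteq> 0" using anti_const by (simp add: l_def)
  have two: "Suc 0 < 2" by simp
  have e: "anti (Suc (Suc 0)) (anti 0 (y 1 1)) = l *v (- (q *v X 0 0))"
    "anti (Suc (Suc 0)) (anti 0 (y 1 2)) = l *v ((q * (s - t)) *v X 0 1 + (s * q) *v X 1 0)"
    "anti (Suc (Suc 0)) (anti 0 (y 2 1)) = l *v ((t * q^2) *v X 0 1 - (q^2 * (s - t)) *v X 1 0)"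
    "anti (Suc (Suc 0)) (anti 0 (y 1 3)) = l *v (X 0 2 + (s * q^2) *v X 1 1)"
    "anti (Suc (Suc 0)) (anti 0 (y 2 2)) = l *v ((t * q^2) *v X 0 2 + (q^2 * (s - t)^2) *v X 1 1 + s *v X 2 0)"
    "anti (Suc (Suc 0)) (anti 0 (y 3 1)) = l *v ((t * q^2) *v X 1 1 + q^2 *v X 2 0)"
    "anti (Suc (Suc 0)) (anti 0 (y 2 3)) = l *v ((q * (s - t)) *v X 1 2 + (s * q) *v X 2 1)"
    "anti (Suc (Suc 0)) (anti 0 (y 3 2)) = l *v ((t * q^2) *v X 1 2 - (q^2 * (s - t)) *v X 2 1)"
    "anti (Suc (Suc 0)) (anti 0 (y 3 3)) = l *v (- (q *v X 2 2))"
    unfolding y_def word4_split anti_linear anti_tensor_left[OF two] anti_right anti_words X_def tensor_linear l_def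
    by (simp_all add: fun_eq_iff power_expand algebra_simps s_t)
  have f: "- (q *v X 0 0) \<in> Q" "(q * (s - t)) *v X 0 1 + (s * q) *v X 1 0 \<in> Q"
    "(t * q^2) *v X 0 1 - (q^2 * (s - t)) *v X 1 0 \<in> Q" "X 0 2 + (s * q^2) *v X 1 1 \<in> Q"
    "(t * q^2) *v X 0 2 + (q^2 * (s - t)^2) *v X 1 1 + s *v X 2 0 \<in> Q"
    "(t * q^2) *v X 1 1 + q^2 *v X 2 0 \<in> Q"
    "(q * (s - t)) *v X 1 2 + (s * q) *v X 2 1 \<in> Q"
    "(t * q^2) *v X 1 2 - (q^2 * (s - t)) *v X 2 1 \<in> Q" "- (q *v X 2 2) \<in> Q"
    using z[of 1 1] z[of 1 2] z[of 2 1] z[of 1 3] z[of 2 2] z[of 3 1] z[of 2 3] z[of 3 2] z[of 3 3]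
      subspace_scaleD[OF sub _ l] unfolding e by simp_all
  have diag: "x \<in> Q" if "- (q *v x) \<in> Q" for x :: vec
    using subspace_scaleD[OF sub, of "- q" x] that by simp
  have n1: "1 - q + q^2 \<noteq> 0" "1 - q + 2 * q^2 - q^3 + q^4 \<noteq> 0"
    using horner_nz[of "[1,-1,1]"] horner_nz[of "[1,-1,2,-1,1]"] by (simp_all add: power_expand algebra_simps)
  have pair: "a \<in> Q \<and> b \<in> Q"
    if 1: "(q * (s - t)) *v a + (s * q) *v b \<in> Q" and 2: "(t * q^2) *v a - (q^2 * (s - t)) *v b \<in> Q" for a b
  proof
    have "(s^4 * (1 - q + q^2)) *v a = (q * (q * (s - t))) *v ((q * (s - t)) *v a + (s * q) *v b) + (s * q) *v ((t * q^2) *v a - (q^2 * (s - t)) *v b)"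
      by (simp add: fun_eq_iff power_expand algebra_simps s_t)
    also have "\<dots> \<in> Q" by (intro Qadd Qsc 1 2)
    finally show a: "a \<in> Q" by (rule subspace_scaleD[OF sub]) (use n1 in simp)
    have "(s * q) *v b = ((q * (s - t)) *v a + (s * q) *v b) - (q * (s - t)) *v a" by simp
    also have "\<dots> \<in> Q" by (intro Qdiff Qsc 1 a)
    finally show "b \<in> Q" by (rule subspace_scaleD[OF sub]) simp
  qed
  have X11: "X 1 1 \<in> Q"
  proof (rule subspace_scaleD[OF sub])
    have "(- (1 - q + 2 * q^2 - q^3 + q^4)) *v X 1 1
      = ((t * q^2) *v X 0 2 + (q^2 * (s - t)^2) *v X 1 1 + s *v X 2 0)
        - (t * q^2) *v (X 0 2 + (s * q^2) *v X 1 1) - (s * t^4) *v ((t * q^2) *v X 1 1 + q^2 *v X 2 0)"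
      by (simp add: fun_eq_iff power_expand algebra_simps s_t)
    also have "\<dots> \<in> Q" using Qdiff[OF Qdiff[OF f(5) Qsc[OF f(4)]] Qsc[OF f(6)]] .
    finally show "(- (1 - q + 2 * q^2 - q^3 + q^4)) *v X 1 1 \<in> Q" .
  qed (metis n1(2) neg_equal_0_iff_equal)
  have "X 0 2 = (X 0 2 + (s * q^2) *v X 1 1) - (s * q^2) *v X 1 1" by simp
  then have X02: "X 0 2 \<in> Q" using Qdiff[OF f(4) Qsc[OF X11]] by metis
  have "q^2 *v X 2 0 = ((t * q^2) *v X 1 1 + q^2 *v X 2 0) - (t * q^2) *v X 1 1" by simp
  then have "q^2 *v X 2 0 \<in> Q" using Qdiff[OF f(6) Qsc[OF X11]] by metis
  then have X20: "X 2 0 \<in> Q" by (rule subspace_scaleD[OF sub]) simp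
  have "X m n \<in> Q"
    using less_3_cases[OF mn(1)] less_3_cases[OF mn(2)] diag[OF f(1)] diag[OF f(9)] pair[OF f(2,3)] pair[OF f(7,8)] X11 X02 X20
    by (elim disjE) auto
  then show ?thesis by (simp add: X_def)
qed

lemma words4_cases:
  assumes "w \<in> words 4" obtains i a b j where "w = [i, a, b, j]" "i \<in> idx" "a \<in> idx" "b \<in> idx" "j \<in> idx"
  using assms by (auto simp: words_def numeral_eq_Suc length_Suc_conv)

lemma antisym4_absorbed:
  assumes Q: "absorbing 4 Q" and x: "x \<in> Tens 4" "R 0 x = (- (t^2)) *v x" "R (Suc (Suc 0)) x = (- (t^2)) *v x"
  shows "x \<in> Q"
proof -
  note sub = absorbingD(1)[OF Q]
  let ?B = "\<lambda>x. anti (Suc (Suc 0)) (anti 0 x)"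
  have "Tens 4 \<subseteq> {x. ?B x \<in> Q}"
  proof (rule Tens_subset_subspace)
    show "fv.subspace {x. ?B x \<in> Q}"
      unfolding fv.subspace_def using sub
      by (simp add: anti_linear fv.subspace_0 fv.subspace_add fv.subspace_scale)
    fix u assume "u \<in> words 4"
    then obtain i a b j where u: "u = [i,a,b,j]" "i \<in> idx" "a \<in> idx" "b \<in> idx" "j \<in> idx" by (rule words4_cases)
    have two: "Suc 0 < 2" by simp
    obtain c m where 1: "m < 3" "anti 0 (word [i, a]) = c *v alt m" using anti_word_alt u by metis
    obtain d n where 2: "n < 3" "anti 0 (word [b, j]) = d *v alt n" using anti_word_alt u by metis
    have "?B (word u) = c *v d *v tensor 2 (alt m) (alt n)"
      unfolding u word4_split anti_tensor_left[OF two] anti_right 1 2 by (simp add: tensor_linear)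
    then show "word u \<in> {x. ?B x \<in> Q}"
      using alt_alt_absorbed[OF Q 1(1) 2(1)] fv.subspace_scale[OF sub] by simp
  qed
  moreover have "?B x = ((1 + t^2) * (1 + t^4)) *v ((1 + t^2) * (1 + t^4)) *v x"
    by (simp only: anti_eigen[OF x(2)] anti_linear anti_eigen[OF x(3)])
  ultimately have "((1 + t^2) * (1 + t^4)) *v ((1 + t^2) * (1 + t^4)) *v x \<in> Q" using x(1) by auto
  then show ?thesis using subspace_scaleD[OF sub] anti_const(1) by blast
qed

text \<open>The quadratic relation with roots \<open>q\<close> and \<open>-q\<^sup>-\<^sup>1\<close>, as the \<open>q\<^sup>-\<^sup>2\<close>-component lies in \<open>Q\<close>.\<close>
lemma hecke_mod:
  assumes "absorbing k Q" "Suc p < k" "x \<in> Tens k"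
  shows "R p (R p x) - x - (s^2 - t^2) *v R p x \<in> Q"
proof -
  obtain a b c where d: "x = a + b + c" "a \<in> Tens k" "b \<in> Tens k" "c \<in> Tens k"
    "R p a = q *v a" "R p b = (- (t^2)) *v b" "R p c = t^4 *v c"
    using eigen_decomposition[OF assms(3,2)] by metis
  have "c \<in> Q" using d absorbingD(4)[OF assms(1,2)] by blast
  moreover have "R p (R p x) - x - (s^2 - t^2) *v R p x = (t^4 * t^4 - 1 - (s^2 - t^2) * t^4) *v c"
    unfolding d(1) local_op_add local_op_sc d(5-7) by (simp add: fun_eq_iff power_expand algebra_simps s_t)
  ultimately show ?thesis
    using absorbingD(1)[OF assms(1)] by (simp add: fv.subspace_scale)
qed

text \<open>Modulo \<open>Q\<close>, with \<open>h = q - q\<^sup>-\<^sup>1\<close>, the third generator is \<open>C = h - A\<close>. Inserting this into \<open>B C B = C B C\<close>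
  gives \<open>2 A B A = h + h A B + h B A\<close> (fact \<open>D\<close>). Comparing the products of \<open>D\<close> with \<open>A\<close> from both sides
  gives \<open>A B = B A\<close> (\<open>N\<close>), so that \<open>A B A = B A B\<close> becomes \<open>A = B\<close> (\<open>L\<close>), and \<open>D\<close> becomes \<open>2 A = h\<close>
  (\<open>E\<close>). Together with \<open>A\<^sup>2 = 1 + h A\<close> this forces \<open>4 + h\<^sup>2 = 0\<close>.\<close>
lemma hecke_collapse:
  assumes Q: "absorbing 4 Q"
    and R2: "\<And>x. x \<in> Tens 4 \<Longrightarrow> R (Suc (Suc 0)) x + R 0 x - (s^2 - t^2) *v x \<in> Q"
    and x: "x \<in> Tens 4"
  shows "x \<in> Q"
proof -
  define A B C where "A = R 0" and "B = R (Suc 0)" and "C = R (Suc (Suc 0))"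
  define h where "h = s^2 - t^2"
  note sub = absorbingD(1)[OF Q]
  note add = fv.subspace_add[OF sub] and sc = fv.subspace_scale[OF sub] and diff = fv.subspace_diff[OF sub]
  have lin: "A (f + g) = A f + A g" "A (f - g) = A f - A g" "A (c *v f) = c *v A f"
    "B (f + g) = B f + B g" "B (f - g) = B f - B g" "B (c *v f) = c *v B f" for f g c
    by (simp_all add: A_def B_def)
  have mem: "A f \<in> Tens 4" "B f \<in> Tens 4" "C f \<in> Tens 4" if "f \<in> Tens 4" for f
    using that by (simp_all add: A_def B_def C_def)
  have stable: "A f \<in> Q" "B f \<in> Q" if "f \<in> Q" for f
    using that absorbingD(3)[OF Q] by (simp_all add: A_def B_def)
  have br: "A (B (A f)) = B (A (B f))" "B (C (B f)) = C (B (C f))" for f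
    using braid[of 0 f] braid[of "Suc 0" f] by (simp_all add: A_def B_def C_def)
  have K1: "C f + A f - h *v f \<in> Q" if "f \<in> Tens 4" for f
    using R2[OF that] by (simp add: A_def C_def h_def)
  have K2: "A (A f) - f - h *v A f \<in> Q" and K3: "B (B f) - f - h *v B f \<in> Q" if "f \<in> Tens 4" for f
    using hecke_mod[OF Q _ that, of 0] hecke_mod[OF Q _ that, of "Suc 0"] by (simp_all add: A_def B_def h_def)
  have D: "2 *v A (B (A f)) - h *v f - h *v A (B f) - h *v B (A f) \<in> Q" if f: "f \<in> Tens 4" for f
  proof -
    let ?e1 = "C (B (C f)) + A (B (C f)) - h *v B (C f)" and ?e2 = "A (B (C f + A f - h *v f))"
      and ?e3 = "B (C f + A f - h *v f)" and ?e4 = "B (C (B f) + A (B f) - h *v B f)"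
      and ?e5 = "B (B f) - f - h *v B f"
    have "?e4 + h *v ?e5 - ?e1 + ?e2 - h *v ?e3 \<in> Q"
      by (intro add[OF diff[OF add]] diff[OF add[OF diff[OF add]]] sc stable K1 K3 mem f)
    also have "?e4 + h *v ?e5 - ?e1 + ?e2 - h *v ?e3
      = 2 *v A (B (A f)) - h *v f - h *v A (B f) - h *v B (A f)"
      by (simp add: lin br fun_eq_iff algebra_simps)
    finally show ?thesis .
  qed
  have h2: "h^2 + 2 \<noteq> 0" "4 + h^2 \<noteq> 0"
    by (rule nz_by_horner[of _ "[1,0,0,0,1]" 4], simp_all add: h_def power_expand algebra_simps s_t)
      (rule nz_by_horner[of _ "[1,0,2,0,1]" 4], simp_all add: h_def power_expand algebra_simps s_t)
  have N: "A (B f) - B (A f) \<in> Q" if f: "f \<in> Tens 4" for f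
  proof -
    let ?d = "\<lambda>f. 2 *v A (B (A f)) - h *v f - h *v A (B f) - h *v B (A f)"
      and ?k = "\<lambda>f. A (A f) - f - h *v A f"
    have P: "A (?d f) - 2 *v ?k (B (A f)) + h *v ?k (B f) \<in> Q"
      by (intro add[OF diff] sc stable D K2 mem f)
    have P': "?d (A f) - 2 *v A (B (?k f)) + h *v B (?k f) \<in> Q"
      by (intro add[OF diff] sc stable D K2 mem f)
    have "(- (h^2 + 2)) *v (A (B f) - B (A f))
      = (A (?d f) - 2 *v ?k (B (A f)) + h *v ?k (B f)) - (?d (A f) - 2 *v A (B (?k f)) + h *v B (?k f))"
      by (simp add: lin fun_eq_iff power2_eq_square algebra_simps)
    also have "\<dots> \<in> Q" by (rule diff[OF P P'])
    finally show ?thesis by (rule subspace_scaleD[OF sub]) (metis h2(1) neg_equal_0_iff_equal)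
  qed
  have L: "B f - A f \<in> Q" if f: "f \<in> Tens 4" for f
  proof -
    let ?n = "A (B f) - B (A f)"
    have "A ?n + B ?n - (A (A (B f)) - B f - h *v A (B f)) + (B (B (A f)) - A f - h *v B (A f)) - h *v ?n \<in> Q"
      by (intro diff[OF add[OF diff[OF add]]] sc stable N K2 K3 mem f)
    also have "A ?n + B ?n - (A (A (B f)) - B f - h *v A (B f)) + (B (B (A f)) - A f - h *v B (A f)) - h *v ?n
      = B f - A f"
      by (simp add: lin br fun_eq_iff algebra_simps)
    finally show ?thesis .
  qed
  have E: "2 *v A x - h *v x \<in> Q"
  proof -
    let ?d = "2 *v A (B (A x)) - h *v x - h *v A (B x) - h *v B (A x)"
    have "?d - 2 *v A (B (A x) - A (A x)) - 2 *v A (A (A x) - x - h *v A x)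
        + h *v A (B x - A x) + h *v (B (A x) - A (A x)) \<in> Q"
      by (intro add[OF add[OF diff[OF diff]]] sc stable D L K2 mem x)
    also have "?d - 2 *v A (B (A x) - A (A x)) - 2 *v A (A (A x) - x - h *v A x)
        + h *v A (B x - A x) + h *v (B (A x) - A (A x)) = 2 *v A x - h *v x"
      by (simp add: lin fun_eq_iff algebra_simps)
    finally show ?thesis .
  qed
  have "2 *v (A (2 *v A x - h *v x) - 2 *v (A (A x) - x - h *v A x)) - h *v (2 *v A x - h *v x) \<in> Q"
    by (intro diff sc stable E K2 x)
  also have "2 *v (A (2 *v A x - h *v x) - 2 *v (A (A x) - x - h *v A x)) - h *v (2 *v A x - h *v x)
    = (4 + h^2) *v x"
    by (simp add: lin fun_eq_iff power2_eq_square algebra_simps)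
  finally show ?thesis by (rule subspace_scaleD[OF sub]) (rule h2)
qed

text \<open>For joint eigenvectors of \<open>R\<^sub>0\<close> and \<open>R\<^sub>2\<close>, all pairs of eigenvalues other than \<open>(q, -q\<^sup>-\<^sup>1)\<close> and
  \<open>(-q\<^sup>-\<^sup>1, q)\<close> are absorbed, whence \<open>R\<^sub>0 + R\<^sub>2 = q - q\<^sup>-\<^sup>1\<close> modulo the absorbing subspace.\<close>
lemma degree4_cover:
  assumes M: "fv.subspace M" and relM: "pair_rels 4 \<subseteq> M"
  shows "Tens (4 + 4) \<subseteq> M"
proof (rule tensors_cover[OF M relM])
  let ?QL = "{x \<in> Tens 4. \<forall>y\<in>Tens 4. tensor 4 x y \<in> M}" and ?QR = "{y \<in> Tens 4. \<forall>x\<in>Tens 4. tensor 4 x y \<in> M}"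
  let ?c = "Suc (Suc 0)"
  have QL: "absorbing 4 ?QL" by (rule absorbing_left[OF M relM])
  have QR: "absorbing 4 ?QR" by (rule absorbing_right_all[OF M relM])
  note sub = absorbingD(1)[OF QL]
  note Qadd = fv.subspace_add[OF sub] and Qsc = fv.subspace_scale[OF sub] and Qdiff = fv.subspace_diff[OF sub]
  have far: "0 + 2 \<le> ?c" "?c < 4 - 1" "Suc 0 < 4" "Suc ?c < 4" by simp_all
  \<comment> \<open>A vector symmetric in both pairs can survive only against one that alternates in both pairs, and
    those vanish against everything.\<close>
  have sym: "x \<in> ?QL" if x: "x \<in> Tens 4" "R 0 x = q *v x" "R ?c x = q *v x" for x
  proof -
    have qt: "1 + q * t^4 \<noteq> 0" using nonzero_consts by (simp add: power_expand algebra_simps s_t)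
    have "tensor 4 x y \<in> M" if y: "y \<in> Tens 4" for y
    proof -
      obtain a b c where d: "y = a + b + c" "a \<in> Tens 4" "b \<in> Tens 4" "c \<in> Tens 4"
        "R 0 a = q *v a" "R 0 b = (- (t^2)) *v b" "R 0 c = t^4 *v c"
        using eigen_decomposition[OF y far(3)] by metis
      obtain a' b' c' where d': "b = a' + b' + c'" "a' \<in> Tens 4" "b' \<in> Tens 4" "c' \<in> Tens 4"
        "R ?c a' = q *v a'" "R ?c b' = (- (t^2)) *v b'" "R ?c c' = t^4 *v c'"
        "R 0 b' = (- (t^2)) *v b'"
        using eigen_decomposition[OF d(3) far(4), of "- (t^2)"] d(6) far(1) by metis
      have "b' \<in> ?QR" by (rule antisym4_absorbed[OF QR d'(3,8,6)])
      then have "tensor 4 x b' \<in> M" using x by simp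
      moreover have "tensor 4 x a' \<in> M" "tensor 4 x c' \<in> M" "tensor 4 x a \<in> M" "tensor 4 x c \<in> M"
        using pair_eigen[OF M relM x(1) d'(2) far(4) x(3) d'(5) eigen_gap(2)]
          pair_eigen[OF M relM x(1) d'(4) far(4) x(3) d'(7) qt]
          pair_eigen[OF M relM x(1) d(2) far(3) x(2) d(5) eigen_gap(2)]
          pair_eigen[OF M relM x(1) d(4) far(3) x(2) d(7) qt] by blast+
      ultimately show ?thesis unfolding d(1) d'(1) by (intro pair_add[OF M relM])
    qed
    then show ?thesis using x by simp
  qed
  have joint: "R ?c z + R 0 z - (s^2 - t^2) *v z \<in> ?QL"
    if z: "z \<in> Tens 4" "R 0 z = a *v z" "R ?c z = b *v z" and a: "a \<in> {q, - (t^2), t^4}" and b: "b \<in> {q, - (t^2), t^4}" for z a b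
  proof -
    have e: "R ?c z + R 0 z - (s^2 - t^2) *v z = (b + a - (s^2 - t^2)) *v z"
      unfolding z by (simp add: fun_eq_iff algebra_simps)
    consider "z \<in> ?QL" | "b + a - (s^2 - t^2) = 0"
      using a b sym[OF z(1)] antisym4_absorbed[OF QL z(1)] absorbingD(4)[OF QL far(3) z(1)]
        absorbingD(4)[OF QL far(4) z(1)] z(2,3) by fastforce
    then show ?thesis
    proof cases
      case 1
      then show ?thesis unfolding e by (rule Qsc)
    next
      case 2
      then show ?thesis unfolding e using fv.subspace_0[OF sub] by simp
    qed
  qed
  have R2: "R ?c x + R 0 x - (s^2 - t^2) *v x \<in> ?QL" if x: "x \<in> Tens 4" for x
  proof -
    let ?F = "\<lambda>z. R ?c z + R 0 z - (s^2 - t^2) *v z"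
    have F_add: "?F (u + v) = ?F u + ?F v" for u v by (simp add: fun_eq_iff algebra_simps)
    have one: "?F z \<in> ?QL" if z: "z \<in> Tens 4" "R 0 z = a *v z" and a: "a \<in> {q, - (t^2), t^4}" for z a
    proof -
      obtain u v w where d: "z = u + v + w" "u \<in> Tens 4" "v \<in> Tens 4" "w \<in> Tens 4"
        "R ?c u = q *v u" "R ?c v = (- (t^2)) *v v" "R ?c w = t^4 *v w"
        "R 0 u = a *v u \<and> R 0 v = a *v v \<and> R 0 w = a *v w"
        using eigen_decomposition[OF z(1) far(4), of a] z(2) far(1) by metis
      have "?F u \<in> ?QL" "?F v \<in> ?QL" "?F w \<in> ?QL"
        using joint[OF d(2) _ d(5) a] joint[OF d(3) _ d(6) a] joint[OF d(4) _ d(7) a] d(8) by blast+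
      then show ?thesis unfolding d(1) F_add by (intro Qadd)
    qed
    obtain u v w where d: "x = u + v + w" "u \<in> Tens 4" "v \<in> Tens 4" "w \<in> Tens 4"
      "R 0 u = q *v u" "R 0 v = (- (t^2)) *v v" "R 0 w = t^4 *v w"
      using eigen_decomposition[OF x far(3)] by metis
    have "?F u \<in> ?QL" "?F v \<in> ?QL" "?F w \<in> ?QL"
      using one[OF d(2,5)] one[OF d(3,6)] one[OF d(4,7)] by blast+
    then show ?thesis unfolding d(1) F_add by (intro Qadd)
  qed
  have "x \<in> ?QL" if "x \<in> Tens 4" for x by (rule hecke_collapse[OF QL R2 that])
  then show "tensor 4 x y \<in> M" if "x \<in> Tens 4" "y \<in> Tens 4" for x y using that by blast
qed

end

section \<open>Values of the r-form\<close>

abbreviation carr :: "tens set" where "carr \<equiv> carrier Fr"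

lemma carr_def: "f \<in> carr \<longleftrightarrow> finite {w. f w \<noteq> 0} \<and> (\<forall>w. f w \<noteq> 0 \<longrightarrow> w \<in> lists letters)"
  by (simp add: free_alg_def)

lemma carr_subspace: "fv.subspace carr"
proof -
  have conv: "finite {w. f w + g w \<noteq> (0::complex)}" if "finite {w. f w \<noteq> 0}" "finite {w. g w \<noteq> 0}"
    for f g :: tens
    by (rule finite_subset[OF _ finite_UnI[OF that]]) auto
  have conv': "finite {w. c * f w \<noteq> (0::complex)}" if "finite {w. f w \<noteq> 0}" for f :: tens and c
    by (rule finite_subset[OF _ that]) auto
  show ?thesis
    unfolding fv.subspace_def
  proof (intro conjI ballI allI)
    show "0 \<in> carr" by (simp add: carr_def)
    fix f g :: tens assume f: "f \<in> carr"
    show "c *v f \<in> carr" for c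
      using f conv'[of f c] unfolding carr_def sc_apply by simp
    assume g: "g \<in> carr"
    have "w \<in> lists letters" if "f w + g w \<noteq> 0" for w
      using that f g unfolding carr_def by (cases "f w = 0") simp_all
    then show "f + g \<in> carr"
      using f g conv[of f g] unfolding carr_def plus_fun_apply by blast
  qed
qed

lemma carr_intros:
  "f \<in> carr \<Longrightarrow> g \<in> carr \<Longrightarrow> (\<lambda>w. f w + g w) \<in> carr"
  "f \<in> carr \<Longrightarrow> g \<in> carr \<Longrightarrow> (\<lambda>w. f w - g w) \<in> carr"
  "f \<in> carr \<Longrightarrow> (\<lambda>w. c * f w) \<in> carr"
  "f \<in> carr \<Longrightarrow> (\<lambda>w. f w * c) \<in> carr"
  "(b \<Longrightarrow> f \<in> carr) \<Longrightarrow> (\<lambda>w. if b then f w else 0) \<in> carr"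
proof -
  have z: "(\<lambda>w. 0) \<in> carr" using fv.subspace_0[OF carr_subspace] by (simp add: zero_fun_def)
  show "f \<in> carr \<Longrightarrow> g \<in> carr \<Longrightarrow> (\<lambda>w. f w + g w) \<in> carr"
    using fv.subspace_add[OF carr_subspace] by (simp add: plus_fun_def)
  show "f \<in> carr \<Longrightarrow> g \<in> carr \<Longrightarrow> (\<lambda>w. f w - g w) \<in> carr"
    using fv.subspace_diff[OF carr_subspace] by (simp add: fun_diff_def)
  show c: "f \<in> carr \<Longrightarrow> (\<lambda>w. c * f w) \<in> carr"
    using fv.subspace_scale[OF carr_subspace] by (simp add: sc_def)
  then show "f \<in> carr \<Longrightarrow> (\<lambda>w. f w * c) \<in> carr" by (simp add: mult.commute)
  show "(b \<Longrightarrow> f \<in> carr) \<Longrightarrow> (\<lambda>w. if b then f w else 0) \<in> carr" using z by (cases b) auto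
qed

lemma carr_sum: "(\<And>m. m \<in> A \<Longrightarrow> F m \<in> carr) \<Longrightarrow> (\<lambda>w. \<Sum>m\<in>A. F m w) \<in> carr"
  using fv.subspace_sum[OF carr_subspace, of A F] by (simp add: sum_fun_apply[symmetric])

lemma carr_word: "u \<in> lists letters \<Longrightarrow> word u \<in> carr"
  by (auto simp: carr_def word_def)

lemma Oq3_rels_carr: "Oq3_rels s \<subseteq> carr"
proof
  fix f assume f: "f \<in> Oq3_rels s"
  have w: "word [(a, b), (c, d)] \<in> carr" if "a \<in> idx" "b \<in> idx" "c \<in> idx" "d \<in> idx" for a b c d
    using that by (intro carr_word) (auto simp: letters_def)
  have w0: "word [] \<in> carr" by (intro carr_word) simp
  note intros = carr_intros(2) carr_sum carr_intros(3)[OF w] carr_intros(4)[OF w] carr_intros(5)[OF w0]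
  consider
    i j k l where "{i, j, k, l} \<subseteq> idx" "f = (\<lambda>w. (\<Sum>m\<in>idx. \<Sum>n\<in>idx. Rhat s i j m n * word [(m, k), (n, l)] w)
          - (\<Sum>m\<in>idx. \<Sum>n\<in>idx. word [(i, m), (j, n)] w * Rhat s m n k l))"
  | i j where "{i, j} \<subseteq> idx" "f = (\<lambda>w. (\<Sum>a\<in>idx. \<Sum>b\<in>idx. \<Sum>c\<in>idx. Cmat s a b * Cinv s c j * word [(i, a), (c, b)] w)
          - (if i = j then word [] w else 0))"
  | i j where "{i, j} \<subseteq> idx" "f = (\<lambda>w. (\<Sum>a\<in>idx. \<Sum>b\<in>idx. \<Sum>c\<in>idx. Cmat s i a * Cinv s b c * word [(b, a), (c, j)] w)
          - (if i = j then word [] w else 0))"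
    using f unfolding Oq3_rels_def by blast
  then show "f \<in> carr"
    by cases (use intros in \<open>auto intro!: intros\<close>)
qed

interpretation Fr: ring Fr
  by (rule ring_free_alg)

lemma Oq3_ideal: "ideal (Oq3_ideal s) Fr"
  unfolding Oq3_ideal_def by (rule Fr.genideal_ideal[OF Oq3_rels_carr])

lemma Oq3_ring: "ring (Oq3 s)"
  unfolding Oq3_def by (rule ideal.quotient_is_ring[OF Oq3_ideal])

lemma ugen_carrier: "i \<in> idx \<Longrightarrow> j \<in> idx \<Longrightarrow> ugen s i j \<in> carrier (Oq3 s)"
  unfolding ugen_def Oq3_def
  by (rule ring_hom_closed[OF ideal.rcos_ring_hom[OF Oq3_ideal]], rule carr_word) (auto simp: letters_def)

lemma csmult_carrier: "a \<in> carrier (Oq3 s) \<Longrightarrow> csmult s z a \<in> carrier (Oq3 s)"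
proof -
  interpret O: ring "Oq3 s" by (rule Oq3_ring)
  have "(\<lambda>w. z * word [] w) \<in> carr" by (intro carr_intros(3) carr_word) simp
  then have "scalar letters (Oq3_ideal s) z \<in> carrier (Oq3 s)"
    unfolding scalar_def Oq3_def by (rule ring_hom_closed[OF ideal.rcos_ring_hom[OF Oq3_ideal]])
  then show "a \<in> carrier (Oq3 s) \<Longrightarrow> csmult s z a \<in> carrier (Oq3 s)"
    unfolding csmult_def by simp
qed

lemma additive_finsum:
  fixes \<phi> :: "'a \<Rightarrow> complex"
  assumes "ring A" and add: "\<And>a b. a \<in> carrier A \<Longrightarrow> b \<in> carrier A \<Longrightarrow> \<phi> (a \<oplus>\<^bsub>A\<^esub> b) = \<phi> a + \<phi> b"
    and "finite I" "f \<in> I \<rightarrow> carrier A"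
  shows "\<phi> (finsum A f I) = (\<Sum>i\<in>I. \<phi> (f i))"
  using assms(3,4)
proof (induction I)
  interpret A: ring A by fact
  case empty
  have "\<phi> (\<zero>\<^bsub>A\<^esub> \<oplus>\<^bsub>A\<^esub> \<zero>\<^bsub>A\<^esub>) = \<phi> \<zero>\<^bsub>A\<^esub> + \<phi> \<zero>\<^bsub>A\<^esub>" by (rule add) simp_all
  then show ?case by simp
next
  interpret A: ring A by fact
  case (insert i I)
  then have "f \<in> I \<rightarrow> carrier A" "f i \<in> carrier A" by auto
  then show ?case using insert by (simp add: add A.finsum_closed)
qed

text \<open>\<open>S(u\<^sup>i\<^sub>j)\<close> is \<open>q\<^sup>a u\<close> at the indices \<open>j'\<close>, \<open>i'\<close> with \<open>a = \<rho>\<^sub>j - \<rho>\<^sub>i\<close>, evaluated under a linear functional;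
  for \<open>\<phi>\<close> the \<open>r\<close>-form with one argument fixed is used.\<close>
lemma additive_antipode:
  assumes "s \<noteq> 0" "is_antipode s S" "i \<in> idx" "j \<in> idx"
    and add: "\<And>a b. a \<in> carrier (Oq3 s) \<Longrightarrow> b \<in> carrier (Oq3 s) \<Longrightarrow> \<phi> (a \<oplus>\<^bsub>Oq3 s\<^esub> b) = \<phi> a + (\<phi> b :: complex)"
    and scale: "\<And>z a. a \<in> carrier (Oq3 s) \<Longrightarrow> \<phi> (csmult s z a) = z * \<phi> a"
  shows "\<phi> (S (ugen s i j)) = s powi (two_rho j - two_rho i) * \<phi> (ugen s (pr j) (pr i))"
proof -
  interpret O: ring "Oq3 s" by (rule Oq3_ring)
  have c: "csmult s z (ugen s b a) \<in> carrier (Oq3 s)" if "a \<in> idx" "b \<in> idx" for z a b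
    using that by (intro csmult_carrier ugen_carrier)
  have "S (ugen s i j) =
        (\<Oplus>\<^bsub>Oq3 s\<^esub>a\<in>idx. \<Oplus>\<^bsub>Oq3 s\<^esub>b\<in>idx. csmult s (Cmat s i a * Cinv s b j) (ugen s b a))"
    using assms(2-4) unfolding is_antipode_def by blast
  then have "\<phi> (S (ugen s i j)) = (\<Sum>a\<in>idx. \<Sum>b\<in>idx. Cmat s i a * Cinv s b j * \<phi> (ugen s b a))"
    using c by (simp add: additive_finsum[OF Oq3_ring add] scale ugen_carrier)
  also have "\<dots> = s powi (- two_rho i) * s powi (two_rho j) * \<phi> (ugen s (pr j) (pr i))"
    using assms(3,4) by (elim idx_cases; simp add: sum_idx Cmat_def Cinv_def)
  also have "s powi (- two_rho i) * s powi (two_rho j) = s powi (two_rho j - two_rho i)"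
    using assms(1) by (simp add: power_int_add[symmetric])
  finally show ?thesis .
qed

lemma antipode_carrier: "is_antipode s S \<Longrightarrow> i \<in> idx \<Longrightarrow> j \<in> idx \<Longrightarrow> S (ugen s i j) \<in> carrier (Oq3 s)"
  unfolding is_antipode_def using ugen_carrier by blast

lemma pr_idx: "i \<in> idx \<Longrightarrow> pr i \<in> idx" "i \<in> idx \<Longrightarrow> pr (pr i) = i"
  "i \<in> idx \<Longrightarrow> two_rho (pr i) = - two_rho i"
  by (auto simp: idx_def pr_def two_rho_def)

context
  fixes s e S r
  assumes s0: "s \<noteq> 0" and S: "is_antipode s S" and r: "universal_r_form s e r"
begin

lemma r_bilinear: "is_bilinear s r"
  using r unfolding universal_r_form_def by blast

lemma r_S_right:
  assumes "a \<in> carrier (Oq3 s)" "i \<in> idx" "j \<in> idx"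
  shows "r a (S (ugen s i j)) = s powi (two_rho j - two_rho i) * r a (ugen s (pr j) (pr i))"
  by (rule additive_antipode[OF s0 S assms(2,3), of "r a"])
    (use r_bilinear assms(1) in \<open>auto simp: is_bilinear_def\<close>)

lemma r_S_left:
  assumes "a \<in> carrier (Oq3 s)" "i \<in> idx" "j \<in> idx"
  shows "r (S (ugen s i j)) a = s powi (two_rho j - two_rho i) * r (ugen s (pr j) (pr i)) a"
  by (rule additive_antipode[OF s0 S assms(2,3), of "\<lambda>b. r b a"])
    (use r_bilinear assms(1) in \<open>auto simp: is_bilinear_def\<close>)

lemma r_gen: "i \<in> idx \<Longrightarrow> j \<in> idx \<Longrightarrow> k \<in> idx \<Longrightarrow> l \<in> idx \<Longrightarrow> r (ugen s i j) (ugen s k l) = Rmat s i k j l"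
  using r unfolding universal_r_form_def by blast

lemma Rgrave_eq:
  assumes "i \<in> idx" "j \<in> idx" "k \<in> idx" "l \<in> idx"
  shows "Rgrave s S r i j k l = s powi (two_rho i - two_rho l) * Rhat s (pr i) j k (pr l)"
  unfolding Rgrave_def uc_def Rhat_def using assms
  by (simp add: r_S_right ugen_carrier r_gen pr_idx)

text \<open>The powers of \<open>q\<close> cancel because \<open>Rhat\<close> preserves the sum of the indices.\<close>
lemma Rcheck_eq:
  assumes "i \<in> idx" "j \<in> idx" "k \<in> idx" "l \<in> idx"
  shows "Rcheck s S r i j k l = Rhat s (pr i) (pr j) (pr k) (pr l)"
proof -
  have "Rcheck s S r i j k l = s powi (two_rho i - two_rho l) * (s powi (two_rho j - two_rho k) * Rhat s (pr i) (pr j) (pr k) (pr l))"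
    unfolding Rcheck_def uc_def Rhat_def using assms
    by (simp add: r_S_right r_S_left antipode_carrier[OF S] ugen_carrier r_gen pr_idx)
  also have "\<dots> = s powi (two_rho i - two_rho l + (two_rho j - two_rho k)) * Rhat s (pr i) (pr j) (pr k) (pr l)"
    using s0 by (simp add: power_int_add)
  also have "\<dots> = Rhat s (pr i) (pr j) (pr k) (pr l)"
  proof (cases "Rhat s (pr i) (pr j) (pr k) (pr l) = 0")
    case False
    then have "pr i + pr j = pr k + pr l" using Rhat_nz by blast
    then have "two_rho i - two_rho l + (two_rho j - two_rho k) = 0"
      using assms by (auto simp: two_rho_def pr_def idx_def)
    then show ?thesis by simp
  qed simp
  finally show ?thesis .
qed

end

section \<open>Rearranging the tensor factors\<close>

context generic_q
begin

text \<open>The second braiding after the identification of \<open>\<Gamma>\<^sub>L\<close> with the tensor square of \<open>V\<close>, on two adjacent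
  copies that occupy the factors \<open>p, \<dots>, p + 3\<close>.\<close>
definition braiding :: "nat \<Rightarrow> vec \<Rightarrow> vec" where
  "braiding p h = R (p + 1) (R p (R (p + 2) (Ri (p + 1) h)))"

lemma braiding_nums: "braiding 0 h = R 1 (R 0 (R 2 (Ri 1 h)))" "braiding 2 h = R 3 (R 2 (R 4 (Ri 3 h)))"
  "braiding 4 h = R 5 (R 4 (R 6 (Ri 5 h)))"
  unfolding braiding_def by (simp_all only: add_0 semiring_norm numeral_plus_one numeral_plus_numeral)

lemma braid_nums:
  "R 1 (R 2 (R 1 f)) = R 2 (R 1 (R 2 f))" "R 2 (R 3 (R 2 f)) = R 3 (R 2 (R 3 f))"
  "R 3 (R 4 (R 3 f)) = R 4 (R 3 (R 4 f))" "R 4 (R 5 (R 4 f)) = R 5 (R 4 (R 5 f))"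
  using braid[of 1 f] braid[of 2 f] braid[of 3 f] braid[of 4 f] by simp_all

lemma comm_nums:
  "R 2 (R 0 f) = R 0 (R 2 f)" "R 3 (R 0 f) = R 0 (R 3 f)" "R 4 (R 0 f) = R 0 (R 4 f)" "R 5 (R 0 f) = R 0 (R 5 f)"
  "R 3 (R 1 f) = R 1 (R 3 f)" "R 4 (R 1 f) = R 1 (R 4 f)" "R 5 (R 1 f) = R 1 (R 5 f)" "R 6 (R 1 f) = R 1 (R 6 f)"
  "R 4 (R 2 f) = R 2 (R 4 f)" "R 5 (R 2 f) = R 2 (R 5 f)" "R 6 (R 2 f) = R 2 (R 6 f)"
  "R 5 (R 3 f) = R 3 (R 5 f)" "R 6 (R 3 f) = R 3 (R 6 f)" "R 6 (R 4 f) = R 4 (R 6 f)"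
  by (rule R_commute[symmetric]; simp)+

text \<open>The positive braid that takes the order \<open>x\<^sub>1 \<dots> x\<^sub>k y\<^sub>1 \<dots> y\<^sub>k\<close> of the factors to \<open>x\<^sub>1 y\<^sub>1 \<dots> x\<^sub>k y\<^sub>k\<close>.\<close>
definition shuffle :: "nat \<Rightarrow> vec \<Rightarrow> vec" where
  "shuffle k h = (if k = 2 then R 1 h else if k = 3 then R 1 (R 3 (R 2 h))
     else if k = 4 then R 1 (R 3 (R 5 (R 2 (R 4 (R 3 h))))) else h)"

text \<open>An identity of braids: once the \<open>2k\<close> strands are sorted into the first and the second ones of the
  \<open>k\<close> copies, the braiding of two adjacent copies becomes one crossing among the first strands and one
  among the second ones.\<close>
lemma shuffle_rel_aux:
  assumes "h \<in> Tens (k + k)" "k \<le> 4" "Suc i < k"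
  shows "braiding (2 * i) (shuffle k h) = shuffle k (R i (R (k + i) h))"
proof -
  have c: "k = 2 \<and> i = 0 \<or> k = 3 \<and> i = 0 \<or> k = 3 \<and> i = 1 \<or> k = 4 \<and> i = 0 \<or> k = 4 \<and> i = 1 \<or> k = 4 \<and> i = 2"
    using assms by auto
  have inv: "Ri p (R p f) = f" if "f \<in> Tens (k + k)" "Suc p < k + k" for p f using Ri_R that by blast
  have e: "R 1 (R 0 (R 2 (R 3 (R 2 h)))) = R 1 (R 3 (R 2 (R 0 (R 3 h))))"
    "R 3 (R 2 (R 4 (R 1 (R 2 h)))) = R 1 (R 3 (R 2 (R 1 (R 4 h))))" for h
    by (metis braid_nums comm_nums)+
  have e4: "R 1 (R 0 (R 2 (R 3 (R 5 (R 2 (R 4 (R 3 h))))))) = R 1 (R 3 (R 5 (R 2 (R 4 (R 3 (R 0 (R 4 h)))))))" for h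
    by (metis braid_nums comm_nums)
  have e42: "R 3 (R 2 (R 4 (R 1 (R 5 (R 2 (R 4 (R 3 h))))))) = R 1 (R 3 (R 5 (R 2 (R 4 (R 3 (R 1 (R 5 h)))))))" for h
  proof -
    have "R 3 (R 2 (R 4 (R 1 (R 5 (R 2 (R 4 (R 3 h))))))) = R 3 (R 2 (R 1 (R 2 (R 4 (R 5 (R 4 (R 3 h)))))))"
      by (simp only: comm_nums)
    also have "\<dots> = R 3 (R 1 (R 2 (R 1 (R 5 (R 4 (R 5 (R 3 h)))))))"
      by (simp only: braid_nums)
    also have "\<dots> = R 1 (R 3 (R 5 (R 2 (R 4 (R 3 (R 1 (R 5 h)))))))"
      by (simp only: comm_nums)
    finally show ?thesis .
  qed
  have e43: "R 5 (R 4 (R 6 (R 1 (R 3 (R 2 (R 4 (R 3 h))))))) = R 1 (R 3 (R 5 (R 2 (R 4 (R 3 (R 2 (R 6 h)))))))" for h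
  proof -
    have "R 5 (R 4 (R 6 (R 1 (R 3 (R 2 (R 4 (R 3 h))))))) = R 5 (R 6 (R 1 (R 4 (R 3 (R 4 (R 2 (R 3 h)))))))"
      by (simp only: comm_nums)
    also have "\<dots> = R 5 (R 6 (R 1 (R 3 (R 4 (R 3 (R 2 (R 3 h)))))))"
      by (simp only: braid_nums(3)[symmetric])
    also have "\<dots> = R 5 (R 6 (R 1 (R 3 (R 4 (R 2 (R 3 (R 2 h)))))))"
      by (simp only: braid_nums(2)[symmetric])
    also have "\<dots> = R 1 (R 3 (R 5 (R 2 (R 4 (R 3 (R 2 (R 6 h)))))))"
      by (simp only: comm_nums)
    finally show ?thesis .
  qed
  have Tens: "R p f \<in> Tens (k + k)" if "f \<in> Tens (k + k)" for p f using that by simp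
  note h = assms(1)
  show ?thesis
    using c
  proof (elim disjE conjE)
    assume "k = 2" "i = 0"
    then show ?thesis using inv[OF h, of 1] by (simp add: shuffle_def braiding_nums)
  next
    assume "k = 3" "i = 0"
    then show ?thesis using inv[OF Tens[OF Tens[OF h]], of 1] by (simp add: shuffle_def braiding_nums e)
  next
    assume "k = 3" "i = 1"
    then show ?thesis using inv[OF Tens[OF Tens[OF h]], of 3]
      by (simp add: shuffle_def braiding_nums e comm_nums(5)[symmetric])
  next
    assume "k = 4" "i = 0"
    then show ?thesis using inv[OF Tens[OF Tens[OF Tens[OF Tens[OF Tens[OF h]]]]], of 1] by (simp add: shuffle_def braiding_nums e4)
  next
    assume ki: "k = 4" "i = 1"
    have "shuffle 4 h = R 3 (R 1 (R 5 (R 2 (R 4 (R 3 h)))))" by (simp add: shuffle_def comm_nums(5))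
    then show ?thesis using ki inv[OF Tens[OF Tens[OF Tens[OF Tens[OF Tens[OF h]]]]], of 3]
      by (simp add: braiding_nums e42) (simp add: shuffle_def)
  next
    assume ki: "k = 4" "i = 2"
    have "shuffle 4 h = R 5 (R 1 (R 3 (R 2 (R 4 (R 3 h)))))" by (simp add: shuffle_def comm_nums)
    then show ?thesis using ki inv[OF Tens[OF Tens[OF Tens[OF Tens[OF Tens[OF h]]]]], of 5]
      by (simp add: braiding_nums e43) (simp add: shuffle_def)
  qed
qed

definition unshuffle :: "nat \<Rightarrow> vec \<Rightarrow> vec" where
  "unshuffle k h = (if k = 2 then Ri 1 h else if k = 3 then Ri 2 (Ri 3 (Ri 1 h))
     else if k = 4 then Ri 3 (Ri 4 (Ri 2 (Ri 5 (Ri 3 (Ri 1 h))))) else h)"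

lemma shuffle_Tens [simp]: "h \<in> Tens n \<Longrightarrow> shuffle k h \<in> Tens n" and unshuffle_Tens [simp]: "h \<in> Tens n \<Longrightarrow> unshuffle k h \<in> Tens n"
  by (simp_all add: shuffle_def unshuffle_def)

lemma shuffle_unshuffle: "h \<in> Tens (k + k) \<Longrightarrow> shuffle k (unshuffle k h) = h" and unshuffle_shuffle: "h \<in> Tens (k + k) \<Longrightarrow> unshuffle k (shuffle k h) = h"
  by (auto simp: shuffle_def unshuffle_def Ri_R[of _ "k + k"])

lemma shuffle_linear: "shuffle k (f + g) = shuffle k f + shuffle k g" "shuffle k (c *v f) = c *v shuffle k f"
  by (simp_all add: shuffle_def)

lemma braiding_linear: "braiding p (f + g) = braiding p f + braiding p g" "braiding p (c *v f) = c *v braiding p f"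
  by (simp_all add: braiding_def Ri_def fun_eq_iff algebra_simps)

lemma braiding_Tens [simp]: "h \<in> Tens n \<Longrightarrow> braiding p h \<in> Tens n"
  by (simp add: braiding_def)

lemma Ri_tensor: "Suc p < k \<Longrightarrow> Ri p (tensor k x y) = tensor k (Ri p x) y" "Ri (k + p) (tensor k x y) = tensor k x (Ri p y)"
  by (simp_all add: Ri_def local_op_tensor_left local_op_tensor_right tensor_linear)

lemma braiding_tensor: "braiding (k + p) (tensor k x y) = tensor k x (braiding p y)" "p + 3 < k \<Longrightarrow> braiding p (tensor k x y) = tensor k (braiding p x) y"
proof -
  show "braiding (k + p) (tensor k x y) = tensor k x (braiding p y)"
    unfolding braiding_def add.assoc Ri_tensor(2) local_op_tensor_right ..
  show "p + 3 < k \<Longrightarrow> braiding p (tensor k x y) = tensor k (braiding p x) y"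
    unfolding braiding_def by (simp add: Ri_tensor(1) local_op_tensor_left)
qed

section \<open>Quadratic relations\<close>

text \<open>The degree \<open>k\<close> part of the ideal generated by \<open>m + braiding 0 m\<close>, spanned by its multiples from
  both sides.\<close>
definition quad_rels :: "nat \<Rightarrow> vec set" where
  "quad_rels k = fv.span {tensor (2 * i) x (tensor 4 (m + braiding 0 m) y) | i j x m y.
     k = i + 2 + j \<and> x \<in> Tens (2 * i) \<and> m \<in> Tens 4 \<and> y \<in> Tens (2 * j)}"

lemma quad_rels_subspace: "fv.subspace (quad_rels k)"
  unfolding quad_rels_def by (rule fv.subspace_span)

lemma quad_rels_base: "x \<in> Tens (2 * i) \<Longrightarrow> m \<in> Tens 4 \<Longrightarrow> y \<in> Tens (2 * j) \<Longrightarrow> k = i + 2 + j \<Longrightarrow>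
    tensor (2 * i) x (tensor 4 (m + braiding 0 m) y) \<in> quad_rels k"
  unfolding quad_rels_def by (intro fv.span_base) blast

lemma braiding_middle: "braiding (2 * i) (tensor (2 * i) x (tensor 4 m y)) = tensor (2 * i) x (tensor 4 (braiding 0 m) y)"
  using braiding_tensor(1)[of "2 * i" 0 x "tensor 4 m y"] braiding_tensor(2)[of 0 4 m y] by simp

lemma braiding_rel_quad_rels:
  assumes "h \<in> Tens (2 * k)" "i + 2 \<le> k"
  shows "h + braiding (2 * i) h \<in> quad_rels k"
proof -
  obtain j where k: "k = i + 2 + j" using assms(2) le_Suc_ex by blast
  have "Tens (2 * k) \<subseteq> {h. h + braiding (2 * i) h \<in> quad_rels k}"
  proof (rule Tens_subset_subspace)
    have a: "f + g + braiding p (f + g) = (f + braiding p f) + (g + braiding p g)" for f g p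
      by (simp add: braiding_linear)
    have b: "c *v f + braiding p (c *v f) = c *v (f + braiding p f)" for c f p
      by (simp add: braiding_linear fv.scale_right_distrib)
    have z: "0 + braiding p 0 = 0" for p using b[of 0 0 p] by simp
    show "fv.subspace {h. h + braiding (2 * i) h \<in> quad_rels k}"
      unfolding fv.subspace_def mem_Collect_eq a b z
      using fv.subspace_0[OF quad_rels_subspace] fv.subspace_add[OF quad_rels_subspace] fv.subspace_scale[OF quad_rels_subspace] by blast
    fix u assume u: "u \<in> words (2 * k)"
    define a b c where "a = take (2 * i) u" and "b = take 4 (drop (2 * i) u)" and "c = drop 4 (drop (2 * i) u)"
    have w: "a \<in> words (2 * i)" "b \<in> words 4" "c \<in> words (2 * j)"
      using u unfolding a_def b_def c_def k by (auto dest: in_set_takeD in_set_dropD)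
    have abc: "u = a @ b @ c" unfolding a_def b_def c_def by (metis append_take_drop_id)
    have "word u = tensor (2 * i) (word a) (tensor 4 (word b) (word c))"
      using w abc tensor_word[of a "b @ c"] tensor_word[of b c] by simp
    then have "word u + braiding (2 * i) (word u) = tensor (2 * i) (word a) (tensor 4 (word b + braiding 0 (word b)) (word c))"
      using braiding_middle by (simp add: tensor_linear)
    then show "word u \<in> {h. h + braiding (2 * i) h \<in> quad_rels k}"
      using quad_rels_base[of "word a" i "word b" "word c" j k] w k by (simp del: word_words)
  qed
  then show ?thesis using assms(1) by blast
qed

text \<open>\<open>shuffle k\<close> is invertible and conjugates the generators of one space into those of the other.\<close>
lemma shuffle_pair_rels:
  assumes "h \<in> Tens (2 * k)" "k \<le> 4"
  shows "shuffle k h \<in> quad_rels k \<longleftrightarrow> h \<in> pair_rels k"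
proof
  have WW: "Tens (k + k) = Tens (2 * k)" by (simp add: mult_2)
  have "pair_rels k \<subseteq> {h. shuffle k h \<in> quad_rels k}"
    unfolding pair_rels_def
  proof (rule fv.span_minimal)
    show "fv.subspace {h. shuffle k h \<in> quad_rels k}"
      unfolding fv.subspace_def mem_Collect_eq shuffle_linear
      using fv.subspace_0[OF quad_rels_subspace] fv.subspace_add[OF quad_rels_subspace] fv.subspace_scale[OF quad_rels_subspace]
        shuffle_linear(2)[of k 0 0] by auto
    show "{h + R i (R (k + i) h) |i h. Suc i < k \<and> h \<in> Tens (k + k)} \<subseteq> {h. shuffle k h \<in> quad_rels k}"
    proof safe
      fix i h assume i: "Suc i < k" and h: "h \<in> Tens (k + k)"
      have "shuffle k h \<in> Tens (2 * k)" using h WW by simp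
      then show "shuffle k (h + R i (R (k + i) h)) \<in> quad_rels k"
        unfolding shuffle_linear shuffle_rel_aux[OF h assms(2) i, symmetric] using i by (intro braiding_rel_quad_rels) auto
    qed
  qed
  then show "h \<in> pair_rels k \<Longrightarrow> shuffle k h \<in> quad_rels k" by blast
  have "quad_rels k \<subseteq> shuffle k ` pair_rels k"
    unfolding quad_rels_def
  proof (rule fv.span_minimal)
    show "fv.subspace (shuffle k ` pair_rels k)"
      unfolding fv.subspace_def
    proof (intro conjI ballI allI)
      have "shuffle k 0 = 0" using shuffle_linear(2)[of k 0 0] by simp
      then show "0 \<in> shuffle k ` pair_rels k" using fv.subspace_0[OF pair_rels_subspace] by (metis imageI)
      show "x + y \<in> shuffle k ` pair_rels k" if "x \<in> shuffle k ` pair_rels k" "y \<in> shuffle k ` pair_rels k" for x y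
        using that fv.subspace_add[OF pair_rels_subspace] by (auto simp: shuffle_linear[symmetric])
      show "c *v x \<in> shuffle k ` pair_rels k" if "x \<in> shuffle k ` pair_rels k" for c x
        using that fv.subspace_scale[OF pair_rels_subspace] by (auto simp: shuffle_linear[symmetric])
    qed
    show "{tensor (2 * i) x (tensor 4 (m + braiding 0 m) y) |i j x m y.
      k = i + 2 + j \<and> x \<in> Tens (2 * i) \<and> m \<in> Tens 4 \<and> y \<in> Tens (2 * j)} \<subseteq> shuffle k ` pair_rels k"
    proof safe
      fix i j x m y assume k: "k = i + 2 + j" and w: "x \<in> Tens (2 * i)" "m \<in> Tens 4" "y \<in> Tens (2 * j)"
      define f where "f = tensor (2 * i) x (tensor 4 m y)"
      have f: "f \<in> Tens (k + k)"
        unfolding f_def k using w by (intro Tens_mem_tensor[of _ "2 * i" _ "4 + 2 * j"] Tens_mem_tensor[of _ 4 _ "2 * j"]) auto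
      define h where "h = unshuffle k f"
      have h: "h \<in> Tens (k + k)" "shuffle k h = f" using f shuffle_unshuffle by (simp_all add: h_def)
      have "tensor (2 * i) x (tensor 4 (m + braiding 0 m) y) = f + braiding (2 * i) f"
        unfolding f_def braiding_middle by (simp add: tensor_linear)
      also have "\<dots> = shuffle k (h + R i (R (k + i) h))"
        using shuffle_rel_aux[OF h(1) assms(2), of i] k h(2) by (simp add: shuffle_linear)
      also have "\<dots> \<in> shuffle k ` pair_rels k"
        unfolding pair_rels_def using h(1) k
        by (intro imageI fv.span_base CollectI exI[of _ i] exI[of _ h] conjI refl) simp_all
      finally show "tensor (2 * i) x (tensor 4 (m + braiding 0 m) y) \<in> shuffle (i + 2 + j) ` pair_rels (i + 2 + j)" by (simp add: k)
    qed
  qed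
  moreover assume "shuffle k h \<in> quad_rels k"
  ultimately obtain h' where h': "h' \<in> pair_rels k" "shuffle k h = shuffle k h'" by blast
  have "pair_rels k \<subseteq> Tens (k + k)"
    unfolding pair_rels_def by (rule fv.span_minimal[OF _ Tens_subspace]) auto
  then have "h' \<in> Tens (k + k)" using h' by blast
  then have "h = h'" using unshuffle_shuffle h'(2) assms(1) WW by metis
  then show "h \<in> pair_rels k" using h' by simp
qed

end

section \<open>Coding of the tensor algebra\<close>
lemma Fr_ops:
  "f \<oplus>\<^bsub>Fr\<^esub> g = f + g" "\<zero>\<^bsub>Fr\<^esub> = 0" "\<one>\<^bsub>Fr\<^esub> = word []"
  "(f \<otimes>\<^bsub>Fr\<^esub> g) w = (\<Sum>i\<le>length w. f (take i w) * g (drop i w))"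
  by (auto simp: free_alg_def plus_fun_def zero_fun_def word_def fun_eq_iff)

lemma homogeneous_iff:
  "f \<in> homogeneous letters k \<longleftrightarrow> (\<forall>w. f w \<noteq> 0 \<longrightarrow> w \<in> lists letters \<and> length w = k)"
proof
  assume *: "\<forall>w. f w \<noteq> 0 \<longrightarrow> w \<in> lists letters \<and> length w = k"
  have "finite {w. set w \<subseteq> letters \<and> length w = k}"
    by (rule finite_lists_length_eq) (simp add: letters_def)
  moreover have "{w. f w \<noteq> 0} \<subseteq> {w. set w \<subseteq> letters \<and> length w = k}" using * by auto
  ultimately have "finite {w. f w \<noteq> 0}" by (rule finite_subset[rotated])
  then show "f \<in> homogeneous letters k" using * by (simp add: homogeneous_def carr_def)
qed (auto simp: homogeneous_def carr_def)

lemma homogeneous_carr: "f \<in> homogeneous letters k \<Longrightarrow> f \<in> carr"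
  by (simp add: homogeneous_def)

lemma homogeneous_mult:
  assumes "f \<in> homogeneous letters i" "g \<in> homogeneous letters j"
  shows "f \<otimes>\<^bsub>Fr\<^esub> g \<in> homogeneous letters (i + j)"
  unfolding homogeneous_iff
proof (intro allI impI)
  fix w assume "(f \<otimes>\<^bsub>Fr\<^esub> g) w \<noteq> 0"
  then obtain n where n: "n \<le> length w" "f (take n w) * g (drop n w) \<noteq> 0"
    unfolding Fr_ops by (meson atMost_iff sum.not_neutral_contains_not_neutral)
  then have "take n w \<in> lists letters \<and> length (take n w) = i" "drop n w \<in> lists letters \<and> length (drop n w) = j"
    using assms unfolding homogeneous_iff by auto
  then show "w \<in> lists letters \<and> length w = i + j"
    using n(1) by (metis append_in_lists_conv append_take_drop_id length_append)
qed

text \<open>The second index is primed, since the second index of \<open>\<theta>\<^sub>i\<^sub>j\<close> transforms under the contragredient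
  corepresentation, and priming identifies that one with \<open>u\<close>.\<close>
fun pairs :: "nat list \<Rightarrow> (nat \<times> nat) list" where
  "pairs (i # j # w) = (i, pr j) # pairs w"
| "pairs _ = []"

primrec flat :: "(nat \<times> nat) list \<Rightarrow> nat list" where
  "flat [] = []"
| "flat (p # ps) = fst p # pr (snd p) # flat ps"

lemma flat_words: "ps \<in> lists letters \<Longrightarrow> flat ps \<in> words (2 * length ps)"
  by (induction ps) (auto simp: letters_def pr_idx)

lemma pairs_flat: "ps \<in> lists letters \<Longrightarrow> pairs (flat ps) = ps"
  by (induction ps) (auto simp: letters_def pr_idx)

lemma flat_pairs:
  "w \<in> words (2 * k) \<Longrightarrow> flat (pairs w) = w \<and> pairs w \<in> lists letters \<and> length (pairs w) = k"
proof (induction k arbitrary: w)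
  case (Suc k)
  then obtain i j v where w: "w = i # j # v" "i \<in> idx" "j \<in> idx" "v \<in> words (2 * k)"
    by (auto simp: length_Suc_conv)
  then show ?case using Suc.IH[OF w(4)] by (simp add: letters_def pr_idx)
qed simp

lemma pairs_take_drop:
  "w \<in> words (2 * k) \<Longrightarrow> pairs (take (2 * i) w) = take i (pairs w) \<and> pairs (drop (2 * i) w) = drop i (pairs w)"
proof (induction i arbitrary: w k)
  case (Suc i)
  show ?case
  proof (cases k)
    case 0
    then show ?thesis using Suc.prems by simp
  next
    case (Suc k')
    then obtain i j v where w: "w = i # j # v" "v \<in> words (2 * k')"
      using Suc.prems by (auto simp: length_Suc_conv)
    then show ?thesis using Suc.IH[OF w(2)] by simp
  qed
qed simp

context generic_q
begin

text \<open>The basis vector \<open>e\<^sub>i \<otimes> e\<^sub>j\<close> of the tensor square of \<open>V\<close> stands for \<open>\<theta>\<close> with indices \<open>i\<close>, \<open>j'\<close>, scaled by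
  \<open>q\<close> to the power \<open>\<rho>\<^sub>j\<close>. This scaling removes the powers of \<open>q\<close> in \<open>Rgrave_eq\<close>.\<close>
fun weight_scale :: "nat list \<Rightarrow> complex" where
  "weight_scale (i # j # w) = s powi (two_rho j) * weight_scale w"
| "weight_scale _ = 1"

lemma weight_scale_nz [simp]: "weight_scale w \<noteq> 0"
  by (induction w rule: weight_scale.induct) simp_all

lemma weight_scale_take_drop: "w \<in> words (2 * k) \<Longrightarrow> weight_scale w = weight_scale (take (2 * i) w) * weight_scale (drop (2 * i) w)"
proof (induction i arbitrary: w k)
  case (Suc i)
  show ?case
  proof (cases k)
    case 0
    then show ?thesis using Suc.prems by simp
  next
    case (Suc k')
    then obtain i j v where w: "w = i # j # v" "v \<in> words (2 * k')"
      using Suc.prems by (auto simp: length_Suc_conv)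
    then show ?thesis using Suc.IH[OF w(2)] by simp
  qed
qed simp

definition encode :: "nat \<Rightarrow> tens \<Rightarrow> vec" where
  "encode k f w = (if w \<in> words (2 * k) then weight_scale w * f (pairs w) else 0)"

definition decode :: "vec \<Rightarrow> tens" where
  "decode h ps = (if ps \<in> lists letters then h (flat ps) / weight_scale (flat ps) else 0)"

lemma encode_Tens [simp]: "encode k f \<in> Tens (2 * k)"
  by (simp add: Tens_def encode_def)

lemma encode_linear: "encode k (f + g) = encode k f + encode k g" "encode k (c *v f) = c *v encode k f"
  by (auto simp: encode_def fun_eq_iff algebra_simps)

lemma decode_linear: "decode (f + g) = decode f + decode g" "decode (c *v f) = c *v decode f"
  by (auto simp: decode_def fun_eq_iff add_divide_distrib)

lemma decode_homogeneous [simp]: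
  assumes "h \<in> Tens (2 * k)"
  shows "decode h \<in> homogeneous letters k"
  unfolding homogeneous_iff
proof (intro allI impI)
  fix w assume nz: "decode h w \<noteq> 0"
  then have w: "w \<in> lists letters" "h (flat w) \<noteq> 0" by (auto simp: decode_def split: if_splits)
  then have "flat w \<in> words (2 * k)" using assms unfolding Tens_def by blast
  then have "length (pairs (flat w)) = k" using flat_pairs by blast
  then show "w \<in> lists letters \<and> length w = k" using w pairs_flat by simp
qed

lemma encode_decode:
  assumes "h \<in> Tens (2 * k)"
  shows "encode k (decode h) = h"
proof (rule Tens_eqI[OF encode_Tens assms])
  fix w assume w: "w \<in> words (2 * k)"
  then show "encode k (decode h) w = h w"
    using flat_pairs[OF w] unfolding encode_def decode_def by (simp del: word_words)
qed

lemma decode_encode: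
  assumes "f \<in> homogeneous letters k"
  shows "decode (encode k f) = f"
proof
  fix w show "decode (encode k f) w = f w"
  proof (cases "f w = 0")
    case True
    have "pairs (flat w) = w" if "w \<in> lists letters" using that by (rule pairs_flat)
    then show ?thesis using True unfolding decode_def encode_def by (simp del: word_words)
  next
    case False
    then have "w \<in> lists letters" "length w = k" using assms unfolding homogeneous_iff by blast+
    then show ?thesis
      using flat_words[of w] pairs_flat[of w] unfolding decode_def encode_def by (simp del: word_words)
  qed
qed

lemma encode_other:
  assumes "f \<in> homogeneous letters k" "j \<noteq> k"
  shows "encode j f = 0"
proof
  fix w show "encode j f w = 0 w"
  proof (cases "w \<in> words (2 * j)")
    case True
    then have "length (pairs w) = j" using flat_pairs by blast
    then have "f (pairs w) = 0" using assms unfolding homogeneous_iff by metis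
    then show ?thesis by (simp add: encode_def)
  qed (simp add: encode_def del: word_words)
qed

lemma encode_mult: "encode k (f \<otimes>\<^bsub>Fr\<^esub> g) = (\<Sum>i\<le>k. tensor (2 * i) (encode i f) (encode (k - i) g))"
proof
  fix w
  have 1: "encode k (f \<otimes>\<^bsub>Fr\<^esub> g) w = (\<Sum>i\<le>k. tensor (2 * i) (encode i f) (encode (k - i) g) w)" if w: "w \<in> words (2 * k)"
  proof -
    have t: "tensor (2 * i) (encode i f) (encode (k - i) g) w = weight_scale w * (f (take i (pairs w)) * g (drop i (pairs w)))"
      if "i \<le> k" for i
    proof -
      have "2 * k = 2 * i + 2 * (k - i)" using that by simp
      then have "take (2 * i) w \<in> words (2 * i)" "drop (2 * i) w \<in> words (2 * (k - i))"
        using w words_append by metis+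
      then show ?thesis
        using pairs_take_drop[OF w] weight_scale_take_drop[OF w, of i] unfolding tensor_def encode_def by (simp del: word_words)
    qed
    have "encode k (f \<otimes>\<^bsub>Fr\<^esub> g) w = weight_scale w * (\<Sum>i\<le>k. f (take i (pairs w)) * g (drop i (pairs w)))"
      using w flat_pairs[OF w] unfolding encode_def Fr_ops by (simp del: word_words)
    then show ?thesis using t by (simp add: sum_distrib_left)
  qed
  have 2: "tensor (2 * i) (encode i f) (encode (k - i) g) \<in> Tens (2 * k)" if "i \<le> k" for i
    using that by (intro Tens_mem_tensor[of _ "2 * i" _ "2 * (k - i)"]) auto
  show "encode k (f \<otimes>\<^bsub>Fr\<^esub> g) w = (\<Sum>i\<le>k. tensor (2 * i) (encode i f) (encode (k - i) g)) w"
  proof (cases "w \<in> words (2 * k)")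
    case True
    then show ?thesis using 1 by (simp add: sum_fun_apply)
  next
    case False
    have "tensor (2 * i) (encode i f) (encode (k - i) g) w = 0" if "i \<le> k" for i
      using 2[OF that] False unfolding Tens_def by blast
    then show ?thesis using False unfolding sum_fun_apply by (simp add: encode_def del: word_words)
  qed
qed

lemma decode_tensor:
  assumes x: "x \<in> Tens (2 * i)" and y: "y \<in> Tens (2 * j)"
  shows "decode (tensor (2 * i) x y) = decode x \<otimes>\<^bsub>Fr\<^esub> decode y"
proof -
  have p: "decode x \<otimes>\<^bsub>Fr\<^esub> decode y \<in> homogeneous letters (i + j)"
    using x y by (intro homogeneous_mult) auto
  have z: "tensor (2 * n) (encode n (decode x)) (encode (i + j - n) (decode y)) = 0" if "n \<noteq> i" for n
    using encode_other[OF decode_homogeneous[OF x] that] by (simp add: tensor_zero_left)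
  have "encode (i + j) (decode x \<otimes>\<^bsub>Fr\<^esub> decode y) = (\<Sum>n\<le>i + j. if n = i then tensor (2 * i) x y else 0)"
    unfolding encode_mult
    by (rule sum.cong) (use z in \<open>auto simp: encode_decode[OF x] encode_decode[OF y]\<close>)
  also have "\<dots> = tensor (2 * i) x y" by simp
  finally show ?thesis using decode_encode[OF p] by simp
qed

section \<open>The second braiding\<close>
lemma sum_pr: "(\<Sum>n\<in>idx. g n) = (\<Sum>n\<in>idx. g (pr n))"
  by (simp add: sum_idx add_ac)

text \<open>The operator \<open>b\<^sub>2\<close> starts from an order of the four factors in which the contragredient ones come last.
  So in its domain the third and fourth indices are primed and scaled, instead of the second and
  fourth as in \<open>encode 2\<close>.\<close>
definition encode_d :: "tens \<Rightarrow> vec" where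
  "encode_d f w = (if w \<in> words 4 then s powi (two_rho (w ! 2) + two_rho (w ! 3))
      * f [(w ! 0, w ! 1), (pr (w ! 2), pr (w ! 3))] else 0)"

definition decode_d :: "vec \<Rightarrow> tens" where
  "decode_d h ps = (case ps of [(i, j), (k, l)] \<Rightarrow> if {i, j, k, l} \<subseteq> idx
     then h [i, j, pr k, pr l] / s powi (two_rho (pr k) + two_rho (pr l)) else 0 | _ \<Rightarrow> 0)"

lemma encode_d_Tens [simp]: "encode_d f \<in> Tens 4"
  unfolding Tens_def encode_d_def by (auto simp del: word_words)

lemma encode_d_eval:
  "i \<in> idx \<Longrightarrow> j \<in> idx \<Longrightarrow> k \<in> idx \<Longrightarrow> l \<in> idx \<Longrightarrow>
    encode_d f [i, j, k, l] = s powi (two_rho k + two_rho l) * f [(i, j), (pr k, pr l)]"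
  by (simp add: encode_d_def numeral_eq_Suc One_nat_def)

lemma encode_d_decode_d:
  assumes "h \<in> Tens 4"
  shows "encode_d (decode_d h) = h"
proof (rule Tens_eqI[OF encode_d_Tens assms])
  fix w assume "w \<in> words 4"
  then obtain i j k l where w: "w = [i, j, k, l]" "i \<in> idx" "j \<in> idx" "k \<in> idx" "l \<in> idx"
    by (rule words4_cases)
  then show "encode_d (decode_d h) w = h w"
    by (simp add: encode_d_eval decode_d_def pr_idx)
qed

lemma homogeneous2I:
  assumes "\<And>i j k l. g [(i, j), (k, l)] \<noteq> 0 \<Longrightarrow> {i, j, k, l} \<subseteq> idx"
    and "\<And>ps. g ps \<noteq> 0 \<Longrightarrow> length ps = 2"
  shows "g \<in> homogeneous letters 2"
  unfolding homogeneous_iff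
proof (intro allI impI)
  fix ps assume nz: "g ps \<noteq> 0"
  then have "length ps = 2" using assms(2) by blast
  then obtain i j k l where ps: "ps = [(i, j), (k, l)]" by (auto simp: numeral_2_eq_2 length_Suc_conv)
  then show "ps \<in> lists letters \<and> length ps = 2" using assms(1) nz by (auto simp: letters_def)
qed

lemma homogeneous2: "decode_d h \<in> homogeneous letters 2" "on_middle T f \<in> homogeneous letters 2"
    "odot T T' f \<in> homogeneous letters 2"
  by (rule homogeneous2I;
    auto simp: decode_d_def on_middle_def odot_def split: list.splits if_splits prod.splits)+

lemma encode2_eval:
  "i \<in> idx \<Longrightarrow> j \<in> idx \<Longrightarrow> k \<in> idx \<Longrightarrow> l \<in> idx \<Longrightarrow>
    encode 2 f [i, j, k, l] = s powi (two_rho j) * s powi (two_rho l) * f [(i, pr j), (k, pr l)]"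
  by (simp add: encode_def)

context
  fixes e S r
  assumes S: "is_antipode s S" and r: "universal_r_form s e r"
begin

lemma encode_on_middle: "encode 2 (on_middle (Rgrave s S r) f) = R 1 (encode_d f)"
proof (rule Tens_eqI[of _ 4])
  show "encode 2 (on_middle (Rgrave s S r) f) \<in> Tens 4" using encode_Tens[of 2] by simp
  show "R 1 (encode_d f) \<in> Tens 4" by simp
  fix w assume "w \<in> words 4"
  then obtain i j k l where w: "w = [i, j, k, l]" and x: "i \<in> idx" "j \<in> idx" "k \<in> idx" "l \<in> idx"
    by (rule words4_cases)
  have "encode 2 (on_middle (Rgrave s S r) f) w
    = s powi (two_rho j) * s powi (two_rho l) * (\<Sum>m\<in>idx. \<Sum>n\<in>idx. Rgrave s S r (pr j) k m n * f [(i, m), (n, pr l)])"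
    using x unfolding w by (simp add: encode2_eval on_middle_def pr_idx)
  also have "\<dots> = (\<Sum>m\<in>idx. \<Sum>n\<in>idx. s powi (two_rho j) * s powi (two_rho l) * (Rgrave s S r (pr j) k m (pr n) * f [(i, m), (pr n, pr l)]))"
    unfolding sum_distrib_left by (subst sum_pr) (rule refl)
  also have "\<dots> = (\<Sum>m\<in>idx. \<Sum>n\<in>idx. Rhat s j k m n * encode_d f [i, m, n, l])"
  proof (intro sum.cong refl)
    fix m n assume mn: "m \<in> idx" "n \<in> idx"
    have "s powi (two_rho j) * s powi (- two_rho j + two_rho n) = s powi two_rho n"
      by (simp add: power_int_add[symmetric])
    then show "s powi (two_rho j) * s powi (two_rho l) * (Rgrave s S r (pr j) k m (pr n) * f [(i, m), (pr n, pr l)])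
      = Rhat s j k m n * encode_d f [i, m, n, l]"
      using x mn by (simp add: encode_d_eval Rgrave_eq[OF s_nz S r] pr_idx power_int_add algebra_simps)
  qed
  also have "\<dots> = R 1 (encode_d f) w"
    unfolding w One_nat_def by (simp add: local_op_0_Cons)
  finally show "encode 2 (on_middle (Rgrave s S r) f) w = R 1 (encode_d f) w" .
qed

lemma encode_odot: "encode_d (odot (Rhat s) (Rcheck s S r) f) = R 0 (R 2 (encode_d f))"
proof (rule Tens_eqI[OF encode_d_Tens])
  show "R 0 (R 2 (encode_d f)) \<in> Tens 4" by simp
  fix w assume "w \<in> words 4"
  then obtain i j k l where w: "w = [i, j, k, l]" and x: "i \<in> idx" "j \<in> idx" "k \<in> idx" "l \<in> idx"
    by (rule words4_cases)
  have "encode_d (odot (Rhat s) (Rcheck s S r) f) w = s powi (two_rho k + two_rho l) *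
    (\<Sum>a\<in>idx. \<Sum>b\<in>idx. \<Sum>c\<in>idx. \<Sum>d\<in>idx. Rhat s i j a b * Rcheck s S r (pr k) (pr l) c d * f [(a, b), (c, d)])"
    using x unfolding w by (simp add: encode_d_eval odot_def pr_idx)
  also have "\<dots> = (\<Sum>a\<in>idx. \<Sum>b\<in>idx. \<Sum>c\<in>idx. \<Sum>d\<in>idx. s powi (two_rho k + two_rho l) *
    (Rhat s i j a b * Rcheck s S r (pr k) (pr l) (pr c) (pr d) * f [(a, b), (pr c, pr d)]))"
    unfolding sum_distrib_left by (rule sum.cong[OF refl], rule sum.cong[OF refl], subst sum_pr, rule sum.cong[OF refl], rule sum_pr)
  also have "\<dots> = (\<Sum>a\<in>idx. \<Sum>b\<in>idx. Rhat s i j a b * (\<Sum>c\<in>idx. \<Sum>d\<in>idx. Rhat s k l c d * encode_d f [a, b, c, d]))"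
    unfolding sum_distrib_left
  proof (intro sum.cong refl)
    fix a b c d assume abcd: "a \<in> idx" "b \<in> idx" "c \<in> idx" "d \<in> idx"
    show "s powi (two_rho k + two_rho l) * (Rhat s i j a b * Rcheck s S r (pr k) (pr l) (pr c) (pr d) * f [(a, b), (pr c, pr d)])
      = Rhat s i j a b * (Rhat s k l c d * encode_d f [a, b, c, d])"
    proof (cases "Rhat s k l c d = 0")
      case False
      then have "k + l = c + d" using Rhat_nz by blast
      then have "two_rho k + two_rho l = two_rho c + two_rho d" by (simp add: two_rho_def)
      then show ?thesis using x abcd by (simp add: encode_d_eval Rcheck_eq[OF s_nz S r] pr_idx)
    qed (use x abcd in \<open>simp add: Rcheck_eq[OF s_nz S r] pr_idx\<close>)
  qed
  also have "\<dots> = R 0 (R 2 (encode_d f)) w"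
    unfolding w by (simp add: local_op_0_Cons numeral_2_eq_2)
  finally show "encode_d (odot (Rhat s) (Rcheck s S r) f) w = R 0 (R 2 (encode_d f)) w" .
qed

text \<open>\<open>inv_into\<close> picks some preimage of \<open>f\<close> under \<open>b\<^sub>2\<close>. As \<open>f\<close> has a preimage by \<open>encode_on_middle\<close>, the code of
  the chosen one is determined.\<close>
lemma encode_sigma:
  assumes "f \<in> homogeneous letters 2"
  shows "encode 2 (sigma_tilde s S r f) = braiding 0 (encode 2 f)"
    and "sigma_tilde s S r f \<in> homogeneous letters 2"
proof -
  let ?b = "on_middle (Rgrave s S r)" and ?H = "homogeneous letters 2"
  define g where "g = inv_into ?H ?b f"
  have F4: "encode 2 f \<in> Tens 4" using encode_Tens[of 2 f] by simp
  have "encode 2 (?b (decode_d (Ri 1 (encode 2 f)))) = encode 2 f"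
    unfolding encode_on_middle using F4 by (simp add: encode_d_decode_d Ri_R(2)[of _ 4])
  then have "?b (decode_d (Ri 1 (encode 2 f))) = f"
    using decode_encode[OF homogeneous2(2)] decode_encode[OF assms] by metis
  then have "f \<in> ?b ` ?H" using homogeneous2(1) by (metis image_eqI)
  then have g: "?b g = f" unfolding g_def by (rule f_inv_into_f)
  have sig: "sigma_tilde s S r f = ?b (odot (Rhat s) (Rcheck s S r) g)"
    by (simp add: sigma_tilde_def Let_def g_def)
  show "sigma_tilde s S r f \<in> ?H" unfolding sig by (rule homogeneous2)
  have gd: "encode_d g = Ri 1 (encode 2 f)"
    unfolding g[symmetric] encode_on_middle by (simp add: Ri_R(1)[of _ 4])
  have "encode 2 (sigma_tilde s S r f) = R 1 (R 0 (R 2 (Ri 1 (encode 2 f))))"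
    unfolding sig encode_on_middle encode_odot gd ..
  then show "encode 2 (sigma_tilde s S r f) = braiding 0 (encode 2 f)" by (simp add: braiding_nums)
qed

end

section \<open>The defining ideal and the dimensions\<close>
lemma quad_rels_tensor_left:
  assumes x: "x \<in> Tens (2 * i)" and y: "y \<in> quad_rels j"
  shows "tensor (2 * i) x y \<in> quad_rels (i + j)"
proof -
  have "quad_rels j \<subseteq> {y. tensor (2 * i) x y \<in> quad_rels (i + j)}"
    unfolding quad_rels_def[of j]
  proof (rule fv.span_minimal)
    show "fv.subspace {y. tensor (2 * i) x y \<in> quad_rels (i + j)}"
      unfolding fv.subspace_def mem_Collect_eq tensor_linear
      using fv.subspace_0[OF quad_rels_subspace] fv.subspace_add[OF quad_rels_subspace] fv.subspace_scale[OF quad_rels_subspace] by blast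
    show "{tensor (2 * a) u (tensor 4 (m + braiding 0 m) v) |a b u m v.
       j = a + 2 + b \<and> u \<in> Tens (2 * a) \<and> m \<in> Tens 4 \<and> v \<in> Tens (2 * b)} \<subseteq> {y. tensor (2 * i) x y \<in> quad_rels (i + j)}"
    proof safe
      fix a b u m v assume *: "j = a + 2 + b" "u \<in> Tens (2 * a)" "m \<in> Tens 4" "v \<in> Tens (2 * b)"
      have "tensor (2 * i) x (tensor (2 * a) u (tensor 4 (m + braiding 0 m) v)) = tensor (2 * (i + a)) (tensor (2 * i) x u) (tensor 4 (m + braiding 0 m) v)"
        by (simp only: tensor_assoc distrib_left)
      also have "\<dots> \<in> quad_rels (i + (a + 2 + b))"
        using * x by (intro quad_rels_base[of _ _ _ _ b] Tens_mem_tensor[of _ "2 * i" _ "2 * a"]) auto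
      finally show "tensor (2 * i) x (tensor (2 * a) u (tensor 4 (m + braiding 0 m) v)) \<in> quad_rels (i + (a + 2 + b))" .
    qed
  qed
  then show ?thesis using y by blast
qed

lemma quad_rels_tensor_right:
  assumes x: "x \<in> quad_rels i" and y: "y \<in> Tens (2 * j)"
  shows "tensor (2 * i) x y \<in> quad_rels (i + j)"
proof -
  have "quad_rels i \<subseteq> {x. tensor (2 * i) x y \<in> quad_rels (i + j)}"
    unfolding quad_rels_def[of i]
  proof (rule fv.span_minimal)
    show "fv.subspace {x. tensor (2 * i) x y \<in> quad_rels (i + j)}"
      unfolding fv.subspace_def mem_Collect_eq tensor_linear
      using fv.subspace_0[OF quad_rels_subspace] fv.subspace_add[OF quad_rels_subspace] fv.subspace_scale[OF quad_rels_subspace] by blast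
    show "{tensor (2 * a) u (tensor 4 (m + braiding 0 m) v) |a b u m v.
       i = a + 2 + b \<and> u \<in> Tens (2 * a) \<and> m \<in> Tens 4 \<and> v \<in> Tens (2 * b)} \<subseteq> {x. tensor (2 * i) x y \<in> quad_rels (i + j)}"
    proof safe
      fix a b u m v assume *: "i = a + 2 + b" "u \<in> Tens (2 * a)" "m \<in> Tens 4" "v \<in> Tens (2 * b)"
      have "2 * (a + 2 + b) = 2 * a + (4 + 2 * b)" by simp
      then have "tensor (2 * (a + 2 + b)) (tensor (2 * a) u (tensor 4 (m + braiding 0 m) v)) y = tensor (2 * a) u (tensor 4 (m + braiding 0 m) (tensor (2 * b) v y))"
        by (simp only: tensor_assoc)
      also have "\<dots> \<in> quad_rels (a + 2 + b + j)"
        using * y by (intro quad_rels_base[of _ _ _ _ "b + j"] Tens_mem_tensor[of _ "2 * b" _ "2 * j"]) auto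
      finally show "tensor (2 * (a + 2 + b)) (tensor (2 * a) u (tensor 4 (m + braiding 0 m) v)) y \<in> quad_rels (a + 2 + b + j)" .
    qed
  qed
  then show ?thesis using x by blast
qed

lemma scalar_mult: "(\<lambda>w. c * word [] w) \<otimes>\<^bsub>Fr\<^esub> f = c *v f" if "f \<in> carr"
proof
  fix w
  have "((\<lambda>w. c * word [] w) \<otimes>\<^bsub>Fr\<^esub> f) w = c * (word [] \<otimes>\<^bsub>Fr\<^esub> f) w"
    by (simp add: Fr_ops sum_distrib_left mult.assoc)
  also have "word [] \<otimes>\<^bsub>Fr\<^esub> f = f" using Fr.l_one[OF that] by (simp add: Fr_ops)
  finally show "((\<lambda>w. c * word [] w) \<otimes>\<^bsub>Fr\<^esub> f) w = (c *v f) w" by simp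
qed

lemma scalar_carr: "(\<lambda>w. c * word [] w) \<in> carr"
  by (intro carr_intros(3) carr_word) simp

lemma ideal_subspace:
  assumes "ideal J Fr"
  shows "fv.subspace J"
proof -
  interpret J: ideal J Fr by fact
  show ?thesis
    unfolding fv.subspace_def
  proof (intro conjI ballI allI)
    show "0 \<in> J" using J.zero_closed by (simp add: Fr_ops)
    show "f + g \<in> J" if "f \<in> J" "g \<in> J" for f g using J.a_closed[OF that] by (simp add: Fr_ops)
    show "c *v f \<in> J" if "f \<in> J" for c f
      using J.I_l_closed[OF that scalar_carr[of c]] scalar_mult[OF J.Icarr[OF that]] by simp
  qed
qed

lemma Fr_neg: "f \<in> carr \<Longrightarrow> \<ominus>\<^bsub>Fr\<^esub> f = - f"
proof -
  assume f: "f \<in> carr"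
  have "- f \<in> carr" using fv.subspace_neg[OF carr_subspace f] .
  then show ?thesis using f by (intro Fr.minus_equality) (simp_all add: Fr_ops)
qed

text \<open>This ideal contains the generators of \<open>wedge_ideal\<close>, which bounds that ideal from above.\<close>
lemma quad_rels_ideal: "ideal {f \<in> carr. \<forall>k. encode k f \<in> quad_rels k} Fr"
proof (rule idealI[OF ring_free_alg])
  note qs = fv.subspace_0[OF quad_rels_subspace] fv.subspace_add[OF quad_rels_subspace] fv.subspace_scale[OF quad_rels_subspace]
  have neg: "encode k (- f) = (- 1) *v encode k f" for k f
  proof -
    have "- f = (- 1) *v f" by (simp add: fun_eq_iff)
    then show ?thesis using encode_linear(2)[of k "- 1" f] by metis
  qed
  show "subgroup {f \<in> carr. \<forall>k. encode k f \<in> quad_rels k} (add_monoid Fr)"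
  proof (rule Fr.add.subgroupI)
    have "encode k 0 = 0" for k using encode_linear(2)[of k 0 0] by simp
    then have "0 \<in> {f \<in> carr. \<forall>k. encode k f \<in> quad_rels k}"
      using qs(1) fv.subspace_0[OF carr_subspace] by simp
    then show "{f \<in> carr. \<forall>k. encode k f \<in> quad_rels k} \<noteq> {}" by blast
    fix f assume f: "f \<in> {f \<in> carr. \<forall>k. encode k f \<in> quad_rels k}"
    then show "\<ominus>\<^bsub>Fr\<^esub> f \<in> {f \<in> carr. \<forall>k. encode k f \<in> quad_rels k}"
      using Fr_neg[of f] neg fv.subspace_neg[OF quad_rels_subspace] fv.subspace_neg[OF carr_subspace] by auto
    fix g assume "g \<in> {f \<in> carr. \<forall>k. encode k f \<in> quad_rels k}"
    then show "f \<oplus>\<^bsub>Fr\<^esub> g \<in> {f \<in> carr. \<forall>k. encode k f \<in> quad_rels k}"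
      using f qs(2) fv.subspace_add[OF carr_subspace] by (auto simp: Fr_ops encode_linear)
  qed auto
  fix f g assume f: "f \<in> {f \<in> carr. \<forall>k. encode k f \<in> quad_rels k}" and g: "g \<in> carr"
  have "encode k (g \<otimes>\<^bsub>Fr\<^esub> f) \<in> quad_rels k" for k
    unfolding encode_mult
  proof (rule fv.subspace_sum[OF quad_rels_subspace])
    fix i assume "i \<in> {..k}"
    then show "tensor (2 * i) (encode i g) (encode (k - i) f) \<in> quad_rels k"
      using quad_rels_tensor_left[OF encode_Tens, of "encode (k - i) f" "k - i" i g] f by simp
  qed
  then show "g \<otimes>\<^bsub>Fr\<^esub> f \<in> {f \<in> carr. \<forall>k. encode k f \<in> quad_rels k}" using f g by simp
  have "encode k (f \<otimes>\<^bsub>Fr\<^esub> g) \<in> quad_rels k" for k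
    unfolding encode_mult
  proof (rule fv.subspace_sum[OF quad_rels_subspace])
    fix i assume "i \<in> {..k}"
    then show "tensor (2 * i) (encode i f) (encode (k - i) g) \<in> quad_rels k"
      using quad_rels_tensor_right[OF _ encode_Tens, of "encode i f" i "k - i" g] f by simp
  qed
  then show "f \<otimes>\<^bsub>Fr\<^esub> g \<in> {f \<in> carr. \<forall>k. encode k f \<in> quad_rels k}" using f g by simp
qed

context
  fixes e S r
  assumes S: "is_antipode s S" and r: "universal_r_form s e r"
begin

abbreviation I where "I \<equiv> wedge_ideal s S r"

lemma gens_carr: "(\<lambda>f. f \<oplus>\<^bsub>Fr\<^esub> sigma_tilde s S r f) ` homogeneous letters 2 \<subseteq> carr"
  using encode_sigma(2)[OF S r] homogeneous_carr by auto

lemma I_ideal: "ideal I Fr"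
  unfolding wedge_ideal_def by (rule Fr.genideal_ideal[OF gens_carr])

lemma encode_wedge_ideal: "f \<in> I \<Longrightarrow> encode k f \<in> quad_rels k"
proof -
  have "I \<subseteq> {f \<in> carr. \<forall>k. encode k f \<in> quad_rels k}"
    unfolding wedge_ideal_def
  proof (rule Fr.genideal_minimal[OF quad_rels_ideal], safe)
    fix f assume f: "f \<in> homogeneous letters 2"
    note sf = encode_sigma[OF S r f]
    show "f \<oplus>\<^bsub>Fr\<^esub> sigma_tilde s S r f \<in> carr"
      using f sf(2) homogeneous_carr by auto
    fix k
    show "encode k (f \<oplus>\<^bsub>Fr\<^esub> sigma_tilde s S r f) \<in> quad_rels k"
    proof (cases "k = 2")
      case True
      show ?thesis
        unfolding Fr_ops encode_linear True sf(1) using braiding_rel_quad_rels[of "encode 2 f" 2 0] encode_Tens[of 2 f] by simp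
    next
      case False
      then show ?thesis
        unfolding Fr_ops encode_linear using encode_other[OF f] encode_other[OF sf(2)] fv.subspace_0[OF quad_rels_subspace] by simp
    qed
  qed
  then show "f \<in> I \<Longrightarrow> encode k f \<in> quad_rels k" by blast
qed

lemma decode_wedge_ideal:
  assumes "x \<in> quad_rels k"
  shows "decode x \<in> I"
proof -
  interpret I: ideal I Fr by (rule I_ideal)
  note sub = ideal_subspace[OF I_ideal]
  have "quad_rels k \<subseteq> {x. decode x \<in> I}"
    unfolding quad_rels_def
  proof (rule fv.span_minimal)
    have "decode 0 = 0" using decode_linear(2)[of 0 0] by simp
    then show "fv.subspace {x. decode x \<in> I}"
      unfolding fv.subspace_def mem_Collect_eq decode_linear
      using fv.subspace_0[OF sub] fv.subspace_add[OF sub] fv.subspace_scale[OF sub] by simp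
    show "{tensor (2 * a) u (tensor 4 (m + braiding 0 m) v) |a b u m v.
       k = a + 2 + b \<and> u \<in> Tens (2 * a) \<and> m \<in> Tens 4 \<and> v \<in> Tens (2 * b)} \<subseteq> {x. decode x \<in> I}"
    proof safe
      fix a b u m v assume *: "u \<in> Tens (2 * a)" "m \<in> Tens 4" "v \<in> Tens (2 * b)"
      have m4: "m \<in> Tens (2 * 2)" using * by simp
      have f: "decode m \<in> homogeneous letters 2" using m4 by (rule decode_homogeneous)
      have "encode 2 (sigma_tilde s S r (decode m)) = braiding 0 m"
        using encode_sigma(1)[OF S r f] encode_decode[OF m4] by simp
      then have "sigma_tilde s S r (decode m) = decode (braiding 0 m)"
        using decode_encode[OF encode_sigma(2)[OF S r f]] by simp
      then have "decode (m + braiding 0 m) = decode m \<oplus>\<^bsub>Fr\<^esub> sigma_tilde s S r (decode m)"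
        by (simp add: decode_linear Fr_ops)
      then have g: "decode (m + braiding 0 m) \<in> I"
        using Fr.genideal_self[OF gens_carr] f unfolding wedge_ideal_def by auto
      have w: "m + braiding 0 m \<in> Tens (2 * 2)" "tensor 4 (m + braiding 0 m) v \<in> Tens (2 * (2 + b))"
        using * by (auto intro!: Tens_mem_tensor[of _ 4 _ "2 * b"])
      have "decode (tensor (2 * a) u (tensor 4 (m + braiding 0 m) v)) = decode u \<otimes>\<^bsub>Fr\<^esub> (decode (m + braiding 0 m) \<otimes>\<^bsub>Fr\<^esub> decode v)"
        using decode_tensor[OF *(1) w(2)] decode_tensor[OF w(1) *(3)] by simp
      also have "\<dots> \<in> I"
        using I.I_l_closed[OF I.I_r_closed[OF g homogeneous_carr[OF decode_homogeneous[OF *(3)]]]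
            homogeneous_carr[OF decode_homogeneous[OF *(1)]]] .
      finally show "decode (tensor (2 * a) u (tensor 4 (m + braiding 0 m) v)) \<in> I" .
    qed
  qed
  then show ?thesis using assms by blast
qed

text \<open>In \<open>h\<close> the first tensor factors of all copies of \<open>\<Gamma>\<^sub>L\<close> precede the second ones.\<close>
definition cls :: "nat \<Rightarrow> vec \<Rightarrow> tens set" where
  "cls k h = I +>\<^bsub>Fr\<^esub> decode (shuffle k h)"

lemma decode_shuffle_homogeneous: "h \<in> Tens (2 * k) \<Longrightarrow> decode (shuffle k h) \<in> homogeneous letters k"
  by simp

lemma decode_shuffle_carr: "h \<in> Tens (2 * k) \<Longrightarrow> decode (shuffle k h) \<in> carr"
  by (rule homogeneous_carr[OF decode_shuffle_homogeneous])

lemma cls_carrier: "h \<in> Tens (2 * k) \<Longrightarrow> cls k h \<in> carrier (wedge_alg s S r)"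
  using ring_hom_closed[OF ideal.rcos_ring_hom[OF I_ideal] decode_shuffle_carr]
  unfolding cls_def wedge_alg_def .

lemma cls_add:
  "h \<in> Tens (2 * k) \<Longrightarrow> h' \<in> Tens (2 * k) \<Longrightarrow> cls k (h + h') = cls k h \<oplus>\<^bsub>wedge_alg s S r\<^esub> cls k h'"
  using ring_hom_add[OF ideal.rcos_ring_hom[OF I_ideal] decode_shuffle_carr decode_shuffle_carr]
  unfolding cls_def wedge_alg_def shuffle_linear decode_linear Fr_ops by simp

lemma cls_scale:
  "h \<in> Tens (2 * k) \<Longrightarrow> cls k (c *v h) = scalar letters I c \<otimes>\<^bsub>wedge_alg s S r\<^esub> cls k h"
  using ring_hom_mult[OF ideal.rcos_ring_hom[OF I_ideal] scalar_carr decode_shuffle_carr, of h k c]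
  unfolding cls_def wedge_alg_def shuffle_linear decode_linear scalar_def by (simp add: scalar_mult[OF decode_shuffle_carr])

lemma cls_eq_iff:
  assumes "h \<in> Tens (2 * k)" "h' \<in> Tens (2 * k)" "k \<le> 4"
  shows "cls k h = cls k h' \<longleftrightarrow> h - h' \<in> pair_rels k"
proof -
  note c = decode_shuffle_carr[OF assms(1)] decode_shuffle_carr[OF assms(2)]
  have d: "h - h' = h + (- 1) *v h'" by (simp add: fun_eq_iff)
  have shuffle_h: "shuffle k (h - h') \<in> Tens (2 * k)" using assms by simp
  have "decode (shuffle k h) \<ominus>\<^bsub>Fr\<^esub> decode (shuffle k h') = decode (shuffle k (h - h'))"
    unfolding a_minus_def Fr_neg[OF c(2)] d shuffle_linear decode_linear by (simp add: Fr_ops fun_eq_iff)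
  moreover have "decode (shuffle k (h - h')) \<in> I \<longleftrightarrow> shuffle k (h - h') \<in> quad_rels k"
    using encode_wedge_ideal[of _ k] decode_wedge_ideal encode_decode[OF shuffle_h] by metis
  ultimately show ?thesis
    unfolding cls_def using Fr.quotient_eq_iff_same_a_r_cos[OF I_ideal c] shuffle_pair_rels[of "h - h'" k] assms by simp
qed

lemma wedge_comp_cls: "wedge_comp s S r k = cls k ` Tens (2 * k)"
proof
  show "cls k ` Tens (2 * k) \<subseteq> wedge_comp s S r k"
    unfolding wedge_comp_def cls_def using decode_shuffle_homogeneous by blast
  show "wedge_comp s S r k \<subseteq> cls k ` Tens (2 * k)"
    unfolding wedge_comp_def
  proof safe
    fix f assume f: "f \<in> homogeneous letters k"
    have "encode k f \<in> Tens (k + k)" using encode_Tens[of k f] by (simp add: mult_2)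
    then have "decode (shuffle k (unshuffle k (encode k f))) = f" using shuffle_unshuffle decode_encode[OF f] by simp
    then have "I +>\<^bsub>Fr\<^esub> f = cls k (unshuffle k (encode k f))" by (simp add: cls_def)
    then show "I +>\<^bsub>Fr\<^esub> f \<in> cls k ` Tens (2 * k)" by simp
  qed
qed

text \<open>The classes of the elements of \<open>G\<close> are adjoined one after the other. The class of a new \<open>g\<close> is not in
  the span of the previous ones, because pairing with \<open>g\<close> kills the relations and the previous
  elements, but not \<open>g\<close>.\<close>
lemma wedge_dim_dual_system:
  assumes G: "dual_system k G" and k: "k \<le> 4"
  shows "wedge_dim s S r k (card G)"
proof -
  interpret Q: ring "wedge_alg s S r"
    unfolding wedge_alg_def by (rule ideal.quotient_is_ring[OF I_ideal])
  let ?K = "wedge_scalars s S r"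
  have WW: "Tens (k + k) = Tens (2 * k)" by (simp add: mult_2)
  have GW: "G \<subseteq> Tens (2 * k)" and fin: "finite G"
    using G WW unfolding dual_system_def by simp_all
  have spW: "fv.span F \<subseteq> Tens (2 * k)" if "F \<subseteq> G" for F
    using that GW by (intro fv.span_minimal Tens_subspace) blast
  define D where "D F \<longleftrightarrow> Q.dimension (card F) ?K (cls k ` fv.span F)" for F
  have D_empty: "D {}"
  proof -
    have c: "cls k 0 \<in> carrier (wedge_alg s S r)" by (rule cls_carrier) simp
    have "cls k 0 \<oplus>\<^bsub>wedge_alg s S r\<^esub> cls k 0 = cls k 0"
      using cls_add[of 0 k 0] by simp
    then have "cls k 0 = \<zero>\<^bsub>wedge_alg s S r\<^esub>" using Q.add.l_cancel_one[OF c c] by simp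
    then show ?thesis by (simp add: D_def)
  qed
  have D_insert: "D (insert g F)" if gF: "g \<in> G" "F \<subseteq> G" and new: "finite F" "g \<notin> F" and DF: "D F" for g F
  proof -
    have gW: "g \<in> Tens (2 * k)" and FW: "fv.span F \<subseteq> Tens (2 * k)" using gF GW spW by blast+
    have "cls k g \<notin> cls k ` fv.span F"
    proof
      assume "cls k g \<in> cls k ` fv.span F"
      then obtain x where x: "x \<in> fv.span F" "cls k g = cls k x" by blast
      then have "g - x \<in> pair_rels k" using cls_eq_iff[OF gW _ k] FW by blast
      then have "form (k + k) g (g - x) = 0" using G gF(1) unfolding dual_system_def by blast
      moreover have "fv.span F \<subseteq> {x. form (k + k) g x = 0}"
      proof (rule fv.span_minimal)
        show "F \<subseteq> {x. form (k + k) g x = 0}"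
        proof
          fix x assume "x \<in> F"
          then have "x \<in> G" "g \<noteq> x" using gF(2) new(2) by blast+
          then show "x \<in> {x. form (k + k) g x = 0}"
            using G gF(1) unfolding dual_system_def by simp
        qed
        show "fv.subspace {x. form (k + k) g x = 0}" by (auto simp: fv.subspace_def form_linear)
      qed
      ultimately have "form (k + k) g g = 0" using x(1) by (auto simp: form_linear)
      then show False using G gF(1) unfolding dual_system_def by blast
    qed
    then have "Q.dimension (Suc (card F)) ?K (Q.line_extension ?K (cls k g) (cls k ` fv.span F))"
      using DF cls_carrier[OF gW] unfolding D_def by (intro Q.Suc_dim)
    moreover have "Q.line_extension ?K (cls k g) (cls k ` fv.span F) = cls k ` fv.span (insert g F)"
    proof -
      have 1: "scalar letters I c \<otimes>\<^bsub>wedge_alg s S r\<^esub> cls k g \<oplus>\<^bsub>wedge_alg s S r\<^esub> cls k x = cls k (c *v g + x)"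
        if "x \<in> fv.span F" for c x
        using cls_add[of "c *v g" k x] cls_scale[OF gW] gW FW that by auto
      show ?thesis
      proof (intro equalityI subsetI)
        fix u assume "u \<in> Q.line_extension ?K (cls k g) (cls k ` fv.span F)"
        then obtain c x where "x \<in> fv.span F" "u = scalar letters I c \<otimes>\<^bsub>wedge_alg s S r\<^esub> cls k g \<oplus>\<^bsub>wedge_alg s S r\<^esub> cls k x"
          unfolding Q.line_extension_mem_iff wedge_scalars_def by blast
        moreover have "c *v g + x \<in> fv.span (insert g F)" if "x \<in> fv.span F"
          using that fv.span_breakdown_eq[of "c *v g + x" g F] by (intro iffD2[OF fv.span_breakdown_eq] exI[of _ c]) simp
        ultimately show "u \<in> cls k ` fv.span (insert g F)" using 1 by auto
      next
        fix u assume "u \<in> cls k ` fv.span (insert g F)"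
        then obtain y where y: "y \<in> fv.span (insert g F)" "u = cls k y" by blast
        then obtain c where c: "y - c *v g \<in> fv.span F" using fv.span_breakdown_eq by metis
        have "u = scalar letters I c \<otimes>\<^bsub>wedge_alg s S r\<^esub> cls k g \<oplus>\<^bsub>wedge_alg s S r\<^esub> cls k (y - c *v g)"
          unfolding 1[OF c] y(2) by simp
        then show "u \<in> Q.line_extension ?K (cls k g) (cls k ` fv.span F)"
          unfolding Q.line_extension_mem_iff wedge_scalars_def using c by blast
      qed
    qed
    ultimately show ?thesis using new unfolding D_def by simp
  qed
  have "D F" if "F \<subseteq> G" for F
    using finite_subset[OF that fin] that by (induction F) (simp_all add: D_empty D_insert)
  then have dim: "Q.dimension (card G) ?K (cls k ` fv.span G)" unfolding D_def by blast
  have "wedge_comp s S r k = cls k ` fv.span G"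
  proof
    show "cls k ` fv.span G \<subseteq> wedge_comp s S r k"
      unfolding wedge_comp_cls using spW by blast
    show "wedge_comp s S r k \<subseteq> cls k ` fv.span G"
      unfolding wedge_comp_cls
    proof safe
      fix h assume h: "h \<in> Tens (2 * k)"
      have "Tens (k + k) \<subseteq> fv.span (pair_rels k \<union> G)"
        using G fv.span_superset[of "pair_rels k \<union> G"] fv.subspace_span unfolding dual_system_def by blast
      then have "h \<in> fv.span (pair_rels k \<union> G)" using h WW by blast
      then obtain x y where xy: "h = x + y" "x \<in> fv.span (pair_rels k)" "y \<in> fv.span G"
        unfolding fv.span_Un by blast
      then have "h - y \<in> pair_rels k" using fv.span_eq_iff[THEN iffD2, OF pair_rels_subspace, of k] by simp
      then have "cls k h = cls k y" using cls_eq_iff[OF h _ k] xy(3) spW by blast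
      then show "cls k h \<in> cls k ` fv.span G" using xy(3) by blast
    qed
  qed
  then show ?thesis using dim unfolding wedge_dim_def by simp
qed

end

lemma degree4: "dual_system 4 {}"
  unfolding dual_system_def using degree4_cover by simp

end

theorem mainTheorem4:
  fixes q s :: complex
    and e :: "tens set \<Rightarrow> complex"
    and S :: "tens set \<Rightarrow> tens set"
    and r :: "tens set \<Rightarrow> tens set \<Rightarrow> complex"
  assumes "\<not> algebraic q"
    and "s\<^sup>2 = q"
    and "is_counit s e"
    and "is_antipode s S"
    and "universal_r_form s e r"
  shows "wedge_dim s S r 0 1 \<and> wedge_dim s S r 1 9 \<and> wedge_dim s S r 2 30
    \<and> wedge_dim s S r 3 39 \<and> wedge_dim s S r 4 0"
proof -
  interpret generic_q s by unfold_locales (use assms(1,2) in simp)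
  note wd = wedge_dim_dual_system[OF assms(4,5)]
  have "wedge_dim s S r k (card (words (k + k)))" if "k \<le> 1" for k
    using wd[of k "word ` words (k + k)"] degree_small[OF that] that by simp
  from this[of 0] this[of 1] have "wedge_dim s S r 0 1" "wedge_dim s S r 1 9"
    by (simp_all add: card_words One_nat_def)
  moreover have "wedge_dim s S r 2 30" "wedge_dim s S r 3 39"
    using degree2 degree3 wd[of 2] wd[of 3] by force+
  moreover have "wedge_dim s S r 4 0" using wd[OF degree4] by simp
  ultimately show ?thesis by simp
qed

end
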